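(* Let $q$ be an odd prime power. If two nets of conics of rank one in $\mathrm{PG}(2,q)$ have the same line-orbit distribution, then they belong to the same orbit under the natural action of $\mathrm{PGL}(3,q)$ on nets of conics.
   Context: Throughout, $q$ is an odd prime power and $\mathbb{F}_q$ is the field with $q$ elements. Nets and planes. A net of conics in $\mathrm{PG}(2,q)$ is a two-dimensional linear system of conics, i.e. the projective plane of a $3$-dimensional subspace of the space of ternary quadratic forms over $\mathbb{F}_q$. The net has rank one if it contains a repeated line (a nonzero form that is a scalar multiple of the square of a linear form). $\mathrm{PGL}(3,q)$ acts on nets by linear changes of coordinates. Points of $\mathrm{PG}(5,q)$ are represented by nonzero symmetric $3\times 3$ matrices over $\mathbb{F}_q$ up to scalars, so lines and planes of $\mathrm{PG}(5,q)$ are $2$- and $3$-dimensional subspaces of the space of symmetric $3\times 3$ matrices. Associating to a conic the Gram matrix of its quadratic form, nets correspond to planes of $\mathrm{PG}(5,q)$. A net has rank one iff the corresponding plane contains a point represented by a matrix of rank $1$. Group action. $K\cong \mathrm{PGL}(3,q)$ acts on $\mathrm{PG}(5,q)$ by $M\mapsto AMA^T$, $A\in\mathrm{GL}(3,q)$. Two nets are in the same $\mathrm{PGL}(3,q)$-orbit iff the corresponding planes are in the same $K$-orbit. Line orbits. It is known (Dickson; Lavrauw–Popiel) that there are exactly $15$ $K$-orbits of lines of $\mathrm{PG}(5,q)$, with the following representatives, where $(\alpha,\beta)$ ranges over $\mathbb{F}_q^2\setminus\{(0,0)\}$, rows are separated by semicolons, and $\varepsilon$ is a (fixed, arbitrary)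 non-square in $\mathbb{F}_q$. $o_5$: $\mathrm{diag}(\alpha,\beta,0)$. $o_6$: $[\alpha,\beta,0;\ \beta,0,0;\ 0,0,0]$. $o_{8,1}$: $\mathrm{diag}(\alpha,\beta,-\beta)$. $o_{8,2}$: $\mathrm{diag}(\alpha,\beta,-\varepsilon\beta)$. $o_9$: $[\alpha,0,\beta;\ 0,\beta,0;\ \beta,0,0]$. $o_{10}$: $[v\alpha,\beta,0;\ \beta,\alpha+u\beta,0;\ 0,0,0]$, with $u,v$ satisfying ($*$). $o_{12}$: $[0,\alpha,0;\ \alpha,0,\beta;\ 0,\beta,0]$. $o_{13,1}$: $[0,\alpha,0;\ \alpha,\beta,0;\ 0,0,-\beta]$. $o_{13,2}$: $[0,\alpha,0;\ \alpha,\beta,0;\ 0,0,-\varepsilon\beta]$. $o_{14,1}$: $\mathrm{diag}(\alpha,-(\alpha+\beta),\beta)$. $o_{14,2}$: $\mathrm{diag}(\alpha,-\varepsilon(\alpha+\beta),\beta)$. $o_{15,1}$: $[v\beta,\alpha,0;\ \alpha,u\alpha+\beta,0;\ 0,0,\alpha]$, with $u,v$ satisfying ($*$) and $-v$ a square. $o_{15,2}$: the same matrix form, with $u,v$ satisfying ($*$) and $-v$ a non-square. $o_{16}$: $[0,0,\alpha;\ 0,\alpha,\beta;\ \alpha,\beta,0]$. $o_{17}$: $[v^{-1}\alpha,\beta,0;\ \beta,u\beta-w\alpha,\alpha;\ 0,\alpha,\beta]$, with $u,v,w$ satisfying ($**$). Condition ($*$): $v\neq 0$ and $v\lambda^2+uv\lambda-1\neq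 0$ for all $\lambda\in\mathbb{F}_q$. Condition ($**$): $\lambda^3+w\lambda^2-u\lambda+v\neq 0$ for all $\lambda\in\mathbb{F}_q$. The line-orbit distribution of a plane $\pi$ of $\mathrm{PG}(5,q)$ is the list of the numbers of lines contained in $\pi$ belonging to each of these $15$ $K$-orbits of lines; the line-orbit distribution of a net is that of the corresponding plane. *)

theory Defs
  imports
    "HOL-Analysis.Determinants"
    "HOL-Library.Function_Algebras"
    "HOL-Computational_Algebra.Nth_Powers"
begin

section \<open>Nets of conics\<close>

type_synonym 'a mat3 = "'a^3^3"

text \<open>
  A ternary quadratic form is represented by its polynomial function. In characteristic other
  than 2 nothing is lost by this: lemma \<open>gram_eqI\<close> below recovers the coefficients.
\<close>

definition quadratic_form :: "('a::field^3 \<Rightarrow> 'a) \<Rightarrow> bool" where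
  "quadratic_form Q \<longleftrightarrow>
     (\<exists>C::'a mat3. \<forall>x. Q x = (\<Sum>i\<in>UNIV. \<Sum>j\<in>UNIV. C $ i $ j * x $ i * x $ j))"

definition form_scale :: "'a::field \<Rightarrow> ('a^3 \<Rightarrow> 'a) \<Rightarrow> ('a^3 \<Rightarrow> 'a)" where
  "form_scale c Q = (\<lambda>x. c * Q x)"

interpretation forms: vector_space "form_scale :: 'a::field \<Rightarrow> _"
  by unfold_locales (simp_all add: form_scale_def fun_eq_iff distrib_left distrib_right mult.assoc)

definition net_of_conics :: "('a::field^3 \<Rightarrow> 'a) set \<Rightarrow> bool" where
  "net_of_conics N \<longleftrightarrow> N \<subseteq> Collect quadratic_form \<and> forms.subspace N \<and> forms.dim N = 3"

definition repeated_line :: "('a::field^3 \<Rightarrow> 'a) \<Rightarrow> bool" where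
  "repeated_line Q \<longleftrightarrow>
     Q \<noteq> 0 \<and> (\<exists>c l. Vector_Spaces.linear (*s) (*) l \<and> Q = (\<lambda>x. c * (l x)\<^sup>2))"

definition rank_one_net :: "('a::field^3 \<Rightarrow> 'a) set \<Rightarrow> bool" where
  "rank_one_net N \<longleftrightarrow> net_of_conics N \<and> (\<exists>Q\<in>N. repeated_line Q)"

text \<open>
  Scalar matrices act trivially on subspaces, so orbits under \<open>PGL(3,q)\<close> are orbits under
  \<open>GL(3,q)\<close>.
\<close>

definition PGL_orbit :: "('a::field^3 \<Rightarrow> 'a) set \<Rightarrow> ('a^3 \<Rightarrow> 'a) set set" where
  "PGL_orbit N = {(\<lambda>Q. \<lambda>x. Q (A *v x)) ` N | A :: 'a mat3. invertible A}"


section \<open>Lines and planes of symmetric matrices\<close>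

definition mat_scale :: "'a::field \<Rightarrow> 'a mat3 \<Rightarrow> 'a mat3" where
  "mat_scale c M = (\<chi> i j. c * M $ i $ j)"

interpretation mats: vector_space "mat_scale :: 'a::field \<Rightarrow> _"
  by unfold_locales (simp_all add: mat_scale_def vec_eq_iff distrib_left distrib_right mult.assoc)

text \<open>
  Subspaces of \<open>PG(5,q)\<close> are represented by the underlying linear subspaces, which contain
  the zero matrix.
\<close>

definition PG5_line :: "'a::field mat3 set \<Rightarrow> bool" where
  "PG5_line L \<longleftrightarrow> L \<subseteq> {M. transpose M = M} \<and> mats.subspace L \<and> mats.dim L = 2"

definition K_orbit :: "'a::field mat3 set \<Rightarrow> 'a mat3 set set" where
  "K_orbit L = {(\<lambda>M. A ** M ** transpose A) ` L | A :: 'a mat3. invertible A}"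

text \<open>The Gram matrix is half the matrix of the polar form of \<open>Q\<close>.\<close>

definition gram :: "('a::field^3 \<Rightarrow> 'a) \<Rightarrow> 'a mat3" where
  "gram Q = (\<chi> i j. (Q (axis i 1 + axis j 1) - Q (axis i 1) - Q (axis j 1)) / 2)"

lemma gram_eqI:
  fixes S :: "'a::field mat3"
  assumes "(2::'a) \<noteq> 0" "transpose S = S"
    and "\<And>x. Q x = (\<Sum>i\<in>UNIV. \<Sum>j\<in>UNIV. S $ i $ j * x $ i * x $ j)"
  shows "gram Q = S"
proof -
  have "S $ i $ j = S $ j $ i" for i j
    using arg_cong[OF assms(2), of "\<lambda>M. M $ j $ i"] by (simp add: transpose_def)
  then have s: "S $ 2 $ 1 = S $ 1 $ 2" "S $ 3 $ 1 = S $ 1 $ 3" "S $ 3 $ 2 = S $ 2 $ 3"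
    by auto
  have "Q (axis i 1 + axis j 1) - Q (axis i 1) - Q (axis j 1) = 2 * S $ i $ j" for i j
    using exhaust_3[of i] exhaust_3[of j]
    by (elim disjE; simp add: assms(3) sum_3 axis_def s)
  with assms(1) have "gram Q $ i $ j = S $ i $ j" for i j
    by (simp add: gram_def)
  then show ?thesis by (simp add: vec_eq_iff)
qed

definition plane_of_net :: "('a::field^3 \<Rightarrow> 'a) set \<Rightarrow> 'a mat3 set" where
  "plane_of_net N = gram ` N"


section \<open>The fifteen orbits of lines\<close>

definition mat_rows :: "'a::zero list \<Rightarrow> 'a list \<Rightarrow> 'a list \<Rightarrow> 'a mat3" where
  "mat_rows r s t = vector [vector r, vector s, vector t]"

datatype line_type =
    O5 | O6 | O8_1 | O8_2 | O9 | O10 | O12 | O13_1 | O13_2 | O14_1 | O14_2 | O15_1 | O15_2 | O16 | O17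

text \<open>
  The constants occurring in the representatives: the non-square \<open>\<epsilon>\<close>, and for each of
  \<open>O10\<close>, \<open>O15_1\<close>, \<open>O15_2\<close>, \<open>O17\<close> its own choice of \<open>u\<close>, \<open>v\<close> (and \<open>w\<close>).
\<close>

record 'a line_params =
  eps :: 'a
  u10 :: 'a
  v10 :: 'a
  u15_1 :: 'a
  v15_1 :: 'a
  u15_2 :: 'a
  v15_2 :: 'a
  u17 :: 'a
  v17 :: 'a
  w17 :: 'a

definition cond_star :: "'a::field \<Rightarrow> 'a \<Rightarrow> bool" where
  "cond_star u v \<longleftrightarrow> v \<noteq> 0 \<and> (\<forall>z. v * z\<^sup>2 + u * v * z - 1 \<noteq> 0)"

definition cond_star_star :: "'a::field \<Rightarrow> 'a \<Rightarrow> 'a \<Rightarrow> bool" where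
  "cond_star_star u v w \<longleftrightarrow> (\<forall>z. z ^ 3 + w * z\<^sup>2 - u * z + v \<noteq> 0)"

definition admissible :: "'a::field line_params \<Rightarrow> bool" where
  "admissible p \<longleftrightarrow>
     \<not> is_square (eps p) \<and>
     cond_star (u10 p) (v10 p) \<and>
     cond_star (u15_1 p) (v15_1 p) \<and> is_square (- v15_1 p) \<and>
     cond_star (u15_2 p) (v15_2 p) \<and> \<not> is_square (- v15_2 p) \<and>
     cond_star_star (u17 p) (v17 p) (w17 p)"

fun line_point :: "'a::field line_params \<Rightarrow> line_type \<Rightarrow> 'a \<Rightarrow> 'a \<Rightarrow> 'a mat3" where
  "line_point p O5 a b = mat_rows [a, 0, 0] [0, b, 0] [0, 0, 0]"
| "line_point p O6 a b = mat_rows [a, b, 0] [b, 0, 0] [0, 0, 0]"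
| "line_point p O8_1 a b = mat_rows [a, 0, 0] [0, b, 0] [0, 0, - b]"
| "line_point p O8_2 a b = mat_rows [a, 0, 0] [0, b, 0] [0, 0, - (eps p * b)]"
| "line_point p O9 a b = mat_rows [a, 0, b] [0, b, 0] [b, 0, 0]"
| "line_point p O10 a b = mat_rows [v10 p * a, b, 0] [b, a + u10 p * b, 0] [0, 0, 0]"
| "line_point p O12 a b = mat_rows [0, a, 0] [a, 0, b] [0, b, 0]"
| "line_point p O13_1 a b = mat_rows [0, a, 0] [a, b, 0] [0, 0, - b]"
| "line_point p O13_2 a b = mat_rows [0, a, 0] [a, b, 0] [0, 0, - (eps p * b)]"
| "line_point p O14_1 a b = mat_rows [a, 0, 0] [0, - (a + b), 0] [0, 0, b]"
| "line_point p O14_2 a b = mat_rows [a, 0, 0] [0, - (eps p * (a + b)), 0] [0, 0, b]"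
| "line_point p O15_1 a b = mat_rows [v15_1 p * b, a, 0] [a, u15_1 p * a + b, 0] [0, 0, a]"
| "line_point p O15_2 a b = mat_rows [v15_2 p * b, a, 0] [a, u15_2 p * a + b, 0] [0, 0, a]"
| "line_point p O16 a b = mat_rows [0, 0, a] [0, a, b] [a, b, 0]"
| "line_point p O17 a b =
     mat_rows [inverse (v17 p) * a, b, 0] [b, u17 p * b - w17 p * a, a] [0, a, b]"

definition line_rep :: "'a::field line_params \<Rightarrow> line_type \<Rightarrow> 'a mat3 set" where
  "line_rep p t = {line_point p t a b | a b. True}"

definition line_orbit_distribution ::
    "'a::field line_params \<Rightarrow> 'a mat3 set \<Rightarrow> line_type \<Rightarrow> nat" where
  "line_orbit_distribution p \<pi> =
     (\<lambda>t. card {L. PG5_line L \<and> L \<subseteq> \<pi> \<and> L \<in> K_orbit (line_rep p t)})"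

end

theory Submission
  imports Defs
begin

text \<open>
  Gram matrices turn a net of rank one into a plane \<open>W\<close>: a three-dimensional space of symmetric
  matrices of order three that contains some \<open>v v\<^sup>T\<close> with \<open>v \<noteq> 0\<close>. Nets in one orbit correspond to
  congruent planes (\<open>PGL_orbit_eqI\<close>). Two planes with the same line-orbit distribution contain
  lines of the same types, and the proof reads a normal form of \<open>W\<close> up to congruence off the types
  that occur. The reason that this succeeds is that a plane is spanned by a line and a point: if \<open>W\<close>
  contains a line of a known type and a point of rank one, few possibilities are left. Here \<open>E11\<close>
  is the matrix unit, and a point is called of rank one if its matrix is.

  \<^item> A line of type \<open>o\<^sub>5\<close> is a line with two points of rank one. Planes with such a line have five
    normal forms (\<open>planes_with_O5\<close>), which the types \<open>o\<^sub>6\<close>, \<open>o\<^sub>9\<close> and \<open>o\<^sub>1\<^sub>2\<close> separate.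

  \<^item> Otherwise the point of rank one is unique, and \<open>W\<close> may be assumed to contain \<open>E11\<close>. A line
    through \<open>E11\<close> is given by a matrix \<open>M\<close> modulo \<open>E11\<close>, and the \<open>2 \<times> 2\<close> block \<open>B\<close> of \<open>M\<close> in the last two
    rows and columns decides the type: \<open>o\<^sub>6\<close> if \<open>B = 0\<close>, \<open>o\<^sub>9\<close> if \<open>B\<close> has rank one, and if \<open>B\<close> has rank
    two then \<open>o\<^sub>8\<^sub>,\<^sub>1\<close> or \<open>o\<^sub>8\<^sub>,\<^sub>2\<close>, according to whether \<open>- det B\<close> is a square (\<open>O6_I\<close>, \<open>O9_I\<close>,
    \<open>O9_D\<close>, \<open>O8_I\<close>, \<open>O8_D\<close>). If a line of type \<open>o\<^sub>6\<close> occurs, then this and type \<open>o\<^sub>1\<^sub>2\<close> separate the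
    four families that arise (\<open>planes_with_O6\<close>, \<open>congruent_if_O6\<close>).

  \<^item> If neither type \<open>o\<^sub>5\<close> nor \<open>o\<^sub>6\<close> occurs, then the blocks form a pencil of binary forms, and \<open>W\<close> is
    congruent to the plane of all \<open>sym3 x (a * y) (b * y) y z (d * y)\<close> for some \<open>a\<close>, \<open>b\<close>, \<open>d\<close>
    (\<open>planes_without_O6\<close>). The types \<open>o\<^sub>9\<close> and \<open>o\<^sub>8\<^sub>,\<^sub>2\<close> show whether \<open>d\<close> is a nonzero square, zero or a
    non-square (\<open>pencil_parameter\<close>). Put \<open>w = b + a\<surd>d\<close> in the algebra \<open>K = F[\<surd>d]\<close>. Congruences
    multiply \<open>w\<close> by nonzero scalars and by cubes of units of \<open>K\<close> and replace it by its conjugate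
    (\<open>pencil_plane_cube_class\<close>, \<open>pencil_plane_conj\<close>). If \<open>d \<noteq> 0\<close>, the scalar multiples of cubes have
    index at most three in the units, so all units outside of them are equivalent
    (\<open>cube_class_dichotomy\<close>); if \<open>d = 0\<close>, a diagonal congruence gives the same. The class of
    \<open>w = 1\<close> is recognised by a line of type \<open>o\<^sub>1\<^sub>6\<close>, which the normal form shows at \<open>x = 0\<close>; it is an
    inflectional tangent of the cubic \<open>det = 0\<close>. The class of \<open>w = 0\<close>, with \<open>d\<close> a non-square, is
    recognised by a line of type \<open>o\<^sub>1\<^sub>0\<close>.
\<close>

section \<open>Symmetric matrices of order three\<close>

text \<open>
  The sum of all elements is unchanged when \<open>1\<close> is added to each summand.
\<close>

lemma of_nat_card_UNIV: "of_nat CARD('a::{field,finite}) = (0::'a)"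
proof -
  have "(\<Sum>x\<in>UNIV. x + 1) = (\<Sum>x\<in>UNIV. x :: 'a)"
    by (rule sum.reindex_bij_witness[of _ "\<lambda>x. x - 1" "\<lambda>x. x + 1"]) auto
  then show ?thesis by (simp add: sum.distrib)
qed

lemma two_neq_zero:
  assumes "odd CARD('a::{field,finite})"
  shows "(2::'a) \<noteq> 0"
proof
  assume "(2::'a) = 0"
  obtain k where "CARD('a) = 2 * k + 1" using assms oddE by blast
  then have "of_nat CARD('a) = (2::'a) * of_nat k + 1" by simp
  with \<open>2 = 0\<close> show False by (simp add: of_nat_card_UNIV)
qed

text \<open>
  The six entries on and above the diagonal, row by row.
\<close>

definition sym3 :: "'a::field \<Rightarrow> 'a \<Rightarrow> 'a \<Rightarrow> 'a \<Rightarrow> 'a \<Rightarrow> 'a \<Rightarrow> 'a mat3" where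
  "sym3 a b c d e f = mat_rows [a, b, c] [b, d, e] [c, e, f]"

text \<open>
  The action of \<open>GL(3)\<close> that defines \<open>K_orbit\<close>. If \<open>M\<close> is written as a quadratic polynomial in vectors,
  \<open>E\<^sub>i\<^sub>j + E\<^sub>j\<^sub>i\<close> being \<open>2 e\<^sub>i e\<^sub>j\<close>, the action substitutes the columns of \<open>A\<close> for the basis vectors. The
  normal forms below are obtained by completing squares and products in this notation.
\<close>

definition transform :: "'a::field mat3 \<Rightarrow> 'a mat3 \<Rightarrow> 'a mat3" where
  "transform A M = A ** M ** transpose A"

lemma mat_rows_nth [simp]:
  "mat_rows [a, b, c] s t $ 1 = vector [a, b, c]"
  "mat_rows r [a, b, c] t $ 2 = vector [a, b, c]"
  "mat_rows r s [a, b, c] $ 3 = vector [a, b, c]"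
  by (simp_all add: mat_rows_def)

lemma sym3_nth [simp]:
  "sym3 a b c d e f $ 1 $ 1 = a" "sym3 a b c d e f $ 1 $ 2 = b" "sym3 a b c d e f $ 1 $ 3 = c"
  "sym3 a b c d e f $ 2 $ 1 = b" "sym3 a b c d e f $ 2 $ 2 = d" "sym3 a b c d e f $ 2 $ 3 = e"
  "sym3 a b c d e f $ 3 $ 1 = c" "sym3 a b c d e f $ 3 $ 2 = e" "sym3 a b c d e f $ 3 $ 3 = f"
  by (simp_all add: sym3_def)

lemma mat3_eq_iff: 
  "(M::'a::field mat3) = N \<longleftrightarrow> (\<forall>i\<in>{1,2,3}. \<forall>j\<in>{1,2,3}. M $ i $ j = N $ i $ j)"
  by (auto simp: vec_eq_iff forall_3)

lemma sym3_eq_iff [simp]: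
  "sym3 a b c d e f = sym3 a' b' c' d' e' f' \<longleftrightarrow>
     a = a' \<and> b = b' \<and> c = c' \<and> d = d' \<and> e = e' \<and> f = f'"
  by (auto simp: mat3_eq_iff)

lemma transpose_sym3 [simp]: "transpose (sym3 a b c d e f) = sym3 a b c d e f"
  by (simp add: mat3_eq_iff transpose_def)

lemma symmetric_sym3:
  assumes "transpose M = M"
  obtains a b c d e f where "M = sym3 a b c d e f"
proof -
  have "M $ i $ j = M $ j $ i" for i j
    using arg_cong[OF assms, of "\<lambda>M. M $ j $ i"] by (simp add: transpose_def)
  then have "M = sym3 (M$1$1) (M$1$2) (M$1$3) (M$2$2) (M$2$3) (M$3$3)"
    by (simp add: mat3_eq_iff)
  then show ?thesis by (rule that)
qed

lemma sym3_arith [simp]: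
  "sym3 a b c d e f + sym3 a' b' c' d' e' f' = sym3 (a+a') (b+b') (c+c') (d+d') (e+e') (f+f')"
  "mat_scale k (sym3 a b c d e f) = sym3 (k*a) (k*b) (k*c) (k*d) (k*e) (k*f)"
  by (auto simp: mat3_eq_iff mat_scale_def)

lemma zero_sym3: "0 = sym3 0 0 0 0 0 0"
  by (auto simp: mat3_eq_iff)

lemma mat_rows_mult:
  "mat_rows [p1,q1,r1] [p2,q2,r2] [p3,q3,r3] ** mat_rows [a1,b1,c1] [a2,b2,c2] [a3,b3,c3] =
   (mat_rows [p1*a1+q1*a2+r1*a3, p1*b1+q1*b2+r1*b3, p1*c1+q1*c2+r1*c3]
             [p2*a1+q2*a2+r2*a3, p2*b1+q2*b2+r2*b3, p2*c1+q2*c2+r2*c3]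
             [p3*a1+q3*a2+r3*a3, p3*b1+q3*b2+r3*b3, p3*c1+q3*c2+r3*c3] :: 'a::field mat3)"
  by (simp add: mat3_eq_iff matrix_matrix_mult_def sum_3)

lemma transpose_mat_rows:
  "transpose (mat_rows [p1,q1,r1] [p2,q2,r2] [p3,q3,r3] :: 'a::field mat3) =
     mat_rows [p1,p2,p3] [q1,q2,q3] [r1,r2,r3]"
  by (simp add: mat3_eq_iff transpose_def)

lemma arg_cong3: "a = a' \<Longrightarrow> b = b' \<Longrightarrow> c = c' \<Longrightarrow> f a b c = f a' b' c'"
  by simp

lemma transform_sym3 [simp]:
  "transform (mat_rows [p1,q1,r1] [p2,q2,r2] [p3,q3,r3]) (sym3 a b c d e f) =
   sym3
     (a*p1*p1 + d*q1*q1 + f*r1*r1 + 2*b*p1*q1 + 2*c*p1*r1 + 2*e*q1*r1)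
     (a*p1*p2 + d*q1*q2 + f*r1*r2 + b*(p1*q2 + p2*q1) + c*(p1*r2 + p2*r1) + e*(q1*r2 + q2*r1))
     (a*p1*p3 + d*q1*q3 + f*r1*r3 + b*(p1*q3 + p3*q1) + c*(p1*r3 + p3*r1) + e*(q1*r3 + q3*r1))
     (a*p2*p2 + d*q2*q2 + f*r2*r2 + 2*b*p2*q2 + 2*c*p2*r2 + 2*e*q2*r2)
     (a*p2*p3 + d*q2*q3 + f*r2*r3 + b*(p2*q3 + p3*q2) + c*(p2*r3 + p3*r2) + e*(q2*r3 + q3*r2))
     (a*p3*p3 + d*q3*q3 + f*r3*r3 + 2*b*p3*q3 + 2*c*p3*r3 + 2*e*q3*r3)"
  unfolding transform_def sym3_def mat_rows_mult transpose_mat_rows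
  by (intro arg_cong3[where f=mat_rows] arg_cong2[where f=Cons] refl; algebra)

lemma line_point_sym3 [simp]:
  "line_point p O5 a b = sym3 a 0 0 b 0 0"
  "line_point p O6 a b = sym3 a b 0 0 0 0"
  "line_point p O8_1 a b = sym3 a 0 0 b 0 (- b)"
  "line_point p O8_2 a b = sym3 a 0 0 b 0 (- (eps p * b))"
  "line_point p O9 a b = sym3 a 0 b b 0 0"
  "line_point p O10 a b = sym3 (v10 p * a) b 0 (a + u10 p * b) 0 0"
  "line_point p O12 a b = sym3 0 a 0 0 b 0"
  "line_point p O16 a b = sym3 0 0 a a b 0"
  by (simp_all add: sym3_def)

declare line_point.simps [simp del]

lemma mat3_cases:
  obtains p1 q1 r1 p2 q2 r2 p3 q3 r3 where "(A::'a::field mat3) = mat_rows [p1,q1,r1] [p2,q2,r2] [p3,q3,r3]"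
proof
  show "A = mat_rows [A$1$1,A$1$2,A$1$3] [A$2$1,A$2$2,A$2$3] [A$3$1,A$3$2,A$3$3]"
    by (simp add: mat3_eq_iff)
qed

lemma invertible_mat_rows [simp]:
  "invertible (mat_rows [p1,q1,r1] [p2,q2,r2] [p3,q3,r3] :: 'a::field mat3) \<longleftrightarrow>
   p1 * (q2 * r3 - r2 * q3) - q1 * (p2 * r3 - r2 * p3) + r1 * (p2 * q3 - q2 * p3) \<noteq> 0"
proof -
  have "det (mat_rows [p1,q1,r1] [p2,q2,r2] [p3,q3,r3] :: 'a mat3) =
    p1 * (q2 * r3 - r2 * q3) - q1 * (p2 * r3 - r2 * p3) + r1 * (p2 * q3 - q2 * p3)"
    unfolding det_3 by (simp, algebra)
  then show ?thesis by (simp add: invertible_det_nz)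
qed

lemma transform_mult: "transform A (transform B M) = transform (A ** B) M"
  by (simp add: transform_def matrix_mul_assoc matrix_transpose_mul)

lemma transform_1 [simp]: "transform (mat 1) M = M"
  by (simp add: transform_def)

lemma transform_linear:
  "transform A (M + N) = transform A M + transform A N"
  "transform A (mat_scale k M) = mat_scale k (transform A M)"
proof -
  show "transform A (M + N) = transform A M + transform A N"
    by (simp add: transform_def vec_eq_iff matrix_matrix_mult_def distrib_left distrib_right sum.distrib)
  show "transform A (mat_scale k M) = mat_scale k (transform A M)"
    by (simp add: transform_def mat_scale_def vec_eq_iff matrix_matrix_mult_def sum_distrib_left
      sum_distrib_right mult.assoc mult.left_commute)
qed

lemma inj_triple:
  assumes "\<And>a b c a' b' c'. f a b c = f a' b' c' \<Longrightarrow> a = a' \<and> b = b' \<and> c = c'"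
  shows "inj (\<lambda>(a, b, c). f a b c)"
proof (rule injI)
  fix s t
  assume "(\<lambda>(a, b, c). f a b c) s = (\<lambda>(a, b, c). f a b c) t"
  then show "s = t" using assms by (cases s; cases t) auto
qed

definition symmetric_plane :: "'a::field mat3 set \<Rightarrow> bool" where
  "symmetric_plane W \<longleftrightarrow>
     W \<subseteq> {M. transpose M = M} \<and> mats.subspace W \<and> card W = CARD('a) ^ 3"

definition congruent :: "'a::field mat3 set \<Rightarrow> 'a mat3 set \<Rightarrow> bool" where
  "congruent W W' \<longleftrightarrow> (\<exists>A. invertible A \<and> transform A ` W = W')"

text \<open>
  The congruent copy of the representative line is given pointwise, since containment in a plane is
  checked and used on its points; \<open>line_orbit_distribution_eq_0_iff\<close> makes the connection.
\<close>

definition has_line :: "'a::field line_params \<Rightarrow> line_type \<Rightarrow> 'a mat3 set \<Rightarrow> bool" where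
  "has_line p t W \<longleftrightarrow> (\<exists>A. invertible A \<and> (\<forall>a b. transform A (line_point p t a b) \<in> W))"

text \<open>
  The normal forms of planes are given as images of linear parametrisations \<open>F\<close>.
\<close>

definition family :: "('a \<Rightarrow> 'a \<Rightarrow> 'a \<Rightarrow> 'a mat3) \<Rightarrow> 'a::field mat3 set" where
  "family F = {F a b c | a b c. True}"

text \<open>
  The matrix \<open>v v\<^sup>T\<close> of the vector \<open>v = (x, y, z)\<close>, a point of the Veronese surface.
\<close>

definition veronese :: "'a::field \<Rightarrow> 'a \<Rightarrow> 'a \<Rightarrow> 'a mat3" where
  "veronese x y z = sym3 (x*x) (x*y) (x*z) (y*y) (y*z) (z*z)"

lemma transform_inverse:
  fixes A :: "'a::field mat3"
  assumes "invertible A"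
  obtains B where "invertible B" "\<And>M. transform B (transform A M) = M"
    "\<And>M. transform A (transform B M) = M"
proof -
  obtain B where "A ** B = mat 1" "B ** A = mat 1"
    using assms by (auto simp: invertible_def)
  then show ?thesis
    by (intro that[of B]) (auto simp: invertible_def transform_mult)
qed

lemma inj_transform: "invertible A \<Longrightarrow> inj_on (transform A) S"
  by (metis transform_inverse inj_on_def)

lemma transform_symmetric: "transpose M = M \<Longrightarrow> transpose (transform A M) = transform A M"
  by (simp add: transform_def matrix_transpose_mul matrix_mul_assoc)

lemma congruent_refl: "congruent W W"
  unfolding congruent_def by (rule exI[of _ "mat 1"]) (auto simp: invertible_def)

lemma congruent_sym: "congruent W W' \<Longrightarrow> congruent W' W"
  unfolding congruent_def by (metis (no_types, lifting) transform_inverse image_image image_ident image_cong)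

lemma congruent_trans: "congruent W W' \<Longrightarrow> congruent W' W'' \<Longrightarrow> congruent W W''"
  unfolding congruent_def by (metis (no_types, lifting) invertible_mult image_image image_cong transform_mult)

lemma symmetric_plane_transform:
  assumes "symmetric_plane W" "invertible A"
  shows "symmetric_plane (transform A ` W)"
proof -
  have "mats.subspace (transform A ` W)"
    using assms(1) unfolding symmetric_plane_def mats.subspace_def
    by (auto simp: image_iff) (metis transform_linear mats.scale_zero_left | metis transform_linear)+
  then show ?thesis
    using assms by (auto simp: symmetric_plane_def transform_symmetric card_image inj_transform)
qed

lemma symmetric_plane_congruent: "symmetric_plane W \<Longrightarrow> congruent W W' \<Longrightarrow> symmetric_plane W'"
  using symmetric_plane_transform by (auto simp: congruent_def)

lemma has_line_congruent:
  assumes "congruent W W'" shows "has_line p t W \<longleftrightarrow> has_line p t W'"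
proof -
  have "has_line p t V'" if "has_line p t V" "congruent V V'" for V V' :: "'a mat3 set"
    using that unfolding has_line_def congruent_def
    by (metis image_eqI invertible_mult transform_mult)
  then show ?thesis using assms congruent_sym by blast
qed

text \<open>
  The plane has exactly \<open>q\<^sup>3\<close> elements and a family has at most \<open>q\<^sup>3\<close>, so one inclusion suffices.
\<close>

lemma congruent_family:
  fixes W :: "'a::{field,finite} mat3 set"
  assumes "symmetric_plane W" "invertible B" "\<And>M. M \<in> W \<Longrightarrow> \<exists>a b c. M = transform B (F a b c)"
  shows "congruent W (family F)"
proof -
  let ?f = "\<lambda>(a, b, c). transform B (F a b c)"
  have "W \<subseteq> range ?f"
  proof
    fix M assume "M \<in> W"
    then obtain a b c where "M = ?f (a, b, c)" using assms(3)[of M] by auto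
    then show "M \<in> range ?f" by blast
  qed
  moreover have "card (range ?f) \<le> card W"
    using card_image_le[of UNIV ?f] assms(1)
    by (simp add: symmetric_plane_def power3_eq_cube card_prod flip: UNIV_Times_UNIV)
  ultimately have "W = range ?f" by (simp add: card_seteq)
  then have "W = transform B ` family F"
    by (auto simp: family_def image_iff) fastforce
  then have "congruent (family F) W"
    using assms(2) unfolding congruent_def by blast
  then show ?thesis by (rule congruent_sym)
qed

lemma subspace_combination:
  assumes "mats.subspace W" "X \<in> W" "Y \<in> W" "Z \<in> W"
  shows "mat_scale a X + mat_scale b Y + mat_scale c Z \<in> W"
  using assms by (simp add: mats.subspace_def)

lemma symmetric_plane_eq_family:
  fixes W :: "'a::{field,finite} mat3 set"
  assumes "symmetric_plane W" "X \<in> W" "Y \<in> W" "Z \<in> W"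
    and indep: "\<And>a b c. mat_scale a X + mat_scale b Y + mat_scale c Z = 0 \<Longrightarrow> a = 0 \<and> b = 0 \<and> c = 0"
  shows "W = family (\<lambda>a b c. mat_scale a X + mat_scale b Y + mat_scale c Z)"
proof -
  let ?f = "\<lambda>(a, b, c). mat_scale a X + mat_scale b Y + mat_scale c Z"
  have "inj ?f"
  proof (rule inj_triple)
    fix a b c a' b' c'
    assume eq: "mat_scale a X + mat_scale b Y + mat_scale c Z =
      mat_scale a' X + mat_scale b' Y + mat_scale c' Z"
    have "mat_scale (a - a') X + mat_scale (b - b') Y + mat_scale (c - c') Z = 0"
      using eq by (simp add: mats.scale_left_diff_distrib algebra_simps)
    from indep[OF this] show "a = a' \<and> b = b' \<and> c = c'" by simp
  qed
  then have "card (range ?f) = CARD('a \<times> 'a \<times> 'a)"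
    by (rule card_image)
  also have "\<dots> = card W"
    using assms(1) by (simp add: symmetric_plane_def power3_eq_cube)
  finally have "card (range ?f) = card W" .
  moreover have "range ?f \<subseteq> W"
  proof
    fix M assume "M \<in> range ?f"
    then obtain a b c where "M = mat_scale a X + mat_scale b Y + mat_scale c Z" by auto
    then show "M \<in> W"
      using assms(1-4) unfolding symmetric_plane_def by (blast intro: subspace_combination)
  qed
  ultimately have "W = range ?f"
    by (metis card_subset_eq finite)
  also have "\<dots> = family (\<lambda>a b c. mat_scale a X + mat_scale b Y + mat_scale c Z)"
    unfolding family_def by (auto simp: image_iff) blast
  finally show ?thesis .
qed

text \<open>
  A plane has more elements than a line, so there is a matrix outside of the span of \<open>X\<close> and \<open>Y\<close>.
\<close>

lemma symmetric_plane_extend2: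
  fixes W :: "'a::{field,finite} mat3 set"
  assumes "symmetric_plane W" "X \<in> W" "Y \<in> W"
    and indep: "\<And>a b. mat_scale a X + mat_scale b Y = 0 \<Longrightarrow> a = 0 \<and> b = 0"
  obtains Z where "Z \<in> W" "W = family (\<lambda>a b c. mat_scale a X + mat_scale b Y + mat_scale c Z)"
proof -
  let ?g = "\<lambda>(a, b). mat_scale a X + mat_scale b Y"
  have q: "CARD('a) \<ge> 2"
    using card_mono[of "UNIV :: 'a set" "{0,1}"] by simp
  have "card (range ?g) \<le> CARD('a)^2"
    using card_image_le[of UNIV ?g] by (simp add: power2_eq_square card_prod flip: UNIV_Times_UNIV)
  also have "\<dots> < card W"
    using assms(1) q by (simp add: symmetric_plane_def power_strict_increasing)
  finally have "\<not> W \<subseteq> range ?g"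
    by (metis card_mono finite leD)
  then obtain Z where Z: "Z \<in> W" "\<And>a b. Z \<noteq> mat_scale a X + mat_scale b Y" by fastforce
  have "W = family (\<lambda>a b c. mat_scale a X + mat_scale b Y + mat_scale c Z)"
  proof (rule symmetric_plane_eq_family[OF assms(1-3) Z(1)])
    fix a b c
    assume 0: "mat_scale a X + mat_scale b Y + mat_scale c Z = 0"
    have "c = 0"
    proof (rule ccontr)
      assume "c \<noteq> 0"
      define k where "k = - inverse c"
      have *: "mat_scale c Z = - (mat_scale a X + mat_scale b Y)"
        using 0 by (metis add.commute eq_neg_iff_add_eq_0)
      have "mat_scale (inverse c) (mat_scale c Z) = mat_scale k (mat_scale a X + mat_scale b Y)"
        unfolding * k_def by (simp only: mats.scale_minus_left mats.scale_minus_right)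
      then have "Z = mat_scale (k * a) X + mat_scale (k * b) Y"
        using \<open>c \<noteq> 0\<close> by (simp add: mats.scale_right_distrib)
      with Z(2) show False by blast
    qed
    with 0 indep[of a b] show "a = 0 \<and> b = 0 \<and> c = 0" by simp
  qed
  with Z(1) show ?thesis by (rule that)
qed

lemma symmetric_plane_extend1:
  fixes W :: "'a::{field,finite} mat3 set"
  assumes "symmetric_plane W" "X \<in> W" "X \<noteq> 0"
  obtains Y Z where "Y \<in> W" "Z \<in> W" "W = family (\<lambda>a b c. mat_scale a X + mat_scale b Y + mat_scale c Z)"
proof -
  have q: "CARD('a) \<ge> 2"
    using card_mono[of "UNIV :: 'a set" "{0,1}"] by simp
  have "card (range (\<lambda>a. mat_scale a X)) \<le> CARD('a)^1"
    using card_image_le[of UNIV "\<lambda>a. mat_scale a X"] by simp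
  also have "\<dots> < card W"
    using assms(1) q power_strict_increasing[of 1 3 "CARD('a)"]
    by (simp add: symmetric_plane_def del: power_one_right)
  finally have "\<not> W \<subseteq> range (\<lambda>a. mat_scale a X)"
    by (metis card_mono finite leD)
  then obtain Y where Y: "Y \<in> W" "\<And>a. Y \<noteq> mat_scale a X" by blast
  have "a = 0 \<and> b = 0" if "mat_scale a X + mat_scale b Y = 0" for a b
  proof -
    have "b = 0"
    proof (rule ccontr)
      assume "b \<noteq> 0"
      have "mat_scale b Y = - mat_scale a X"
        using that by (metis add.commute eq_neg_iff_add_eq_0)
      then have "mat_scale (inverse b) (mat_scale b Y) = mat_scale (inverse b) (- mat_scale a X)"
        by (rule arg_cong)
      then have "Y = mat_scale (- (inverse b * a)) X"
        using \<open>b \<noteq> 0\<close> by (simp add: mats.scale_minus_left mats.scale_minus_right)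
      with Y(2) show False by blast
    qed
    with that assms(3) show ?thesis by simp
  qed
  then obtain Z where "Z \<in> W" "W = family (\<lambda>a b c. mat_scale a X + mat_scale b Y + mat_scale c Z)"
    by (rule symmetric_plane_extend2[OF assms(1,2) Y(1)])
  with Y(1) show ?thesis by (rule that)
qed

lemma invertible_first_column:
  assumes "(x, y, z) \<noteq> (0, 0, 0 :: 'a::field)"
  obtains B where "invertible B" "\<And>k. transform B (sym3 k 0 0 0 0 0) = mat_scale k (veronese x y z)"
proof -
  have "\<exists>B. invertible B \<and> (\<forall>k. transform B (sym3 k 0 0 0 0 0) = mat_scale k (veronese x y z))"
  proof (cases "x = 0")
    case True
    show ?thesis
    proof (cases "y = 0")
      case True
      with \<open>x = 0\<close> assms show ?thesis
        by (intro exI[of _ "mat_rows [x,1,0] [y,0,1] [z,0,0]"])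
          (auto simp: invertible_mat_rows transform_sym3 veronese_def)
    next
      case False
      with assms show ?thesis
        by (intro exI[of _ "mat_rows [x,1,0] [y,0,0] [z,0,1]"])
          (auto simp: invertible_mat_rows transform_sym3 veronese_def)
    qed
  next
    case False
    then show ?thesis
      by (intro exI[of _ "mat_rows [x,0,0] [y,1,0] [z,0,1]"])
        (auto simp: invertible_mat_rows transform_sym3 veronese_def)
  qed
  then show ?thesis using that by blast
qed

section \<open>Nets of conics as planes of symmetric matrices\<close>

text \<open>
  The quadratic form with Gram matrix \<open>S\<close>.
\<close>

definition form_of :: "'a::field mat3 \<Rightarrow> 'a^3 \<Rightarrow> 'a" where
  "form_of S x = (\<Sum>i\<in>UNIV. \<Sum>j\<in>UNIV. S $ i $ j * x $ i * x $ j)"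

lemma gram_form_of:
  "(2::'a::field) \<noteq> 0 \<Longrightarrow> transpose S = S \<Longrightarrow> gram (form_of (S :: 'a mat3)) = S"
  by (rule gram_eqI) (auto simp: form_of_def)

lemma quadratic_form_gram:
  assumes two: "(2::'a::field) \<noteq> 0" and "quadratic_form (Q :: 'a^3 \<Rightarrow> 'a)"
  shows "transpose (gram Q) = gram Q" "form_of (gram Q) = Q"
proof -
  obtain C :: "'a mat3" where C: "\<And>x. Q x = form_of C x"
    using assms(2) by (auto simp: quadratic_form_def form_of_def)
  define h :: 'a where "h = 1 / 2"
  have h: "h + h = 1" using two by (simp add: h_def flip: add_divide_distrib)
  \<comment> \<open>the coefficient matrix of a form need not be symmetric, so it is replaced by its symmetric part\<close>
  define S where "S = sym3 (C$1$1) (h * (C$1$2 + C$2$1)) (h * (C$1$3 + C$3$1))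
    (C$2$2) (h * (C$2$3 + C$3$2)) (C$3$3)"
  have "form_of S x = form_of C x" for x
    using h by (simp add: form_of_def S_def sum_3) algebra
  with C have Q: "Q = form_of S" by (simp add: fun_eq_iff)
  moreover have "transpose S = S" by (simp add: S_def)
  ultimately show "transpose (gram Q) = gram Q" "form_of (gram Q) = Q"
    using two by (simp_all add: gram_form_of)
qed

lemma gram_linear:
  "gram (P + Q) = gram P + gram Q" "gram (form_scale c Q) = mat_scale c (gram Q)"
  by (simp_all add: gram_def mat_scale_def form_scale_def vec_eq_iff add_divide_distrib
      diff_divide_distrib right_diff_distrib)

lemma form_of_transform:
  assumes "transpose S = S"
  shows "form_of S (A *v x) = form_of (transform (transpose A) S) x"
proof -
  obtain a b c d e f where S: "S = sym3 a b c d e f" using symmetric_sym3 assms by blast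
  obtain p1 q1 r1 p2 q2 r2 p3 q3 r3 where A: "A = mat_rows [p1,q1,r1] [p2,q2,r2] [p3,q3,r3]"
    by (rule mat3_cases)
  show ?thesis
    unfolding S A transpose_mat_rows transform_sym3
    by (simp add: form_of_def sum_3 matrix_vector_mult_def) algebra
qed

lemma gram_substitution:
  assumes two: "(2::'a::field) \<noteq> 0" and "quadratic_form (Q :: 'a^3 \<Rightarrow> 'a)"
  shows "quadratic_form (\<lambda>x. Q (A *v x))"
    "gram (\<lambda>x. Q (A *v x)) = transform (transpose A) (gram Q)"
proof -
  note Q = quadratic_form_gram[OF assms]
  have *: "(\<lambda>x. Q (A *v x)) = form_of (transform (transpose A) (gram Q))"
    using form_of_transform[OF Q(1), of A] Q(2) by (auto simp: fun_eq_iff)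
  show "quadratic_form (\<lambda>x. Q (A *v x))"
    unfolding * quadratic_form_def form_of_def by blast
  show "gram (\<lambda>x. Q (A *v x)) = transform (transpose A) (gram Q)"
    unfolding * using two Q(1) by (simp add: gram_form_of transform_symmetric)
qed

lemma linear_functional_expansion:
  assumes "Vector_Spaces.linear (*s) (*) (l :: 'a::field^3 \<Rightarrow> 'a)"
  shows "l x = x$1 * l (axis 1 1) + x$2 * l (axis 2 1) + x$3 * l (axis 3 1)"
proof -
  interpret Vector_Spaces.linear "(*s)" "(*)" l by fact
  have "x = x$1 *s axis 1 1 + x$2 *s axis 2 1 + x$3 *s axis 3 1"
    using basis_expansion[of x] by (simp add: sum_3)
  then have "l x = l (x$1 *s axis 1 1 + x$2 *s axis 2 1 + x$3 *s axis 3 1)" by simp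
  then show ?thesis by (simp only: add scale)
qed

text \<open>
  The Gram matrix of \<open>c l\<^sup>2\<close> is \<open>c v v\<^sup>T\<close>, where \<open>v\<close> is the vector of coefficients of \<open>l\<close>.
\<close>

lemma gram_repeated_line:
  assumes two: "(2::'a::field) \<noteq> 0" and "repeated_line (Q :: 'a^3 \<Rightarrow> 'a)"
  obtains c x y z where "c \<noteq> 0" "(x, y, z) \<noteq> (0, 0, 0)" "gram Q = mat_scale c (veronese x y z)"
proof -
  obtain c l where "Q \<noteq> 0" and l: "Vector_Spaces.linear (*s) (*) l" and Q: "Q = (\<lambda>x. c * (l x)\<^sup>2)"
    using assms(2) by (auto simp: repeated_line_def)
  note exp = linear_functional_expansion[OF l]
  define x y z where "x = l (axis 1 1)" "y = l (axis 2 1)" "z = l (axis 3 1)"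
  have lv: "l v = v$1 * x + v$2 * y + v$3 * z" for v using exp[of v] by (simp add: x_y_z_def)
  show ?thesis
  proof (rule that)
    show "c \<noteq> 0" using \<open>Q \<noteq> 0\<close> by (auto simp: Q fun_eq_iff)
    show "(x, y, z) \<noteq> (0, 0, 0)" using \<open>Q \<noteq> 0\<close> lv by (auto simp: Q fun_eq_iff)
    show "gram Q = mat_scale c (veronese x y z)"
    proof (rule gram_eqI[OF two])
      show "Q v = (\<Sum>i\<in>UNIV. \<Sum>j\<in>UNIV. mat_scale c (veronese x y z) $ i $ j * v $ i * v $ j)" for v
        by (simp add: Q lv veronese_def sum_3 power2_eq_square) algebra
    qed (simp add: veronese_def)
  qed
qed

lemma (in vector_space) subspace_dim_3_parametrization:
  assumes "subspace V" "dim V = 3"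
  obtains x y z where "V = (\<lambda>(a, b, c). scale a x + scale b y + scale c z) ` UNIV"
    "inj (\<lambda>(a, b, c). scale a x + scale b y + scale c z)"
proof -
  obtain B where B: "B \<subseteq> V" "independent B" "V \<subseteq> span B" "card B = 3"
    using basis_exists assms(2) by metis
  then obtain x y z where Bxyz: "B = {x, y, z}" and d: "x \<noteq> y" "x \<noteq> z" "y \<noteq> z"
    by (auto simp: card_3_iff)
  have V: "V = span {x, y, z}"
    using B assms(1) Bxyz span_minimal by blast
  show ?thesis
  proof (rule that)
    show "V = (\<lambda>(a, b, c). scale a x + scale b y + scale c z) ` UNIV"
    proof
      show "V \<subseteq> (\<lambda>(a, b, c). scale a x + scale b y + scale c z) ` UNIV"
      proof
        fix v assume "v \<in> V"
        then obtain a b c where "v - scale a x - scale b y - scale c z = 0"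
          by (auto simp: V span_insert)
        then have "v = scale a x + scale b y + scale c z" by (simp add: algebra_simps)
        then show "v \<in> (\<lambda>(a, b, c). scale a x + scale b y + scale c z) ` UNIV" by (auto simp: image_iff)
      qed
      show "(\<lambda>(a, b, c). scale a x + scale b y + scale c z) ` UNIV \<subseteq> V"
        using B(1) assms(1) by (auto simp: Bxyz intro!: subspace_add subspace_scale)
    qed
    show "inj (\<lambda>(a, b, c). scale a x + scale b y + scale c z)"
    proof (rule inj_triple)
      fix a b c a' b' c'
      assume "scale a x + scale b y + scale c z = scale a' x + scale b' y + scale c' z"
      then have 0: "scale (a - a') x + scale (b - b') y + scale (c - c') z = 0"
        by (simp add: scale_left_diff_distrib algebra_simps)
      define u where "u v = (if v = x then a - a' else if v = y then b - b' else c - c')" for v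
      have "(\<Sum>v\<in>{x, y, z}. scale (u v) v) = 0"
        using 0 d by (simp add: u_def add.assoc)
      then have "u v = 0" if "v \<in> {x, y, z}" for v
        using independentD[of "{x,y,z}" "{x,y,z}" u v] B(2) Bxyz that by simp
      then have "u x = 0" "u y = 0" "u z = 0" by auto
      then show "a = a' \<and> b = b' \<and> c = c'" using d by (auto simp: u_def)
    qed
  qed
qed

lemma rank_one_net_plane:
  fixes N :: "('a::{field,finite}^3 \<Rightarrow> 'a) set"
  assumes two: "(2::'a) \<noteq> 0" and "rank_one_net N"
  shows "symmetric_plane (plane_of_net N)"
    "\<exists>x y z. (x, y, z) \<noteq> (0, 0, 0) \<and> veronese x y z \<in> plane_of_net N"
proof -
  have N: "N \<subseteq> Collect quadratic_form" "forms.subspace N" "forms.dim N = 3"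
    using assms(2) by (auto simp: rank_one_net_def net_of_conics_def)
  have inj: "inj_on gram N"
  proof (rule inj_on_subset[OF inj_on_inverseI])
    show "form_of (gram Q) = Q" if "Q \<in> Collect quadratic_form" for Q :: "'a^3 \<Rightarrow> 'a"
      using quadratic_form_gram(2)[OF two] that by simp
  qed (rule N(1))
  obtain x y z where xyz: "N = range (\<lambda>(a, b, c). form_scale a x + form_scale b y + form_scale c z)"
    "inj (\<lambda>(a, b, c). form_scale a x + form_scale b y + form_scale c z)"
    by (rule forms.subspace_dim_3_parametrization[OF N(2,3)])
  have card: "card N = CARD('a) ^ 3"
    unfolding xyz(1) card_image[OF xyz(2)] by (simp add: power3_eq_cube)
  have sub: "mats.subspace (plane_of_net N)"
    unfolding plane_of_net_def mats.subspace_def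
  proof (intro conjI ballI allI)
    have "gram 0 = (0 :: 'a mat3)" by (simp add: gram_def vec_eq_iff)
    then show "0 \<in> gram ` N" using N(2) by (metis forms.subspace_0 imageI)
  next
    fix M M' assume "M \<in> gram ` N" "M' \<in> gram ` N"
    then show "M + M' \<in> gram ` N"
      using N(2) by (auto simp: forms.subspace_add simp flip: gram_linear)
  next
    fix c M assume "M \<in> gram ` N"
    then show "mat_scale c M \<in> gram ` N"
      using N(2) by (auto simp: forms.subspace_scale simp flip: gram_linear)
  qed
  show "symmetric_plane (plane_of_net N)"
    using N(1) quadratic_form_gram(1)[OF two] sub card card_image[OF inj]
    by (auto simp: symmetric_plane_def plane_of_net_def)
  obtain Q where "Q \<in> N" "repeated_line Q" using assms(2) by (auto simp: rank_one_net_def)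
  then obtain c x y z where c: "c \<noteq> 0" "(x, y, z) \<noteq> (0, 0, 0)" "mat_scale c (veronese x y z) \<in> plane_of_net N"
    using gram_repeated_line[OF two, of Q] unfolding plane_of_net_def by (metis imageI)
  then have "mat_scale (inverse c) (mat_scale c (veronese x y z)) \<in> plane_of_net N"
    using sub by (simp only: mats.subspace_scale)
  with c have "veronese x y z \<in> plane_of_net N" by simp
  with c(2) show "\<exists>x y z. (x, y, z) \<noteq> (0, 0, 0) \<and> veronese x y z \<in> plane_of_net N" by blast
qed

lemma PGL_orbit_eqI:
  fixes N1 N2 :: "('a::{field,finite}^3 \<Rightarrow> 'a) set"
  assumes two: "(2::'a) \<noteq> 0" and "net_of_conics N1" "net_of_conics N2"
    and "congruent (plane_of_net N1) (plane_of_net N2)"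
  shows "PGL_orbit N1 = PGL_orbit N2"
proof -
  define act where "act B = (\<lambda>N :: ('a^3 \<Rightarrow> 'a) set. (\<lambda>Q. \<lambda>x. Q (B *v x)) ` N)" for B :: "'a mat3"
  have act_act: "act C (act B N) = act (B ** C) N" for B C N
    by (simp add: act_def image_image matrix_vector_mul_assoc)
  have orbit: "PGL_orbit N = {act A N | A. invertible A}" for N
    by (simp add: PGL_orbit_def act_def)
  have q1: "quadratic_form Q" if "Q \<in> N1" for Q
    using assms(2) that by (auto simp: net_of_conics_def)
  have q2: "quadratic_form Q" if "Q \<in> N2" for Q
    using assms(3) that by (auto simp: net_of_conics_def)
  obtain A where A: "invertible A" "transform A ` gram ` N1 = gram ` N2"
    using assms(4) by (auto simp: congruent_def plane_of_net_def)
  define B where "B = transpose A"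
  have B: "invertible B"
    using A(1) by (simp add: B_def invertible_det_nz)
  have "gram ` act B N1 = transform A ` gram ` N1"
    unfolding act_def image_image
  proof (rule image_cong[OF refl])
    fix Q assume "Q \<in> N1"
    then show "gram (\<lambda>x. Q (B *v x)) = transform A (gram Q)"
      using gram_substitution(2)[OF two q1, of Q B] by (simp add: B_def)
  qed
  then have "gram ` act B N1 = gram ` N2" using A(2) by simp
  moreover have "act B N1 \<subseteq> Collect quadratic_form"
    using gram_substitution(1)[OF two q1] by (auto simp: act_def)
  moreover have "inj_on gram (Collect (quadratic_form :: ('a^3 \<Rightarrow> 'a) \<Rightarrow> _))"
    by (rule inj_on_inverseI[of _ form_of]) (simp add: quadratic_form_gram(2)[OF two])
  ultimately have N2: "N2 = act B N1"
    using q2 inj_on_image_eq_iff[of gram "Collect quadratic_form" "act B N1" N2] by blast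
  obtain B' where B': "B ** B' = mat 1" "B' ** B = mat 1"
    using B by (auto simp: invertible_def)
  then have inv: "invertible B'" by (auto simp: invertible_def)
  have translate: "act C N1 = act (B' ** C) N2" for C
    by (simp add: N2 act_act matrix_mul_assoc B')
  show ?thesis
  proof
    show "PGL_orbit N1 \<subseteq> PGL_orbit N2"
      unfolding orbit using translate inv invertible_mult by blast
    show "PGL_orbit N2 \<subseteq> PGL_orbit N1"
      unfolding orbit N2 act_act using B invertible_mult by blast
  qed
qed

section \<open>Lines of a given type in a plane\<close>

lemma line_point_linear:
  "line_point p t a b = mat_scale a (line_point p t 1 0) + mat_scale b (line_point p t 0 1)"
  by (cases t) (simp_all add: line_point.simps mat3_eq_iff mat_scale_def algebra_simps)

lemma line_point_eq_0: "line_point p t a b = 0 \<Longrightarrow> a = 0 \<and> b = 0"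
  by (cases t) (auto simp: line_point.simps mat3_eq_iff)

lemma line_point_symmetric: "transpose (line_point p t a b) = line_point p t a b"
  by (cases t) (simp_all add: line_point.simps mat3_eq_iff transpose_def)

text \<open>
  Each representative is parametrised injectively by \<open>(\<alpha>, \<beta>)\<close>, so its congruent copies are lines, and
  finding one inside a plane is a matter of membership of points.
\<close>

lemma PG5_line_transform:
  assumes "invertible A"
  shows "PG5_line (transform A ` line_rep p t)"
proof -
  define X Y where "X = transform A (line_point p t 1 0)" and "Y = transform A (line_point p t 0 1)"
  have pt: "transform A (line_point p t a b) = mat_scale a X + mat_scale b Y" for a b
    by (subst line_point_linear) (simp add: transform_linear X_def Y_def)
  have L: "transform A ` line_rep p t = {mat_scale a X + mat_scale b Y | a b. True}"
    by (auto simp: line_rep_def simp flip: pt)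
  have indep: "a = 0 \<and> b = 0" if "mat_scale a X + mat_scale b Y = 0" for a b
  proof -
    have "transform A (line_point p t a b) = transform A 0"
      using that by (simp add: pt) (simp add: transform_def)
    then show ?thesis
      using inj_transform[OF assms] line_point_eq_0 by (metis injD)
  qed
  have span: "mats.span {X, Y} = transform A ` line_rep p t"
    unfolding L mats.span_insert mats.span_singleton
    by (auto simp: algebra_simps)
  have "X \<notin> mats.span {Y}"
  proof
    assume "X \<in> mats.span {Y}"
    then obtain k where "X = mat_scale k Y" by (auto simp: mats.span_singleton)
    then have "mat_scale 1 X + mat_scale (- k) Y = 0" by (simp add: mats.scale_minus_left)
    with indep show False by fastforce
  qed
  moreover have "Y \<noteq> 0" using indep[of 0 1] by auto
  ultimately have "mats.independent {X, Y}" "X \<noteq> Y"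
    by (auto simp: mats.independent_insert mats.span_base)
  then have "mats.dim (transform A ` line_rep p t) = 2"
    using mats.dim_eq_card_independent[of "{X, Y}"] by (simp flip: span)
  moreover have "mats.subspace (transform A ` line_rep p t)"
    by (simp flip: span)
  ultimately show ?thesis
    by (auto simp: PG5_line_def line_rep_def transform_symmetric line_point_symmetric)
qed

lemma line_orbit_distribution_eq_0_iff:
  fixes W :: "'a::{field,finite} mat3 set"
  shows "line_orbit_distribution p W t = 0 \<longleftrightarrow> \<not> has_line p t W"
proof -
  have "(\<exists>L. PG5_line L \<and> L \<subseteq> W \<and> L \<in> K_orbit (line_rep p t)) \<longleftrightarrow> has_line p t W"
  proof
    assume "\<exists>L. PG5_line L \<and> L \<subseteq> W \<and> L \<in> K_orbit (line_rep p t)"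
    then obtain A where "invertible A" "transform A ` line_rep p t \<subseteq> W"
      by (auto simp: K_orbit_def transform_def)
    then show "has_line p t W" unfolding has_line_def line_rep_def by blast
  next
    assume "has_line p t W"
    then obtain A where A: "invertible A" "\<forall>a b. transform A (line_point p t a b) \<in> W"
      by (auto simp: has_line_def)
    then have "transform A ` line_rep p t \<subseteq> W" by (auto simp: line_rep_def)
    moreover have "transform A ` line_rep p t \<in> K_orbit (line_rep p t)"
      using A(1) unfolding K_orbit_def transform_def by blast
    ultimately show "\<exists>L. PG5_line L \<and> L \<subseteq> W \<and> L \<in> K_orbit (line_rep p t)"
      using PG5_line_transform[OF A(1)] by blast
  qed
  then show ?thesis
    by (auto simp: line_orbit_distribution_def card_eq_0_iff)
qed

text \<open>
  Squaring is at most two-to-one, so nonzero squares make up at least half of the nonzero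
  elements, and the coset of a non-square \<open>a\<close> is everything else.
\<close>

lemma nonsquare_quotient:
  fixes a b :: "'a::{field,finite}"
  assumes "\<not> is_square a" "\<not> is_square b"
  obtains s where "s \<noteq> 0" "b = a * s\<^sup>2"
proof -
  define S where "S = (\<lambda>x::'a. x\<^sup>2) ` (- {0})"
  have a: "a \<noteq> x\<^sup>2" and b: "b \<noteq> x\<^sup>2" for x
    using assms by (auto simp: is_nth_power_def)
  have a0: "a \<noteq> 0" and b0: "b \<noteq> 0" using a[of 0] b[of 0] by auto
  have "card {x. x\<^sup>2 = s} \<le> 2" if s: "s \<in> S" for s
  proof -
    obtain y where "s = y\<^sup>2" using s by (auto simp: S_def)
    then have "{x. x\<^sup>2 = s} \<subseteq> {y, - y}" by (auto simp: power2_eq_iff)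
    then have "card {x. x\<^sup>2 = s} \<le> card {y, - y}" by (intro card_mono) auto
    also have "\<dots> \<le> 2" by (simp add: card_insert_if)
    finally show ?thesis .
  qed
  then have "card (\<Union>s\<in>S. {x. x\<^sup>2 = s}) \<le> (\<Sum>s\<in>S. 2)"
    by (intro order_trans[OF card_UN_le] sum_mono) auto
  moreover have "- {0} \<subseteq> (\<Union>s\<in>S. {x. x\<^sup>2 = s})" by (auto simp: S_def)
  ultimately have "card (- {0::'a}) \<le> 2 * card S"
    using card_mono[of "\<Union>s\<in>S. {x. x\<^sup>2 = s}" "- {0}"] by simp
  moreover have "S \<inter> (*) a ` S = {}"
  proof -
    have "a = (x / y)\<^sup>2" if "x\<^sup>2 = a * y\<^sup>2" "y \<noteq> 0" for x y
      using that by (simp add: power_divide)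
    then show ?thesis using a by (auto simp: S_def)
  qed
  moreover have "card ((*) a ` S) = card S"
    using a0 by (intro card_image) (auto simp: inj_on_def)
  ultimately have "card (- {0::'a}) \<le> card (S \<union> (*) a ` S)"
    by (simp add: card_Un_disjoint)
  moreover have "S \<union> (*) a ` S \<subseteq> - {0}" using a0 by (auto simp: S_def)
  ultimately have "S \<union> (*) a ` S = - {0}" by (simp add: card_seteq)
  then have "b \<in> S \<union> (*) a ` S" using b0 by simp
  then show ?thesis using b that by (auto simp: S_def)
qed

section \<open>Lines through the only point of rank one\<close>

lemma congruent_familyI:
  fixes W :: "'a::{field,finite} mat3 set"
  assumes "symmetric_plane W" "invertible A" "\<And>M. M \<in> W \<Longrightarrow> transform A M \<in> family F"
  shows "congruent W (family F)"
proof -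
  obtain B where "invertible B" and B: "\<And>M. transform B (transform A M) = M"
    using transform_inverse[OF assms(2)] by metis
  show ?thesis
  proof (rule congruent_family[OF assms(1) \<open>invertible B\<close>])
    fix M assume "M \<in> W"
    then show "\<exists>a b c. M = transform B (F a b c)"
      using assms(3)[of M] B[of M] unfolding family_def by force
  qed
qed

lemma has_lineD:
  assumes "has_line p t W"
  obtains p1 q1 r1 p2 q2 r2 p3 q3 r3 where
    "p1 * (q2 * r3 - r2 * q3) - q1 * (p2 * r3 - r2 * p3) + r1 * (p2 * q3 - q2 * p3) \<noteq> 0"
    "\<And>a b. transform (mat_rows [p1,q1,r1] [p2,q2,r2] [p3,q3,r3]) (line_point p t a b) \<in> W"
proof -
  obtain A where A: "invertible A" "\<And>a b. transform A (line_point p t a b) \<in> W"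
    using assms by (auto simp: has_line_def)
  obtain p1 q1 r1 p2 q2 r2 p3 q3 r3 where "A = mat_rows [p1,q1,r1] [p2,q2,r2] [p3,q3,r3]"
    by (rule mat3_cases)
  with A show ?thesis using that[of p1 q2 r3 r2 q3 q1 p2 p3 r1] by simp
qed

lemma has_lineI:
  "invertible A \<Longrightarrow> (\<And>a b. transform A (line_point p t a b) \<in> W) \<Longrightarrow> has_line p t W"
  unfolding has_line_def by blast

text \<open>
  A line through the point \<open>E11\<close> lies in \<open>W\<close> as soon as one more of its points does.
\<close>

lemma combination_E11:
  assumes "mats.subspace W" "sym3 1 0 0 0 0 0 \<in> W" "sym3 a b c d e f \<in> W"
  shows "sym3 (k * a + l) (k * b) (k * c) (k * d) (k * e) (k * f) \<in> W"
proof -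
  have "mat_scale k (sym3 a b c d e f) + mat_scale l (sym3 1 0 0 0 0 0) \<in> W"
    using assms by (simp add: mats.subspace_def del: sym3_arith)
  then show ?thesis by simp
qed

text \<open>
  The line joining two points of rank one has type \<open>o\<^sub>5\<close>.
\<close>

lemma unique_rank_one_point:
  assumes W: "mats.subspace W" "sym3 1 0 0 0 0 0 \<in> W" and no: "\<not> has_line p O5 W"
    and "veronese x y z \<in> W"
  shows "y = 0" "z = 0"
proof -
  have *: "sym3 (b * (x * x) + a) (b * (x * y)) (b * (x * z)) (b * (y * y)) (b * (y * z)) (b * (z * z)) \<in> W" for a b
    using combination_E11[OF W] assms(4) by (simp add: veronese_def)
  show y: "y = 0"
  proof (rule ccontr)
    assume "y \<noteq> 0"
    then have "has_line p O5 W"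
      using * by (intro has_lineI[of "mat_rows [1,x,0] [0,y,0] [0,z,1]"])
        (simp_all add: algebra_simps)
    with no show False by simp
  qed
  show "z = 0"
  proof (rule ccontr)
    assume "z \<noteq> 0"
    then have "has_line p O5 W"
      using * y by (intro has_lineI[of "mat_rows [1,x,0] [0,y,1] [0,z,0]"])
        (simp_all add: algebra_simps)
    with no show False by simp
  qed
qed

text \<open>
  Modulo \<open>E11\<close>, a matrix with vanishing block is \<open>2 e\<^sub>1 w\<close> with \<open>w\<close> in the span of \<open>e\<^sub>2\<close> and \<open>e\<^sub>3\<close>.
\<close>

lemma O6_I:
  assumes W: "mats.subspace W" "sym3 1 0 0 0 0 0 \<in> W"
    and M: "sym3 a x y 0 0 0 \<in> W" "x \<noteq> 0 \<or> y \<noteq> 0"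
  shows "has_line p O6 W"
proof -
  have *: "sym3 k (l * x) (l * y) 0 0 0 \<in> W" for k l
    using combination_E11[OF W M(1), of l "k - l * a"] by simp
  show ?thesis
  proof (cases "x = 0")
    case True
    then show ?thesis using M(2) *
      by (intro has_lineI[of "mat_rows [1,0,0] [0,x,1] [0,y,0]"])
        (simp_all add: algebra_simps)
  next
    case False
    then show ?thesis using *
      by (intro has_lineI[of "mat_rows [1,0,0] [0,x,0] [0,y,1]"])
        (simp_all add: algebra_simps)
  qed
qed

text \<open>
  A block of rank one is \<open>k u u\<^sup>T\<close>. Modulo \<open>E11\<close> the matrix is therefore \<open>k (u\<^sup>2 + 2 e\<^sub>1 w)\<close>, which spans
  with \<open>E11\<close> a line of type \<open>o\<^sub>9\<close> if \<open>u\<close> and \<open>w\<close> are independent. If they are dependent, completing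
  the square produces a second point of rank one.
\<close>

lemma O9_I:
  assumes W: "mats.subspace W" "sym3 1 0 0 0 0 0 \<in> W" and no: "\<not> has_line p O5 W"
    and M: "sym3 a b c d e f \<in> W" "d \<noteq> 0 \<or> f \<noteq> 0" "e * e = d * f"
  shows "has_line p O9 W"
proof -
  obtain k y z where k: "k \<noteq> 0" "d = k * (y * y)" "e = k * (y * z)" "f = k * (z * z)" "y \<noteq> 0 \<or> z \<noteq> 0"
  proof (cases "d = 0")
    case True
    with M show ?thesis by (intro that[of f 0 1]) auto
  next
    case False
    with M show ?thesis by (intro that[of d 1 "e / d"]) (auto simp: field_simps)
  qed
  define i where "i = inverse k"
  have i: "i * k = 1" using k(1) by (simp add: i_def)
  have *: "sym3 l (m * (i * b)) (m * (i * c)) (m * (y * y)) (m * (y * z)) (m * (z * z)) \<in> W" for l m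
  proof -
    have ik: "i * (k * u) = u" for u using i by algebra
    show ?thesis
      using combination_E11[OF W M(1), of "m * i" "l - m * i * a"] by (simp add: k(2-4) mult.assoc ik)
  qed
  \<comment> \<open>in the notation of the comment above, \<open>u = (y, z)\<close> and \<open>w = (i b, i c)\<close>\<close>
  have "y * (i * c) \<noteq> z * (i * b)"
  proof
    assume par: "y * (i * c) = z * (i * b)"
    obtain t where t: "i * b = t * y" "i * c = t * z"
    proof (cases "y = 0")
      case True
      with k(5) par show ?thesis by (intro that[of "i * c / z"]) auto
    next
      case False
      with par show ?thesis by (intro that[of "i * b / y"]) (auto simp: field_simps)
    qed
    have "veronese t y z \<in> W"
      using *[of "t * t" 1] by (simp add: veronese_def t)
    with unique_rank_one_point[OF W no] k(5) show False by blast
  qed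
  then show ?thesis
    using * by (intro has_lineI[of "mat_rows [1,0,0] [0,y,i*b] [0,z,i*c]"])
      (simp_all add: algebra_simps)
qed

text \<open>
  Completing the square gives \<open>M = d (u\<^sup>2 - n w\<^sup>2)\<close> modulo \<open>E11\<close>, where the \<open>e\<^sub>1\<close>-coordinates of \<open>u\<close> and \<open>w\<close> are
  chosen to match the first row of \<open>M\<close>. The parameter \<open>n\<close> is \<open>1\<close> for \<open>o\<^sub>8\<^sub>,\<^sub>1\<close> and \<open>eps p\<close> for \<open>o\<^sub>8\<^sub>,\<^sub>2\<close>.
\<close>

lemma O8_I:
  assumes W: "mats.subspace W" "sym3 1 0 0 0 0 0 \<in> W"
    and M: "sym3 a b c d e f \<in> W" "d \<noteq> 0" "e * e - d * f = n * (s * s)" "s \<noteq> 0" "n \<noteq> 0"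
    and t: "\<And>a b. line_point p t a b = sym3 a 0 0 b 0 (- (n * b))"
  shows "has_line p t W"
proof -
  define i where "i = inverse d"
  have i: "i * d = 1" using M(2) by (simp add: i_def)
  define j where "j = inverse (n * s)"
  have j: "j * (n * s) = 1" unfolding j_def using M(4,5) by (intro left_inverse) simp
  have *: "sym3 l (m * i * b) (m * i * c) (m * i * d) (m * i * e) (m * i * f) \<in> W" for l m
    using combination_E11[OF W M(1), of "m * i" "l - m * i * a"] by simp
  let ?x = "i * b" and ?y = "(i * b * e - c) * j"
  have eq: "transform (mat_rows [1, ?x, ?y] [0, 1, 0] [0, i * e, i * s]) (line_point p t l m) =
    sym3 (l + m * (?x * ?x - n * (?y * ?y))) (m * i * b) (m * i * c) (m * i * d) (m * i * e) (m * i * f)" for l m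
    unfolding t transform_sym3 sym3_eq_iff
  proof (intro conjI, goal_cases)
    case 1 show ?case by algebra
    case 2 show ?case by algebra
    case 3 show ?case using j by algebra
    case 4 show ?case using i by algebra
    case 5 show ?case by algebra
    case 6 show ?case using i M(3) by algebra
  qed
  have "i * s \<noteq> 0" using M(2,4) by (simp add: i_def)
  then have "invertible (mat_rows [1, ?x, ?y] [0, 1, 0] [0, i * e, i * s])" by simp
  then show ?thesis
    by (rule has_lineI) (unfold eq, rule *)
qed

text \<open>
  The point of rank one on the line has to be \<open>E11\<close>, so the transforming matrix is block
  triangular, and \<open>- det\<close> of the block changes by the square of a determinant.
\<close>

lemma O8_D:
  assumes W: "mats.subspace W" "sym3 1 0 0 0 0 0 \<in> W" and no: "\<not> has_line p O5 W"
    and t: "\<And>a b. line_point p t a b = sym3 a 0 0 b 0 (- (n * b))" and l: "has_line p t W"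
  obtains a b c d e f s where "sym3 a b c d e f \<in> W" "s \<noteq> 0" "e * e - d * f = n * (s * s)"
proof -
  obtain p1 q1 r1 p2 q2 r2 p3 q3 r3 where
    det: "p1 * (q2 * r3 - r2 * q3) - q1 * (p2 * r3 - r2 * p3) + r1 * (p2 * q3 - q2 * p3) \<noteq> 0"
    and A: "\<And>a b. transform (mat_rows [p1,q1,r1] [p2,q2,r2] [p3,q3,r3]) (line_point p t a b) \<in> W"
    by (rule has_lineD[OF l]) (rule that)
  have "veronese p1 p2 p3 \<in> W"
    using A[of 1 0] by (simp add: t veronese_def)
  then have p: "p2 = 0" "p3 = 0"
    using unique_rank_one_point[OF W no] by blast+
  have M: "sym3 (q1 * q1 - n * r1 * r1) (q1 * q2 - n * r1 * r2) (q1 * q3 - n * r1 * r3)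
      (q2 * q2 - n * r2 * r2) (q2 * q3 - n * r2 * r3) (q3 * q3 - n * r3 * r3) \<in> W"
    using A[of 0 1] by (simp add: t)
  show ?thesis
  proof (rule that[OF M, of "q2 * r3 - r2 * q3"])
    show "q2 * r3 - r2 * q3 \<noteq> 0" using det p by auto
  qed algebra
qed

text \<open>
  The point of rank one on the line is \<open>E11\<close> again, and the block of the other spanning matrix is a
  square \<open>u u\<^sup>T\<close>.
\<close>

lemma O9_D:
  assumes W: "mats.subspace W" "sym3 1 0 0 0 0 0 \<in> W" and no: "\<not> has_line p O5 W"
    and l: "has_line p O9 W"
  obtains a b c d e f where "sym3 a b c d e f \<in> W" "d \<noteq> 0 \<or> f \<noteq> 0" "e * e = d * f"
proof -
  obtain p1 q1 r1 p2 q2 r2 p3 q3 r3 where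
    det: "p1 * (q2 * r3 - r2 * q3) - q1 * (p2 * r3 - r2 * p3) + r1 * (p2 * q3 - q2 * p3) \<noteq> 0"
    and A: "\<And>a b. transform (mat_rows [p1,q1,r1] [p2,q2,r2] [p3,q3,r3]) (line_point p O9 a b) \<in> W"
    by (rule has_lineD[OF l]) (rule that)
  have "veronese p1 p2 p3 \<in> W"
    using A[of 1 0] by (simp add: veronese_def)
  then have p: "p2 = 0" "p3 = 0"
    using unique_rank_one_point[OF W no] by blast+
  have "sym3 (q1 * q1 + 2 * p1 * r1) (q1 * q2 + p1 * r2) (q1 * q3 + p1 * r3) (q2 * q2) (q2 * q3) (q3 * q3) \<in> W"
    using A[of 0 1] p by (simp)
  moreover have "q2 * q2 \<noteq> 0 \<or> q3 * q3 \<noteq> 0" using det p by auto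
  moreover have "q2 * q3 * (q2 * q3) = q2 * q2 * (q3 * q3)" by algebra
  ultimately show ?thesis by (rule that)
qed

section \<open>Planes with two points of rank one\<close>

text \<open>
  The five planes with two points of rank one. Such a plane is spanned by \<open>e\<^sub>1\<^sup>2\<close>, \<open>e\<^sub>2\<^sup>2\<close> and a third
  element: \<open>e\<^sub>3\<^sup>2\<close>, \<open>e\<^sub>3\<^sup>2 + 2 e\<^sub>1 e\<^sub>2\<close>, \<open>2 e\<^sub>1 e\<^sub>2\<close>, the tangent direction \<open>2 e\<^sub>1 e\<^sub>3\<close> at one of the two points, or
  \<open>2 (e\<^sub>1 + e\<^sub>2) e\<^sub>3\<close>. In the fourth plane \<open>e\<^sub>2\<close> and \<open>e\<^sub>3\<close> are exchanged, so that the third coordinate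
  axis splits off and \<open>no_O12_if_axis_splits\<close> applies to it.
\<close>

abbreviation triangle_plane :: "'a::field mat3 set" where
  "triangle_plane \<equiv> family (\<lambda>a b c. sym3 a 0 0 b 0 c)"

abbreviation chord_plane :: "'a::field mat3 set" where
  "chord_plane \<equiv> family (\<lambda>a b c. sym3 a c 0 b 0 c)"

abbreviation conic_plane :: "'a::field mat3 set" where
  "conic_plane \<equiv> family (\<lambda>a b c. sym3 a c 0 b 0 0)"

abbreviation point_tangent_plane :: "'a::field mat3 set" where
  "point_tangent_plane \<equiv> family (\<lambda>a b c. sym3 a b 0 0 0 c)"

abbreviation bisecant_plane :: "'a::field mat3 set" where
  "bisecant_plane \<equiv> family (\<lambda>a b c. sym3 a 0 c b c 0)"

lemma family_congruent:
  fixes E F :: "'a::{field,finite} \<Rightarrow> _"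
  assumes "symmetric_plane (family E)" "invertible B"
    "\<And>a b c. \<exists>a' b' c'. E a b c = transform B (F a' b' c')"
  shows "congruent (family E) (family F)"
  using assms by (intro congruent_family) (auto simp: family_def)

text \<open>
  A congruence that moves a given line of the plane to standard position.
\<close>

lemma pull_back_line:
  assumes "symmetric_plane W" "invertible A" "\<And>a b. transform A (X a b) \<in> W"
  obtains W' where "congruent W W'" "symmetric_plane W'" "\<And>a b. X a b \<in> W'"
proof -
  obtain B where B: "invertible B" "\<And>M. transform B (transform A M) = M"
    using transform_inverse[OF assms(2)] by metis
  show ?thesis
  proof (rule that[of "transform B ` W"])
    show "congruent W (transform B ` W)" using B(1) by (auto simp: congruent_def)
    show "symmetric_plane (transform B ` W)" using symmetric_plane_transform assms(1) B(1) by blast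
    show "X a b \<in> transform B ` W" for a b
      using assms(3)[of a b] B(2)[of "X a b"] by (metis imageI)
  qed
qed

lemma symmetric_plane_sym3:
  assumes "symmetric_plane W" "M \<in> W"
  obtains a b c d e f where "M = sym3 a b c d e f"
proof -
  have "transpose M = M" using assms by (auto simp: symmetric_plane_def)
  then show ?thesis by (rule symmetric_sym3) (rule that)
qed

lemma plane_through_O5:
  fixes W :: "'a::{field,finite} mat3 set"
  assumes "symmetric_plane W" "has_line p O5 W"
  obtains z1 q x z2 y z where
    "congruent W (family (\<lambda>a b c. sym3 (a + c * z1) (c * q) (c * x) (b + c * z2) (c * y) (c * z)))"
    "symmetric_plane (family (\<lambda>a b c. sym3 (a + c * z1) (c * q) (c * x) (b + c * z2) (c * y) (c * z)))"
proof -
  obtain A where "invertible A" "\<And>a b. transform A (sym3 a 0 0 b 0 0) \<in> W"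
    using assms(2) by (auto simp: has_line_def)
  then obtain W' where W': "congruent W W'" "symmetric_plane W'" "\<And>a b. sym3 a 0 0 b 0 0 \<in> W'"
    by (rule pull_back_line[OF assms(1)]) (rule that)
  obtain Z where Z: "Z \<in> W'"
    "W' = family (\<lambda>a b c. mat_scale a (sym3 1 0 0 0 0 0) + mat_scale b (sym3 0 0 0 1 0 0) + mat_scale c Z)"
    by (rule symmetric_plane_extend2[OF W'(2) W'(3)[of 1 0] W'(3)[of 0 1]]) (auto simp: zero_sym3)
  obtain z1 q x z2 y z where "Z = sym3 z1 q x z2 y z"
    by (rule symmetric_plane_sym3[OF W'(2) Z(1)])
  then have "W' = family (\<lambda>a b c. sym3 (a + c * z1) (c * q) (c * x) (b + c * z2) (c * y) (c * z))"
    using Z(2) by simp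
  then show ?thesis using that W'(1,2) by blast
qed

text \<open>
  With \<open>Z\<close> the third spanning matrix, \<open>e\<^sub>3\<close> is replaced so as to complete the square if \<open>z \<noteq> 0\<close>, and to absorb
  the mixed terms if \<open>z = 0\<close>.
\<close>

lemma planes_with_O5:
  fixes W :: "'a::{field,finite} mat3 set"
  assumes two: "(2::'a) \<noteq> 0" and "symmetric_plane W" "has_line p O5 W"
  shows "congruent W triangle_plane \<or> congruent W chord_plane \<or> congruent W conic_plane \<or>
    congruent W point_tangent_plane \<or> congruent W bisecant_plane"
proof -
  obtain z1 q x z2 y z where W:
    "congruent W (family (\<lambda>a b c. sym3 (a + c * z1) (c * q) (c * x) (b + c * z2) (c * y) (c * z)))"
    "symmetric_plane (family (\<lambda>a b c. sym3 (a + c * z1) (c * q) (c * x) (b + c * z2) (c * y) (c * z)))"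
    by (rule plane_through_O5[OF assms(2,3)]) (rule that)
  note fam = congruent_trans[OF W(1) family_congruent[OF W(2)]]
  consider "z \<noteq> 0" "q = x * y / z" | "z \<noteq> 0" "q \<noteq> x * y / z" | "z = 0" "x = 0" "y = 0"
    | "z = 0" "x \<noteq> 0" "y = 0" | "z = 0" "x = 0" "y \<noteq> 0" | "z = 0" "x \<noteq> 0" "y \<noteq> 0"
    by blast
  then show ?thesis
  proof cases
    case 1
    have "congruent W triangle_plane"
    proof (rule fam[of "mat_rows [1,0,x/z] [0,1,y/z] [0,0,1]"])
      show "\<exists>a' b' c'. sym3 (a + c * z1) (c * q) (c * x) (b + c * z2) (c * y) (c * z) =
        transform (mat_rows [1,0,x/z] [0,1,y/z] [0,0,1]) (sym3 a' 0 0 b' 0 c')" for a b c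
        by (rule exI[of _ "a + c * z1 - c * x * x / z"], rule exI[of _ "b + c * z2 - c * y * y / z"],
            rule exI[of _ "c * z"]) (use 1 in \<open>simp add: field_simps\<close>)
    qed simp
    then show ?thesis by simp
  next
    case 2
    define k where "k = (q - x * y / z) / z"
    have k: "k \<noteq> 0" "q = z * k + x * y / z" using 2 by (auto simp: k_def)
    have "congruent W chord_plane"
    proof (rule fam[of "mat_rows [k,0,x/z] [0,1,y/z] [0,0,1]"])
      show "\<exists>a' b' c'. sym3 (a + c * z1) (c * q) (c * x) (b + c * z2) (c * y) (c * z) =
        transform (mat_rows [k,0,x/z] [0,1,y/z] [0,0,1]) (sym3 a' c' 0 b' 0 c')" for a b c
        by (rule exI[of _ "(a + c * z1 - c * x * x / z) / (k * k)"],
            rule exI[of _ "b + c * z2 - c * y * y / z"], rule exI[of _ "c * z"])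
          (use 2 k(1) in \<open>simp add: k(2) field_simps\<close>)
    qed (use k in simp)
    then show ?thesis by simp
  next
    case 3
    have "congruent W conic_plane"
    proof (rule fam[of "mat_rows [1,0,0] [0,1,0] [0,0,1]"])
      show "\<exists>a' b' c'. sym3 (a + c * z1) (c * q) (c * x) (b + c * z2) (c * y) (c * z) =
        transform (mat_rows [1,0,0] [0,1,0] [0,0,1]) (sym3 a' c' 0 b' 0 0)" for a b c
        using 3 by simp
    qed simp
    then show ?thesis by simp
  next
    case 4
    have "congruent W point_tangent_plane"
    proof (rule fam[of "mat_rows [1,0,0] [0,q,1] [0,x,0]"])
      show "\<exists>a' b' c'. sym3 (a + c * z1) (c * q) (c * x) (b + c * z2) (c * y) (c * z) =
        transform (mat_rows [1,0,0] [0,q,1] [0,x,0]) (sym3 a' b' 0 0 0 c')" for a b c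
        using 4 by auto
    qed (use 4 in simp)
    then show ?thesis by simp
  next
    case 5
    have "congruent W point_tangent_plane"
    proof (rule fam[of "mat_rows [0,q,1] [1,0,0] [0,y,0]"])
      show "\<exists>a' b' c'. sym3 (a + c * z1) (c * q) (c * x) (b + c * z2) (c * y) (c * z) =
        transform (mat_rows [0,q,1] [1,0,0] [0,y,0]) (sym3 a' b' 0 0 0 c')" for a b c
        using 5 by auto
    qed (use 5 in simp)
    then show ?thesis by simp
  next
    case 6
    have "congruent W bisecant_plane"
    proof (rule fam[of "mat_rows [x,0,0] [0,y,q/x] [0,0,1]"])
      show "\<exists>a' b' c'. sym3 (a + c * z1) (c * q) (c * x) (b + c * z2) (c * y) (c * z) =
        transform (mat_rows [x,0,0] [0,y,q/x] [0,0,1]) (sym3 a' 0 c' b' c' 0)" for a b c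
        by (rule exI[of _ "(a + c * z1) / (x * x)"],
            rule exI[of _ "(b + c * z2 - 2 * c * y * q / x) / (y * y)"], rule exI[of _ c])
          (use 6 in \<open>simp add: field_simps\<close>)
    qed (use 6 in simp)
    then show ?thesis by simp
  qed
qed

text \<open>
  The matrices of a line of type \<open>o\<^sub>1\<^sub>2\<close> are the products \<open>2 v y\<close> with \<open>y\<close> in a two-dimensional space of
  vectors independent of \<open>v\<close>. If the entries \<open>(1,3)\<close> and \<open>(2,3)\<close> of \<open>2 v y\<close> vanish, then either \<open>y\<close> is
  proportional to a vector that depends on \<open>v\<close> only or \<open>y\<close> lies in a plane containing \<open>v\<close>.
\<close>

lemma no_O12_if_axis_splits:
  assumes "\<And>a b c d e f. sym3 a b c d e f \<in> W \<Longrightarrow> c = 0 \<and> e = 0"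
  shows "\<not> has_line p O12 W"
proof
  assume l: "has_line p O12 W"
  obtain p1 q1 r1 p2 q2 r2 p3 q3 r3 where
    det: "p1 * (q2 * r3 - r2 * q3) - q1 * (p2 * r3 - r2 * p3) + r1 * (p2 * q3 - q2 * p3) \<noteq> 0"
    and A: "\<And>a b. transform (mat_rows [p1,q1,r1] [p2,q2,r2] [p3,q3,r3]) (line_point p O12 a b) \<in> W"
    by (rule has_lineD[OF l]) (rule that)
  have eqs: "p1 * q3 + p3 * q1 = 0" "p2 * q3 + p3 * q2 = 0"
    "q1 * r3 + q3 * r1 = 0" "q2 * r3 + q3 * r2 = 0"
    using A[of 1 0, simplified, THEN assms] A[of 0 1, simplified, THEN assms] by simp_all
  show False
  proof (cases "q3 = 0")
    case True
    then have "q1 * p3 = 0" "q2 * p3 = 0" "q1 * r3 = 0" "q2 * r3 = 0"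
      using eqs by (auto simp: mult.commute)
    then show False using det True by (auto simp: algebra_simps)
  next
    case False
    have "q3 * q3 * (p1 * (q2 * r3 - r2 * q3) - q1 * (p2 * r3 - r2 * p3) + r1 * (p2 * q3 - q2 * p3)) = 0"
      using eqs by algebra
    with det False show False by simp
  qed
qed

lemma O5_normal_forms_O12:
  assumes two: "(2::'a::field) \<noteq> 0"
  shows "\<not> has_line p O12 (triangle_plane :: 'a mat3 set)" "\<not> has_line p O12 (chord_plane :: 'a mat3 set)"
    "\<not> has_line p O12 (conic_plane :: 'a mat3 set)" "\<not> has_line p O12 (point_tangent_plane :: 'a mat3 set)"
    "has_line p O12 (bisecant_plane :: 'a mat3 set)"
proof -
  have "invertible (mat_rows [1,1,0] [-1,1,0] [0,0,1 :: 'a])" using two by simp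
  then show "has_line p O12 (bisecant_plane :: 'a mat3 set)"
    by (rule has_lineI) (auto simp: family_def)
qed (rule no_O12_if_axis_splits; auto simp: family_def)+

lemma O5_normal_forms_O9:
  shows "\<not> has_line p O9 (triangle_plane :: 'a::field mat3 set)" "has_line p O9 (chord_plane :: 'a mat3 set)"
    "\<not> has_line p O9 (conic_plane :: 'a mat3 set)" "has_line p O9 (point_tangent_plane :: 'a mat3 set)"
proof -
  have "invertible (mat_rows [1,0,0] [0,0,1] [0,1,0 :: 'a])" by simp
  then show "has_line p O9 (chord_plane :: 'a mat3 set)" "has_line p O9 (point_tangent_plane :: 'a mat3 set)"
    by (rule has_lineI, auto simp: family_def)+
  show "\<not> has_line p O9 (triangle_plane :: 'a mat3 set)"
  proof
    assume l: "has_line p O9 (triangle_plane :: 'a mat3 set)"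
    obtain p1 q1 r1 p2 q2 r2 p3 q3 r3 where
      det: "p1 * (q2 * r3 - r2 * q3) - q1 * (p2 * r3 - r2 * p3) + r1 * (p2 * q3 - q2 * p3) \<noteq> (0::'a)"
      and A: "\<And>a b. transform (mat_rows [p1,q1,r1] [p2,q2,r2] [p3,q3,r3]) (line_point p O9 a b) \<in> triangle_plane"
      by (rule has_lineD[OF l]) (rule that)
    have "p1 * p2 = 0" "p1 * p3 = 0" "p2 * p3 = 0"
      using A[of 1 0] by (auto simp: family_def)
    moreover have "q1 * q2 + (p1 * r2 + p2 * r1) = 0" "q1 * q3 + (p1 * r3 + p3 * r1) = 0"
      "q2 * q3 + (p2 * r3 + p3 * r2) = 0"
      using A[of 0 1] by (auto simp: family_def)
    ultimately show False using det by (auto simp: algebra_simps)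
  qed
  show "\<not> has_line p O9 (conic_plane :: 'a mat3 set)"
  proof
    assume l: "has_line p O9 (conic_plane :: 'a mat3 set)"
    obtain p1 q1 r1 p2 q2 r2 p3 q3 r3 where
      det: "p1 * (q2 * r3 - r2 * q3) - q1 * (p2 * r3 - r2 * p3) + r1 * (p2 * q3 - q2 * p3) \<noteq> (0::'a)"
      and A: "\<And>a b. transform (mat_rows [p1,q1,r1] [p2,q2,r2] [p3,q3,r3]) (line_point p O9 a b) \<in> conic_plane"
      by (rule has_lineD[OF l]) (rule that)
    have "p3 = 0" using A[of 1 0] by (auto simp: family_def)
    moreover from this have "q3 = 0" "p1 * r3 = 0" "p2 * r3 = 0"
      using A[of 0 1] by (auto simp: family_def)
    ultimately show False using det by auto
  qed
qed

lemma O5_normal_forms_O6: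
  assumes two: "(2::'a::field) \<noteq> 0"
  shows "\<not> has_line p O6 (triangle_plane :: 'a mat3 set)" "\<not> has_line p O6 (chord_plane :: 'a mat3 set)"
    "has_line p O6 (conic_plane :: 'a mat3 set)" "has_line p O6 (point_tangent_plane :: 'a mat3 set)"
proof -
  have "invertible (mat_rows [1,0,0] [0,1,0] [0,0,1 :: 'a])" by simp
  then show "has_line p O6 (conic_plane :: 'a mat3 set)" "has_line p O6 (point_tangent_plane :: 'a mat3 set)"
    by (rule has_lineI, auto simp: family_def)+
  show "\<not> has_line p O6 (triangle_plane :: 'a mat3 set)"
  proof
    assume l: "has_line p O6 (triangle_plane :: 'a mat3 set)"
    obtain p1 q1 r1 p2 q2 r2 p3 q3 r3 where
      det: "p1 * (q2 * r3 - r2 * q3) - q1 * (p2 * r3 - r2 * p3) + r1 * (p2 * q3 - q2 * p3) \<noteq> (0::'a)"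
      and A: "\<And>a b. transform (mat_rows [p1,q1,r1] [p2,q2,r2] [p3,q3,r3]) (line_point p O6 a b) \<in> triangle_plane"
      by (rule has_lineD[OF l]) (rule that)
    have "p1 * p2 = 0" "p1 * p3 = 0" "p2 * p3 = 0"
      using A[of 1 0] by (auto simp: family_def)
    moreover have "p1 * q2 + p2 * q1 = 0" "p1 * q3 + p3 * q1 = 0" "p2 * q3 + p3 * q2 = 0"
      using A[of 0 1] by (auto simp: family_def)
    ultimately show False using det by (auto simp: algebra_simps)
  qed
  show "\<not> has_line p O6 (chord_plane :: 'a mat3 set)"
  proof
    assume l: "has_line p O6 (chord_plane :: 'a mat3 set)"
    obtain p1 q1 r1 p2 q2 r2 p3 q3 r3 where
      det: "p1 * (q2 * r3 - r2 * q3) - q1 * (p2 * r3 - r2 * p3) + r1 * (p2 * q3 - q2 * p3) \<noteq> (0::'a)"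
      and A: "\<And>a b. transform (mat_rows [p1,q1,r1] [p2,q2,r2] [p3,q3,r3]) (line_point p O6 a b) \<in> chord_plane"
      by (rule has_lineD[OF l]) (rule that)
    have 1: "p1 * p3 = 0" "p2 * p3 = 0" "p1 * p2 = p3 * p3"
      using A[of 1 0] by (auto simp: family_def)
    then have p3: "p3 = 0" by auto
    have "p1 * q3 = 0" "p2 * q3 = 0" "p1 * q2 + p2 * q1 = 0"
      using A[of 0 1] p3 by (auto simp: family_def)
    then show False using det 1 p3 by (auto simp: algebra_simps)
  qed
qed

section \<open>Planes with one point of rank one and a line of type $o_6$\<close>

text \<open>
  The planes with a single point of rank one, \<open>e\<^sub>1\<^sup>2\<close>, that contain the tangent direction
  \<open>2 e\<^sub>1 e\<^sub>2\<close> to the Veronese surface. The third spanning element is \<open>2 e\<^sub>1 e\<^sub>3\<close>, \<open>2 e\<^sub>2 e\<^sub>3\<close>,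
  \<open>n e\<^sub>2\<^sup>2 + e\<^sub>3\<^sup>2\<close> with \<open>n \<noteq> 0\<close>, or \<open>e\<^sub>2\<^sup>2 + 2 e\<^sub>1 e\<^sub>3\<close>. The first one is the tangent plane of the surface.
\<close>

abbreviation surface_tangent_plane :: "'a::field mat3 set" where
  "surface_tangent_plane \<equiv> family (\<lambda>a b c. sym3 a b c 0 0 0)"

abbreviation line_pair_plane :: "'a::field mat3 set" where
  "line_pair_plane \<equiv> family (\<lambda>a b c. sym3 a b 0 0 c 0)"

abbreviation binary_plane :: "'a::field \<Rightarrow> 'a mat3 set" where
  "binary_plane n \<equiv> family (\<lambda>a b c. sym3 a b 0 (n * c) 0 c)"

abbreviation osculating_plane :: "'a::field mat3 set" where
  "osculating_plane \<equiv> family (\<lambda>a b c. sym3 a b c c 0 0)"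

lemma congruent_plane_through_E11:
  assumes "symmetric_plane W" "veronese x y z \<in> W" "(x, y, z) \<noteq> (0, 0, 0)"
  obtains W' where "congruent W W'" "symmetric_plane W'" "sym3 1 0 0 0 0 0 \<in> W'"
proof -
  obtain B where B: "invertible B" "\<And>k. transform B (sym3 k 0 0 0 0 0) = mat_scale k (veronese x y z)"
    by (rule invertible_first_column[OF assms(3)]) (rule that)
  have "transform B (sym3 a 0 0 0 0 0) \<in> W" for a
    using assms(1,2) unfolding B(2) by (simp add: symmetric_plane_def mats.subspace_scale)
  then obtain W' where "congruent W W'" "symmetric_plane W'" "\<And>a b::'a. sym3 a 0 0 0 0 0 \<in> W'"
    by (rule pull_back_line[OF assms(1) B(1), where X = "\<lambda>a b. sym3 a 0 0 0 0 0"]) (rule that)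
  then show ?thesis using that by blast
qed

lemma plane_through_O6:
  fixes W :: "'a::{field,finite} mat3 set"
  assumes "symmetric_plane W" "has_line p O6 W"
  obtains z1 z2 x m n k where
    "congruent W (family (\<lambda>a b c. sym3 (a + c * z1) (b + c * z2) (c * x) (c * m) (c * n) (c * k)))"
    "symmetric_plane (family (\<lambda>a b c. sym3 (a + c * z1) (b + c * z2) (c * x) (c * m) (c * n) (c * k)))"
proof -
  obtain A where "invertible A" "\<And>a b. transform A (sym3 a b 0 0 0 0) \<in> W"
    using assms(2) by (auto simp: has_line_def)
  then obtain W' where W': "congruent W W'" "symmetric_plane W'" "\<And>a b. sym3 a b 0 0 0 0 \<in> W'"
    by (rule pull_back_line[OF assms(1)]) (rule that)
  obtain Z where Z: "Z \<in> W'"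
    "W' = family (\<lambda>a b c. mat_scale a (sym3 1 0 0 0 0 0) + mat_scale b (sym3 0 1 0 0 0 0) + mat_scale c Z)"
    by (rule symmetric_plane_extend2[OF W'(2) W'(3)[of 1 0] W'(3)[of 0 1]]) (auto simp: zero_sym3)
  obtain z1 z2 x m n k where "Z = sym3 z1 z2 x m n k"
    by (rule symmetric_plane_sym3[OF W'(2) Z(1)])
  then have "W' = family (\<lambda>a b c. sym3 (a + c * z1) (b + c * z2) (c * x) (c * m) (c * n) (c * k))"
    using Z(2) by simp
  then show ?thesis using that W'(1,2) by blast
qed

text \<open>
  The case is determined by the block of the third spanning matrix, whose quadratic form is reduced by
  completing squares. A block \<open>e\<^sub>3\<^sup>2\<close>, or a block \<open>e\<^sub>2\<^sup>2\<close> with \<open>x = 0\<close>, would give a second point of rank one.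
\<close>

lemma planes_with_O6:
  fixes W :: "'a::{field,finite} mat3 set"
  assumes two: "(2::'a) \<noteq> 0" and "symmetric_plane W" "has_line p O6 W" and no: "\<not> has_line p O5 W"
  shows "congruent W surface_tangent_plane \<or> congruent W line_pair_plane \<or>
    (\<exists>n. n \<noteq> 0 \<and> congruent W (binary_plane n)) \<or> congruent W osculating_plane"
proof -
  obtain z1 z2 x m n k where W:
    "congruent W (family (\<lambda>a b c. sym3 (a + c * z1) (b + c * z2) (c * x) (c * m) (c * n) (c * k)))"
    "symmetric_plane (family (\<lambda>a b c. sym3 (a + c * z1) (b + c * z2) (c * x) (c * m) (c * n) (c * k)))"
    by (rule plane_through_O6[OF assms(2,3)]) (rule that)
  let ?W' = "family (\<lambda>a b c. sym3 (a + c * z1) (b + c * z2) (c * x) (c * m) (c * n) (c * k))"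
  note fam = congruent_trans[OF W(1) family_congruent[OF W(2)]]
  have unique: "v = 0 \<and> w = 0" if "veronese u v w \<in> ?W'" for u v w
  proof -
    have "\<not> has_line p O5 ?W'" using no has_line_congruent W(1) by blast
    moreover have "mats.subspace ?W'" using W(2) by (simp add: symmetric_plane_def)
    moreover have "sym3 1 0 0 0 0 0 \<in> ?W'"
      unfolding family_def by (rule CollectI, rule exI[of _ 1], rule exI[of _ 0], rule exI[of _ 0]) simp
    ultimately show ?thesis using unique_rank_one_point that by blast
  qed
  consider "k \<noteq> 0" | "k = 0" "n \<noteq> 0" | "k = 0" "n = 0" "m \<noteq> 0" | "k = 0" "n = 0" "m = 0"
    by blast
  then show ?thesis
  proof cases
    case 1
    define d where "d = (m - n * n / k) / k"
    have m: "m = k * d + n * n / k" using 1 by (simp add: d_def)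
    have "congruent W (binary_plane d)"
    proof (rule fam[of "mat_rows [1,0,x/k] [0,1,n/k] [0,0,1]"])
      show "\<exists>a' b' c'. sym3 (a + c * z1) (b + c * z2) (c * x) (c * m) (c * n) (c * k) =
        transform (mat_rows [1,0,x/k] [0,1,n/k] [0,0,1]) (sym3 a' b' 0 (d * c') 0 c')" for a b c
        by (rule exI[of _ "a + c * z1 - c * x * x / k"], rule exI[of _ "b + c * z2 - c * x * n / k"],
            rule exI[of _ "c * k"]) (use 1 in \<open>simp add: m field_simps\<close>)
    qed simp
    moreover have "d \<noteq> 0"
    proof
      assume d: "d = 0"
      have "veronese (x / k) (n / k) 1 \<in> ?W'"
        unfolding family_def veronese_def
        by (rule CollectI, rule exI[of _ "x / k * (x / k) - z1 / k"],
            rule exI[of _ "x / k * (n / k) - z2 / k"], rule exI[of _ "1 / k"])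
          (use 1 in \<open>simp add: m d field_simps\<close>)
      then show False using unique by fastforce
    qed
    ultimately show ?thesis by blast
  next
    case 2
    let ?B = "mat_rows [1, x, m * x / (2 * n * n)] [0, n, m / (2 * n)] [0, 0, 1]"
    have "congruent W line_pair_plane"
    proof (rule fam[of ?B])
      show "\<exists>a' b' c'. sym3 (a + c * z1) (b + c * z2) (c * x) (c * m) (c * n) (c * k) =
        transform ?B (sym3 a' b' 0 0 c' 0)" for a b c
      proof -
        \<comment> \<open>chosen to cancel the multiple of \<open>2 e\<^sub>1 e\<^sub>2\<close> left over from completing to a product\<close>
        define b' where "b' = (b + c * z2 - c * x * m / n) / n"
        show ?thesis
          by (rule exI[of _ "a + c * z1 - 2 * b' * x - c * x * x * m / (n * n)"], rule exI[of _ b'],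
              rule exI[of _ c]) (use 2 two in \<open>simp add: b'_def field_simps\<close>)
      qed
    qed (use 2 in simp)
    then show ?thesis by simp
  next
    case 3
    have "x \<noteq> 0"
    proof
      assume x: "x = 0"
      have "veronese 0 1 0 \<in> ?W'"
        unfolding family_def veronese_def
        by (rule CollectI, rule exI[of _ "- z1 / m"], rule exI[of _ "- z2 / m"], rule exI[of _ "1 / m"])
          (use 3 x in simp)
      then show False using unique by fastforce
    qed
    have "congruent W osculating_plane"
    proof (rule fam[of "mat_rows [1,0,0] [0,1,0] [0,0,x/m]"])
      show "\<exists>a' b' c'. sym3 (a + c * z1) (b + c * z2) (c * x) (c * m) (c * n) (c * k) =
        transform (mat_rows [1,0,0] [0,1,0] [0,0,x/m]) (sym3 a' b' c' c' 0 0)" for a b c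
        using 3 by auto
    qed (use 3 \<open>x \<noteq> 0\<close> in simp)
    then show ?thesis by simp
  next
    case 4
    have "congruent W surface_tangent_plane"
    proof (rule fam[of "mat_rows [1,0,0] [0,1,0] [0,0,1]"])
      show "\<exists>a' b' c'. sym3 (a + c * z1) (b + c * z2) (c * x) (c * m) (c * n) (c * k) =
        transform (mat_rows [1,0,0] [0,1,0] [0,0,1]) (sym3 a' b' c' 0 0 0)" for a b c
        using 4 by simp
    qed simp
    then show ?thesis by simp
  qed
qed

lemma no_O9:
  assumes "symmetric_plane W" "sym3 1 0 0 0 0 0 \<in> W" "\<not> has_line p O5 W"
    and "\<And>a b c d e f. sym3 a b c d e f \<in> W \<Longrightarrow> e * e = d * f \<Longrightarrow> d = 0 \<and> f = 0"
  shows "\<not> has_line p O9 W"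
proof
  assume l: "has_line p O9 W"
  have "mats.subspace W" using assms(1) by (simp add: symmetric_plane_def)
  then obtain a b c d e f where "sym3 a b c d e f \<in> W" "d \<noteq> 0 \<or> f \<noteq> 0" "e * e = d * f"
    by (rule O9_D[OF _ assms(2,3) l]) (rule that)
  with assms(4) show False by simp
qed

lemma is_square_iff: "is_square (x::'a::field) \<longleftrightarrow> (\<exists>y. x = y * y)"
  by (simp add: is_nth_power_def power2_eq_square)

lemma osculating_plane_O9: "has_line p O9 (osculating_plane :: 'a::field mat3 set)"
proof -
  have "invertible (mat_rows [1,0,0] [0,1,0] [0,0,1 :: 'a])" by simp
  then show ?thesis by (rule has_lineI) (auto simp: family_def)
qed

lemma line_pair_plane_no_O9:
  assumes "symmetric_plane (line_pair_plane :: 'a::field mat3 set)"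
    and "\<not> has_line p O5 (line_pair_plane :: 'a mat3 set)"
  shows "\<not> has_line p O9 (line_pair_plane :: 'a mat3 set)"
  by (rule no_O9[OF assms(1) _ assms(2)]) (auto simp: family_def)

lemma line_pair_plane_lines:
  assumes two: "(2::'a::field) \<noteq> 0"
  shows "has_line p O8_1 (line_pair_plane :: 'a mat3 set)" "has_line p O12 (line_pair_plane :: 'a mat3 set)"
proof -
  have "invertible (mat_rows [1,0,0] [0,1,1] [0,1,-1 :: 'a])" using two by simp
  then show "has_line p O8_1 (line_pair_plane :: 'a mat3 set)"
    by (rule has_lineI) (auto simp: family_def)
  have "invertible (mat_rows [1,0,0] [0,1,0] [0,0,1 :: 'a])" by simp
  then show "has_line p O12 (line_pair_plane :: 'a mat3 set)"
    by (rule has_lineI) (auto simp: family_def)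
qed

lemma surface_tangent_plane_lines:
  fixes p :: "'a::field line_params"
  assumes "symmetric_plane (surface_tangent_plane :: 'a mat3 set)"
    and no: "\<not> has_line p O5 (surface_tangent_plane :: 'a mat3 set)"
    and "eps p \<noteq> 0"
  shows "\<not> has_line p O9 (surface_tangent_plane :: 'a mat3 set)"
    "\<not> has_line p O8_1 (surface_tangent_plane :: 'a mat3 set)"
    "\<not> has_line p O8_2 (surface_tangent_plane :: 'a mat3 set)"
proof -
  let ?W = "surface_tangent_plane :: 'a mat3 set"
  have W: "mats.subspace ?W" "sym3 1 0 0 0 0 0 \<in> ?W"
    using assms by (auto simp: symmetric_plane_def family_def)
  have N: "d = 0" "e = 0" "f = 0" if "sym3 a b c d e f \<in> ?W" for a b c d e f
    using that by (auto simp: family_def)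
  show "\<not> has_line p O9 ?W" by (rule no_O9[OF assms(1) W(2) no]) (intro conjI; erule N)
  show "\<not> has_line p O8_1 ?W"
  proof
    assume "has_line p O8_1 ?W"
    then obtain a b c d e f s where "sym3 a b c d e f \<in> ?W" "s \<noteq> 0" "e * e - d * f = 1 * (s * s)"
      by (rule O8_D[OF W no, of _ 1, rotated]) (rule that, assumption+, simp)
    then show False using N[of a b c d e f] by simp
  qed
  show "\<not> has_line p O8_2 ?W"
  proof
    assume "has_line p O8_2 ?W"
    then obtain a b c d e f s where "sym3 a b c d e f \<in> ?W" "s \<noteq> 0" "e * e - d * f = eps p * (s * s)"
      by (rule O8_D[OF W no, of _ "eps p", rotated]) (rule that, assumption+, simp)
    then show False using N[of a b c d e f] assms(3) by simp
  qed
qed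

text \<open>
  The discriminant \<open>- det\<close> of the block with parameter \<open>c\<close> is \<open>- n c\<^sup>2\<close>.
\<close>

lemma binary_plane_lines:
  fixes p :: "'a::{field,finite} line_params"
  assumes "symmetric_plane (binary_plane n)" and no: "\<not> has_line p O5 (binary_plane n)"
    and "n \<noteq> 0" and eps: "\<not> is_square (eps p)"
  shows "\<not> has_line p O9 (binary_plane n)" "\<not> has_line p O12 (binary_plane n)"
    "has_line p O8_1 (binary_plane n) \<longleftrightarrow> is_square (- n)"
    "has_line p O8_2 (binary_plane n) \<longleftrightarrow> \<not> is_square (- n)"
proof -
  let ?W = "binary_plane n"
  have W: "mats.subspace ?W" "sym3 1 0 0 0 0 0 \<in> ?W"
    using assms by (auto simp: symmetric_plane_def family_def)
  have N: "c = 0 \<and> d = n * f \<and> e = 0" if "sym3 a b c d e f \<in> ?W" for a b c d e f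
    using that by (auto simp: family_def)
  have M: "sym3 0 0 0 n 0 1 \<in> ?W" by (auto simp: family_def)
  have eps0: "eps p \<noteq> 0" using eps by (auto simp: is_square_iff)
  show "\<not> has_line p O9 ?W"
    by (rule no_O9[OF assms(1) W(2) no]) (drule N, use assms(3) in simp)
  show "\<not> has_line p O12 ?W"
    by (rule no_O12_if_axis_splits) (drule N, simp)
  show "has_line p O8_1 ?W \<longleftrightarrow> is_square (- n)"
  proof
    assume "has_line p O8_1 ?W"
    then obtain a b c d e f s where s: "sym3 a b c d e f \<in> ?W" "s \<noteq> 0" "e * e - d * f = 1 * (s * s)"
      by (rule O8_D[OF W no, of _ 1, rotated]) (rule that, assumption+, simp)
    have sq: "- n * (f * f) = s * s" using s(3) N[OF s(1)] by (simp add: mult.assoc)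
    then have "f \<noteq> 0" using s(2) by auto
    then have "- n = (s / f) * (s / f)" using sq by (simp add: field_simps)
    then show "is_square (- n)" unfolding is_square_iff by blast
  next
    assume "is_square (- n)"
    then obtain s where s: "- n = s * s" by (auto simp: is_square_iff)
    show "has_line p O8_1 ?W"
      by (rule O8_I[OF W M assms(3), of 1 s]) (use s assms(3) in auto)
  qed
  show "has_line p O8_2 ?W \<longleftrightarrow> \<not> is_square (- n)"
  proof
    assume "has_line p O8_2 ?W"
    then obtain a b c d e f s where s: "sym3 a b c d e f \<in> ?W" "s \<noteq> 0" "e * e - d * f = eps p * (s * s)"
      by (rule O8_D[OF W no, of _ "eps p", rotated]) (rule that, assumption+, simp)
    have sq: "- n * (f * f) = eps p * (s * s)" using s(3) N[OF s(1)] by (simp add: mult.assoc)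
    show "\<not> is_square (- n)"
    proof
      assume "is_square (- n)"
      then obtain t where "- n = t * t" by (auto simp: is_square_iff)
      then have "eps p = (t * f / s) * (t * f / s)" using sq s(2) by (simp add: field_simps)
      then show False using eps unfolding is_square_iff by blast
    qed
  next
    assume "\<not> is_square (- n)"
    then obtain s where s: "s \<noteq> 0" "- n = eps p * s\<^sup>2" by (rule nonsquare_quotient[OF eps])
    show "has_line p O8_2 ?W"
      by (rule O8_I[OF W M assms(3), of "eps p" s]) (use s eps0 in \<open>auto simp: power2_eq_square\<close>)
  qed
qed

lemma binary_plane_rescale:
  fixes n :: "'a::{field,finite}"
  assumes "symmetric_plane (binary_plane n)" "s \<noteq> 0"
  shows "congruent (binary_plane n) (binary_plane (n * s\<^sup>2))"
proof (rule congruent_familyI[OF assms(1)])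
  show "invertible (mat_rows [1,0,0] [0,s,0] [0,0,1])" using assms(2) by simp
  show "transform (mat_rows [1,0,0] [0,s,0] [0,0,1]) M \<in> binary_plane (n * s\<^sup>2)" if "M \<in> binary_plane n" for M
    using that by (auto simp: family_def power2_eq_square)
qed

text \<open>
  Type \<open>o\<^sub>9\<close> singles out the osculating plane, the types \<open>o\<^sub>8\<^sub>,\<^sub>1\<close> and \<open>o\<^sub>8\<^sub>,\<^sub>2\<close> show the square class of \<open>- n\<close>,
  type \<open>o\<^sub>1\<^sub>2\<close> distinguishes \<open>binary_plane n\<close> for square \<open>- n\<close> from \<open>line_pair_plane\<close>.
\<close>

lemma congruent_if_O6:
  fixes W1 W2 :: "'a::{field,finite} mat3 set"
  assumes two: "(2::'a) \<noteq> 0" and eps: "\<not> is_square (eps p)"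
    and W: "symmetric_plane W1" "symmetric_plane W2"
    and O5: "\<not> has_line p O5 W1" "\<not> has_line p O5 W2"
    and O6: "has_line p O6 W1" "has_line p O6 W2"
    and same: "\<And>t. has_line p t W1 \<longleftrightarrow> has_line p t W2"
  shows "congruent W1 W2"
proof -
  have eps0: "eps p \<noteq> 0" using eps by (auto simp: is_square_iff)
  have cases: "congruent V surface_tangent_plane \<and> \<not> has_line p O9 V \<and> \<not> has_line p O8_1 V \<and> \<not> has_line p O8_2 V \<or>
    congruent V line_pair_plane \<and> \<not> has_line p O9 V \<and> has_line p O8_1 V \<and> has_line p O12 V \<or>
    (\<exists>n. congruent V (binary_plane n) \<and> symmetric_plane (binary_plane n) \<and> n \<noteq> 0 \<and> \<not> has_line p O9 V \<and>
      \<not> has_line p O12 V \<and> (has_line p O8_1 V \<longleftrightarrow> is_square (- n)) \<and> (has_line p O8_2 V \<longleftrightarrow> \<not> is_square (- n))) \<or>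
    congruent V osculating_plane \<and> has_line p O9 V"
    if V: "symmetric_plane V" "\<not> has_line p O5 V" "has_line p O6 V" for V :: "'a mat3 set"
  proof -
    have nf: "symmetric_plane V'" "\<not> has_line p O5 V'" "has_line p t V \<longleftrightarrow> has_line p t V'"
      if "congruent V V'" for V' t
      using that V symmetric_plane_congruent has_line_congruent by blast+
    from planes_with_O6[OF two V(1,3,2)] show ?thesis
    proof (elim disjE exE conjE)
      assume c: "congruent V surface_tangent_plane"
      then show ?thesis using surface_tangent_plane_lines[OF nf(1)[OF c] nf(2)[OF c] eps0] nf(3)[OF c] by simp
    next
      assume c: "congruent V line_pair_plane"
      then show ?thesis
        using line_pair_plane_no_O9[OF nf(1)[OF c] nf(2)[OF c]] line_pair_plane_lines[OF two] nf(3)[OF c]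
        by simp
    next
      fix n assume c: "congruent V (binary_plane n)" and n: "n \<noteq> 0"
      show ?thesis
        using binary_plane_lines[OF nf(1)[OF c] nf(2)[OF c] n eps] nf(1)[OF c] nf(3)[OF c] c n by blast
    next
      assume c: "congruent V osculating_plane"
      then show ?thesis using nf(3)[OF c] by (simp add: osculating_plane_O9)
    qed
  qed
  have binary: "congruent (binary_plane m) (binary_plane n)"
    if h: "symmetric_plane (binary_plane m)" "m \<noteq> 0" "n \<noteq> 0" "is_square (- m) \<longleftrightarrow> is_square (- n)" for m n :: 'a
  proof -
    obtain s where "s \<noteq> 0" "- n = - m * s\<^sup>2"
    proof (cases "is_square (- m)")
      case True
      then obtain s t where "- m = s * s" "- n = t * t" using h(4) by (auto simp: is_square_iff)
      moreover from this have "s \<noteq> 0" "t \<noteq> 0" using h by auto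
      ultimately show ?thesis by (intro that[of "t / s"]) (auto simp: power2_eq_square)
    next
      case False
      moreover from this have "\<not> is_square (- n)" using h(4) by simp
      ultimately show ?thesis by (rule nonsquare_quotient) (rule that)
    qed
    then have "n = m * s\<^sup>2" by simp
    then show ?thesis using binary_plane_rescale[OF h(1) \<open>s \<noteq> 0\<close>] by simp
  qed
  have join: "congruent W1 W2" if "congruent W1 V" "congruent W2 V" for V
    using that congruent_sym congruent_trans by blast
  note V1 = cases[OF W(1) O5(1) O6(1)] and V2 = cases[OF W(2) O5(2) O6(2), folded same]
  consider "has_line p O9 W1" | "\<not> has_line p O9 W1" "has_line p O8_1 W1" "has_line p O12 W1"
    | "\<not> has_line p O9 W1" "\<not> has_line p O8_1 W1" "\<not> has_line p O8_2 W1"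
    | "\<not> has_line p O9 W1" "\<not> (has_line p O8_1 W1 \<and> has_line p O12 W1)"
      "has_line p O8_1 W1 \<or> has_line p O8_2 W1"
    by blast
  then show ?thesis
  proof cases
    case 1
    with V1 V2 have "congruent W1 osculating_plane" "congruent W2 osculating_plane" by auto
    then show ?thesis by (rule join)
  next
    case 2
    with V1 V2 have "congruent W1 line_pair_plane" "congruent W2 line_pair_plane" by auto
    then show ?thesis by (rule join)
  next
    case 3
    with V1 V2 have "congruent W1 surface_tangent_plane" "congruent W2 surface_tangent_plane" by auto
    then show ?thesis by (rule join)
  next
    case 4
    from 4 V1 obtain m where m: "congruent W1 (binary_plane m)" "symmetric_plane (binary_plane m)" "m \<noteq> 0"
      "has_line p O8_1 W1 \<longleftrightarrow> is_square (- m)" by auto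
    from 4 V2 obtain n where n: "congruent W2 (binary_plane n)" "n \<noteq> 0"
      "has_line p O8_1 W1 \<longleftrightarrow> is_square (- n)" by auto
    have "congruent (binary_plane m) (binary_plane n)"
      using m(2,3) n(2) by (rule binary) (simp flip: m(4) n(3))
    with m(1) have "congruent W1 (binary_plane n)" by (rule congruent_trans)
    with n(1) show ?thesis by (intro join)
  qed
qed

section \<open>Scalar multiples of cubes in a quadratic algebra\<close>

text \<open>
  A pair \<open>(x, y)\<close> stands for \<open>x + y\<surd>d\<close> in the quadratic algebra \<open>F[\<surd>d]\<close>, which is a field, a
  product of two fields or the dual numbers, depending on \<open>d\<close>. Pairs allow a uniform treatment.
\<close>

definition qnorm :: "'a::field \<Rightarrow> 'a \<times> 'a \<Rightarrow> 'a" where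
  "qnorm d z = (fst z)\<^sup>2 - d * (snd z)\<^sup>2"

definition qmul :: "'a::field \<Rightarrow> 'a \<times> 'a \<Rightarrow> 'a \<times> 'a \<Rightarrow> 'a \<times> 'a" where
  "qmul d z w = (fst z * fst w + d * snd z * snd w, fst z * snd w + snd z * fst w)"

definition qscale :: "'a::field \<Rightarrow> 'a \<times> 'a \<Rightarrow> 'a \<times> 'a" where
  "qscale k z = (k * fst z, k * snd z)"

definition qcube :: "'a::field \<Rightarrow> 'a \<times> 'a \<Rightarrow> 'a \<times> 'a" where
  "qcube d z = qmul d z (qmul d z z)"

definition qconj :: "'a::field \<times> 'a \<Rightarrow> 'a \<times> 'a" where
  "qconj z = (fst z, - snd z)"

text \<open>
  Cosets of the group of scalar multiples of cubes of units. Planes with parameters in one coset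
  turn out to be congruent.
\<close>

definition cube_class :: "'a::field \<Rightarrow> 'a \<times> 'a \<Rightarrow> 'a \<times> 'a \<Rightarrow> bool" where
  "cube_class d z w \<longleftrightarrow> (\<exists>k h. k \<noteq> 0 \<and> qnorm d h \<noteq> 0 \<and> w = qscale k (qmul d (qcube d h) z))"

lemmas q_defs = qnorm_def qmul_def qscale_def qcube_def qconj_def

lemma qmul_assoc: "qmul d (qmul d x y) z = qmul d x (qmul d y z)"
  by (simp add: qmul_def algebra_simps)

lemma qmul_commute: "qmul d x y = qmul d y x"
  by (simp add: qmul_def algebra_simps)

lemma qnorm_mult: "qnorm d (qmul d x y) = qnorm d x * qnorm d y"
  by (simp add: q_defs) algebra

lemma qnorm_conj: "qnorm d (qconj z) = qnorm d z"
  by (simp add: q_defs)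

lemma qnorm_scale: "qnorm d (qscale k z) = k\<^sup>2 * qnorm d z"
  by (simp add: q_defs) algebra

lemma qmul_conj: "qmul d z (qconj z) = (qnorm d z, 0)"
  by (simp add: q_defs power2_eq_square)

lemma qmul_scalar: "qmul d (k, 0) z = qscale k z"
  by (simp add: q_defs)

lemma qmul_scale: "qmul d (qscale k z) w = qscale k (qmul d z w)" "qmul d z (qscale k w) = qscale k (qmul d z w)"
  by (simp_all add: q_defs algebra_simps)

lemma qscale_scale: "qscale k (qscale l z) = qscale (k * l) z"
  by (simp add: q_defs mult.assoc)

lemma qscale_inverse: "k \<noteq> 0 \<Longrightarrow> qscale (inverse k) (qscale k z) = z"
  by (cases z) (simp add: qscale_def)

lemma qcube_mult: "qcube d (qmul d x y) = qmul d (qcube d x) (qcube d y)"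
  by (simp add: q_defs) (intro conjI; algebra)

lemma cube_class_trans: "cube_class d x y \<Longrightarrow> cube_class d y z \<Longrightarrow> cube_class d x z"
proof -
  assume "cube_class d x y" "cube_class d y z"
  then obtain k h l g where "k \<noteq> 0" "qnorm d h \<noteq> 0" "y = qscale k (qmul d (qcube d h) x)"
    "l \<noteq> 0" "qnorm d g \<noteq> 0" "z = qscale l (qmul d (qcube d g) y)"
    by (auto simp: cube_class_def)
  then show ?thesis
    unfolding cube_class_def
    by (intro exI[of _ "l * k"] exI[of _ "qmul d g h"])
      (simp add: qnorm_mult qcube_mult qmul_scale qscale_scale qmul_assoc)
qed

lemma cube_class_sym: "cube_class d x y \<Longrightarrow> cube_class d y x"
proof -
  assume "cube_class d x y"
  then obtain k h where k: "k \<noteq> 0" "qnorm d h \<noteq> 0" "y = qscale k (qmul d (qcube d h) x)"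
    by (auto simp: cube_class_def)
  define n where "n = qnorm d h"
  have "qmul d (qcube d (qconj h)) y = qscale (k * n ^ 3) x"
  proof -
    have "qmul d (qcube d (qconj h)) (qcube d h) = (n ^ 3, 0)"
      unfolding n_def by (simp add: q_defs) (intro conjI; algebra)
    then show ?thesis by (simp add: k(3) qmul_scale qmul_scalar qscale_scale flip: qmul_assoc)
  qed
  then have "x = qscale (inverse (k * n ^ 3)) (qmul d (qcube d (qconj h)) y)"
    using k qscale_inverse[of "k * n ^ 3"] by (simp add: n_def)
  then show ?thesis
    unfolding cube_class_def using k
    by (intro exI[of _ "inverse (k * n ^ 3)"] exI[of _ "qconj h"]) (simp add: qnorm_conj n_def)
qed

lemma cube_class_mult: "cube_class d x y \<Longrightarrow> cube_class d (qmul d w x) (qmul d w y)"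
proof -
  assume "cube_class d x y"
  then obtain k h where k: "k \<noteq> 0" "qnorm d h \<noteq> 0" "y = qscale k (qmul d (qcube d h) x)"
    by (auto simp: cube_class_def)
  then show ?thesis
    unfolding cube_class_def
    by (intro exI[of _ k] exI[of _ h]) (simp add: qmul_scale, metis qmul_assoc qmul_commute)
qed

text \<open>
  The irrational part of \<open>(x + y\<surd>d)\<^sup>3\<close> is \<open>y (3 x\<^sup>2 + d y\<^sup>2)\<close>, so for each \<open>y \<noteq> 0\<close> at most two \<open>x\<close> are
  possible. For \<open>d = 0\<close> in characteristic three there is no condition on \<open>y\<close>.
\<close>

lemma card_cube_scalar:
  fixes d :: "'a::{field,finite}"
  assumes "d \<noteq> 0"
  shows "card {h. qnorm d h \<noteq> 0 \<and> snd (qcube d h) = 0} \<le> 3 * card (- {0::'a})"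
proof -
  let ?S = "{h. qnorm d h \<noteq> 0 \<and> snd (qcube d h) = 0}"
  have "?S \<subseteq> (\<lambda>x. (x, 0)) ` (- {0}) \<union> (\<Union>y\<in>- {0}. (\<lambda>x. (x, y)) ` {x. 3 * x\<^sup>2 = - (d * y\<^sup>2)})"
  proof
    fix h assume h: "h \<in> ?S"
    obtain x y where xy: "h = (x, y)" by (cases h)
    have "y * (3 * x\<^sup>2 + d * y\<^sup>2) = 0"
      using h by (simp add: xy q_defs) algebra
    then consider "y = 0" | "y \<noteq> 0" "3 * x\<^sup>2 = - (d * y\<^sup>2)"
      by (auto simp: eq_neg_iff_add_eq_0)
    then show "h \<in> (\<lambda>x. (x, 0)) ` (- {0}) \<union> (\<Union>y\<in>- {0}. (\<lambda>x. (x, y)) ` {x. 3 * x\<^sup>2 = - (d * y\<^sup>2)})"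
      using h by cases (auto simp: xy qnorm_def)
  qed
  moreover have "card {x. 3 * x\<^sup>2 = - (d * y\<^sup>2)} \<le> 2" if y: "y \<noteq> 0" for y
  proof (cases "\<exists>x. 3 * x\<^sup>2 = - (d * y\<^sup>2)")
    case True
    then obtain x where x: "3 * x\<^sup>2 = - (d * y\<^sup>2)" by blast
    then have "(3::'a) \<noteq> 0" using y assms by auto
    then have "{x. 3 * x\<^sup>2 = - (d * y\<^sup>2)} \<subseteq> {x, - x}"
      by (auto simp: power2_eq_iff simp flip: x)
    then have "card {x. 3 * x\<^sup>2 = - (d * y\<^sup>2)} \<le> card {x, - x}" by (intro card_mono) auto
    also have "\<dots> \<le> 2" by (simp add: card_insert_if)
    finally show ?thesis .
  qed simp
  then have "card (\<Union>y\<in>- {0}. (\<lambda>x. (x, y)) ` {x. 3 * x\<^sup>2 = - (d * y\<^sup>2)}) \<le> (\<Sum>y\<in>- {0::'a}. 2)"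
    by (intro order_trans[OF card_UN_le] sum_mono order_trans[OF card_image_le]) auto
  moreover have "card ((\<lambda>x. (x, 0::'a)) ` (- {0::'a})) \<le> card (- {0::'a})"
    by (rule card_image_le) simp
  ultimately show ?thesis
    using card_mono[of "(\<lambda>x. (x, 0)) ` (- {0}) \<union> (\<Union>y\<in>- {0}. (\<lambda>x. (x, y)) ` {x. 3 * x\<^sup>2 = - (d * y\<^sup>2)})" ?S]
      card_Un_le[of "(\<lambda>x. (x, 0::'a)) ` (- {0::'a})" "\<Union>y\<in>- {0}. (\<lambda>x. (x, y)) ` {x. 3 * x\<^sup>2 = - (d * y\<^sup>2)}"]
    by simp
qed

lemma qmul_cancel:
  assumes "qnorm d z \<noteq> 0" "qmul d z x = qmul d z y"
  shows "x = y"
proof -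
  have *: "qmul d (qconj z) (qmul d z u) = qscale (qnorm d z) u" for u
  proof -
    have "qmul d (qconj z) (qmul d z u) = qmul d (qmul d z (qconj z)) u"
      by (simp only: qmul_assoc qmul_commute[of d z "qconj z"])
    then show ?thesis by (simp add: qmul_conj qmul_scalar)
  qed
  have "qscale (qnorm d z) x = qscale (qnorm d z) y" using assms(2) by (simp flip: *)
  then have "qscale (inverse (qnorm d z)) (qscale (qnorm d z) x) =
    qscale (inverse (qnorm d z)) (qscale (qnorm d z) y)" by simp
  then show ?thesis by (simp only: qscale_inverse[OF assms(1)])
qed

text \<open>
  Consider the homomorphism that sends a nonzero scalar \<open>k\<close> and a unit \<open>h\<close> to \<open>k h\<^sup>3\<close>. Its kernel
  projects bijectively onto the set of \<open>card_cube_scalar\<close>, so its fibres are at most three times as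
  large as the set of nonzero scalars.
\<close>

lemma card_units_le:
  fixes d :: "'a::{field,finite}"
  assumes "d \<noteq> 0"
  shows "card {z. qnorm d z \<noteq> 0} \<le> 3 * card {w. cube_class d (1, 0) w}"
proof -
  let ?U = "{z. qnorm d z \<noteq> 0}" and ?H = "{w. cube_class d (1, 0) w}"
  define F where "F w = {(k, h). k \<noteq> 0 \<and> qnorm d h \<noteq> 0 \<and> qscale k (qcube d h) = w}" for w
  have one: "qmul d z (1, 0) = z" for z by (simp add: qmul_def)
  have "card (F w) \<le> 3 * card (- {0::'a})" if w: "w \<in> ?H" for w
  proof -
    obtain k0 h0 where 0: "k0 \<noteq> 0" "qnorm d h0 \<noteq> 0" "w = qscale k0 (qcube d h0)"
      using w by (auto simp: cube_class_def one)
    \<comment> \<open>dividing by \<open>h0\<close> moves the fibre into the set of \<open>h\<close> whose cube is a scalar\<close>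
    let ?g = "\<lambda>kh. qmul d (qconj h0) (snd kh)"
    have "inj_on ?g (F w)"
    proof (rule inj_onI)
      fix s t assume st: "s \<in> F w" "t \<in> F w" "?g s = ?g t"
      obtain k h l g where kh: "s = (k, h)" "t = (l, g)" by (cases s; cases t)
      have "h = g" using st(3) qmul_cancel[of d "qconj h0"] 0(2) by (simp add: kh qnorm_conj)
      moreover have "qnorm d (qcube d h) \<noteq> 0" using st(1) by (simp add: F_def kh qcube_def qnorm_mult)
      then have "qcube d h \<noteq> (0, 0)" by (auto simp: qnorm_def)
      then have "k = l" using st(1,2) \<open>h = g\<close>
        by (cases "qcube d h") (auto simp: F_def kh qscale_def)
      ultimately show "s = t" by (simp add: kh)
    qed
    moreover have "?g ` F w \<subseteq> {h. qnorm d h \<noteq> 0 \<and> snd (qcube d h) = 0}"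
    proof clarsimp
      fix k h assume kh: "(k, h) \<in> F w"
      have "qscale k (qcube d h) = qscale k0 (qcube d h0)" "k \<noteq> 0"
        using kh 0(3) by (auto simp: F_def)
      then have "qscale (inverse k) (qscale k (qcube d h)) = qscale (inverse k) (qscale k0 (qcube d h0))"
        by simp
      then have "qcube d h = qscale (inverse k * k0) (qcube d h0)"
        unfolding qscale_inverse[OF \<open>k \<noteq> 0\<close>] by (simp only: qscale_scale)
      then have "qcube d (qmul d (qconj h0) h) =
        qscale (inverse k * k0) (qmul d (qcube d (qconj h0)) (qcube d h0))"
        by (simp add: qcube_mult qmul_scale)
      moreover have "qmul d (qcube d (qconj h0)) (qcube d h0) = qcube d (qnorm d h0, 0)"
        by (simp only: qcube_mult[symmetric] qmul_commute[of d "qconj h0"] qmul_conj)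
      ultimately have "snd (qcube d (qmul d (qconj h0) h)) = 0"
        by (simp add: qcube_def qmul_def qscale_def)
      then show "qnorm d (qmul d (qconj h0) h) \<noteq> 0 \<and> snd (qcube d (qmul d (qconj h0) h)) = 0"
        using kh 0(2) by (simp add: qnorm_mult qnorm_conj F_def)
    qed
    ultimately have "card (F w) \<le> card {h. qnorm d h \<noteq> 0 \<and> snd (qcube d h) = 0}"
      by (rule card_inj_on_le) simp
    with card_cube_scalar[OF assms] show ?thesis by linarith
  qed
  then have "card (\<Union>w\<in>?H. F w) \<le> (\<Sum>w\<in>?H. 3 * card (- {0::'a}))"
    by (intro order_trans[OF card_UN_le] sum_mono) auto
  moreover have "(\<Union>w\<in>?H. F w) = (- {0}) \<times> ?U"
    by (auto simp: F_def cube_class_def one)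
  ultimately have "card (- {0::'a}) * card ?U \<le> card (- {0::'a}) * (3 * card ?H)"
    by (simp add: card_cartesian_product mult.commute mult.left_commute)
  moreover have "card (- {0::'a}) > 0"
  proof -
    have "(1::'a) \<in> - {0}" by simp
    then have "- {0::'a} \<noteq> {}" by blast
    then show ?thesis using card_gt_0_iff finite by blast
  qed
  ultimately show ?thesis by simp
qed

text \<open>
  The units modulo scalar multiples of cubes form a group of order at most three. Because
  \<open>z\<close> times its conjugate is a scalar, the conjugate represents the inverse class.
  If \<open>z\<close> is not trivial then \<open>1\<close>, \<open>z\<close> and \<open>z\<^sup>-\<^sup>1\<close> are different classes, so they are all classes.
\<close>

lemma cube_class_dichotomy:
  fixes d :: "'a::{field,finite}"
  assumes "d \<noteq> 0" and z: "qnorm d z \<noteq> 0" and w: "qnorm d w \<noteq> 0"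
    and nz: "\<not> cube_class d (1, 0) z" and nw: "\<not> cube_class d (1, 0) w"
  shows "cube_class d z w \<or> cube_class d (qconj z) w"
proof -
  let ?H = "\<lambda>x. {y. cube_class d x y}"
  have one: "qmul d x (1, 0) = x" for x by (simp add: qmul_def)
  have conj: "qmul d z (qconj z) = (qnorm d z, 0)" by (rule qmul_conj)
  have scalar: "cube_class d (1, 0) (qnorm d z, 0)"
    unfolding cube_class_def using z
    by (intro exI[of _ "qnorm d z"] exI[of _ "(1, 0)"]) (simp add: q_defs)
  have cube: "cube_class d (1, 0) (qcube d z)"
    unfolding cube_class_def using z by (intro exI[of _ 1] exI[of _ z]) (simp add: one qscale_def)
  have nconj: "\<not> cube_class d (1, 0) (qconj z)"
  proof
    assume "cube_class d (1, 0) (qconj z)"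
    then have "cube_class d z (qnorm d z, 0)"
      using cube_class_mult[of d "(1, 0)" "qconj z" z] by (simp add: one conj)
    then show False using scalar nz cube_class_sym cube_class_trans by blast
  qed
  have nzz: "\<not> cube_class d z (qconj z)"
  proof
    assume "cube_class d z (qconj z)"
    then have "cube_class d (qmul d z z) (qnorm d z, 0)"
      using cube_class_mult[of d z "qconj z" z] by (simp add: conj)
    then have "cube_class d (1, 0) (qmul d z z)" using scalar cube_class_sym cube_class_trans by blast
    then have "cube_class d z (qcube d z)"
      using cube_class_mult[of d "(1, 0)" "qmul d z z" z] by (simp add: one qcube_def)
    then show False using cube nz cube_class_sym cube_class_trans by blast
  qed
  have disj: "?H x \<inter> ?H y = {}" if "\<not> cube_class d x y" for x y
    using that cube_class_sym cube_class_trans by blast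
  have card: "card (?H (1, 0)) \<le> card (?H x)" if x: "qnorm d x \<noteq> 0" for x
  proof (rule card_inj_on_le[of "qmul d x"])
    show "inj_on (qmul d x) (?H (1, 0))" using qmul_cancel[OF x] by (auto simp: inj_on_def)
    show "qmul d x ` ?H (1, 0) \<subseteq> ?H x" using cube_class_mult[of d "(1, 0)" _ x] by (auto simp: one)
  qed simp
  have units: "?H x \<subseteq> {y. qnorm d y \<noteq> 0}" if "qnorm d x \<noteq> 0" for x
    using that by (auto simp: cube_class_def qnorm_scale qnorm_mult qcube_def)
  have 1: "qnorm d (1, 0) \<noteq> 0" and c: "qnorm d (qconj z) \<noteq> 0"
    using z by (simp_all add: qnorm_conj) (simp add: qnorm_def)
  have "card {y. qnorm d y \<noteq> 0} \<le> card (?H (1, 0)) + card (?H z) + card (?H (qconj z))"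
    using card_units_le[OF assms(1)] card[OF z] card[OF c] by linarith
  also have "\<dots> = card (?H (1, 0) \<union> ?H z \<union> ?H (qconj z))"
    using disj[OF nz] disj[OF nconj] disj[OF nzz] by (simp add: card_Un_disjoint Int_Un_distrib2)
  finally have "?H (1, 0) \<union> ?H z \<union> ?H (qconj z) = {y. qnorm d y \<noteq> 0}"
    using units[OF 1] units[OF z] units[OF c] by (intro card_seteq) auto
  then show ?thesis using w nw by blast
qed

section \<open>The pencil of a plane without lines of type $o_6$\<close>

text \<open>
  A surjection between finite sets of the same size is injective.
\<close>

lemma family_inj:
  fixes F :: "'a::{field,finite} \<Rightarrow> _"
  assumes "symmetric_plane (family F)" "F a b c = F a' b' c'"
  shows "a = a' \<and> b = b' \<and> c = c'"
proof -
  let ?f = "\<lambda>(a, b, c). F a b c"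
  have "range ?f = family F" by (auto simp: family_def image_iff) blast
  then have "card (range ?f) = card (UNIV :: ('a \<times> 'a \<times> 'a) set)"
    using assms(1) by (simp add: symmetric_plane_def power3_eq_cube)
  then have "inj ?f" by (rule eq_card_imp_inj_on[rotated]) simp
  then show ?thesis using injD[of ?f "(a, b, c)" "(a', b', c')"] assms(2) by simp
qed

text \<open>
  The blocks of these matrices form the pencil of the matrices with rows \<open>(y, z)\<close> and \<open>(z, d y)\<close>,
  which multiplication by an exchange matrix turns into the regular representation of \<open>F[\<surd>d]\<close>. In
  the same vein, \<open>w = (b, a)\<close> stands for \<open>b + a\<surd>d\<close>.
\<close>

abbreviation pencil_plane :: "'a::field \<Rightarrow> 'a \<times> 'a \<Rightarrow> 'a mat3 set" where
  "pencil_plane d w \<equiv> family (\<lambda>x y z. sym3 x (snd w * y) (fst w * y) y z (d * y))"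

text \<open>
  Applied before simplification, which would evaluate the projections of \<open>w\<close>.
\<close>

lemma mem_pencil_plane:
  "sym3 x1 x2 x3 x4 x5 x6 \<in> pencil_plane d w \<longleftrightarrow> x2 = snd w * x4 \<and> x3 = fst w * x4 \<and> x6 = d * x4"
  by (auto simp: family_def)

text \<open>
  A pencil of binary quadratic forms is the kernel of a functional on binary forms, itself a nonzero
  binary form with coefficients \<open>q\<^sub>1\<close>, \<open>q\<^sub>2\<close>, \<open>q\<^sub>3\<close> on the dual space. Diagonalising that form turns
  the condition into \<open>f = d\<^sub>0 d\<close>.
\<close>

lemma pencil_diagonalise:
  fixes q1 q2 q3 :: "'a::field"
  assumes two: "(2::'a) \<noteq> 0" and "q1 \<noteq> 0 \<or> q2 \<noteq> 0 \<or> q3 \<noteq> 0"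
  obtains A d0 where "invertible A" "transform A (sym3 1 0 0 0 0 0) = sym3 1 0 0 0 0 0"
    "\<And>a b c d e f. q1 * d + q2 * e + q3 * f = 0 \<Longrightarrow>
      \<exists>a' b' c' d' e'. transform A (sym3 a b c d e f) = sym3 a' b' c' d' e' (d0 * d')"
proof -
  consider "q3 \<noteq> 0" | "q3 = 0" "q1 \<noteq> 0" | "q3 = 0" "q1 = 0" "q2 \<noteq> 0" using assms(2) by blast
  then show ?thesis
  proof cases
    case 1
    define t where "t = q2 / (2 * q3)"
    have t: "q2 = 2 * q3 * t" using 1 two by (simp add: t_def)
    show ?thesis
    proof (rule that[of "mat_rows [1,0,0] [0,1,0] [0,t,1]" "t * t - q1 / q3"])
      fix a b c d e f :: 'a
      assume "q1 * d + q2 * e + q3 * f = 0"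
      then have "q3 * f = - (q1 * d + q2 * e)" by algebra
      then have "f = - (q1 * d + q2 * e) / q3" using 1 by (simp add: field_simps)
      then have f: "f = - (q1 / q3) * d - 2 * t * e" using 1 by (simp add: t field_simps)
      show "\<exists>a' b' c' d' e'. transform (mat_rows [1,0,0] [0,1,0] [0,t,1]) (sym3 a b c d e f) =
        sym3 a' b' c' d' e' ((t * t - q1 / q3) * d')"
        by (simp add: f algebra_simps)
    qed simp_all
  next
    case 2
    define t where "t = q2 / (2 * q1)"
    have t: "q2 = 2 * q1 * t" using 2 two by (simp add: t_def)
    show ?thesis
    proof (rule that[of "mat_rows [1,0,0] [0,0,1] [0,1,t]" "t * t"])
      fix a b c d e f :: 'a
      assume "q1 * d + q2 * e + q3 * f = 0"
      then have "q1 * (d + 2 * t * e) = 0" using 2 t by algebra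
      then have d: "d = - (2 * t * e)" using 2 by (simp add: eq_neg_iff_add_eq_0)
      show "\<exists>a' b' c' d' e'. transform (mat_rows [1,0,0] [0,0,1] [0,1,t]) (sym3 a b c d e f) =
        sym3 a' b' c' d' e' (t * t * d')"
        by (simp add: d algebra_simps)
    qed simp_all
  next
    case 3
    show ?thesis
      by (rule that[of "mat_rows [1,0,0] [0,1,1] [0,1,-1]" 1]) (use 3 two in auto)
  qed
qed

lemma dependent_if_minors_vanish:
  fixes u1 u2 u3 v1 v2 v3 :: "'a::field"
  assumes "u1 * v2 = u2 * v1" "u1 * v3 = u3 * v1" "u2 * v3 = u3 * v2"
  obtains b c where "b \<noteq> 0 \<or> c \<noteq> 0" "b * u1 + c * v1 = 0" "b * u2 + c * v2 = 0" "b * u3 + c * v3 = 0"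
proof -
  consider "u1 \<noteq> 0" | "u2 \<noteq> 0" | "u3 \<noteq> 0" | "u1 = 0" "u2 = 0" "u3 = 0" by blast
  then show ?thesis
  proof cases
    case 1 show ?thesis by (rule that[of v1 "- u1"]) (use 1 assms in \<open>auto simp: mult.commute\<close>)
  next
    case 2 show ?thesis by (rule that[of v2 "- u2"]) (use 2 assms in \<open>auto simp: mult.commute\<close>)
  next
    case 3 show ?thesis by (rule that[of v3 "- u3"]) (use 3 assms in \<open>auto simp: mult.commute\<close>)
  next
    case 4 show ?thesis by (rule that[of 1 0]) (use 4 in auto)
  qed
qed

text \<open>
  A combination with vanishing block is a multiple of \<open>E11\<close>, because there is no line of type \<open>o\<^sub>6\<close>.
\<close>

lemma blocks_independent:
  fixes W :: "'a::{field,finite} mat3 set"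
  assumes W: "symmetric_plane W" "sym3 1 0 0 0 0 0 \<in> W" and no: "\<not> has_line p O6 W"
    and fam: "W = family (\<lambda>a b c. mat_scale a (sym3 1 0 0 0 0 0) +
      mat_scale b (sym3 a1 b1 c1 d1 e1 f1) + mat_scale c (sym3 a2 b2 c2 d2 e2 f2))"
    and 0: "b * d1 + c * d2 = 0" "b * e1 + c * e2 = 0" "b * f1 + c * f2 = 0"
  shows "b = 0" "c = 0"
proof -
  let ?F = "\<lambda>a b c. mat_scale a (sym3 1 0 0 0 0 0) +
      mat_scale b (sym3 a1 b1 c1 d1 e1 f1) + mat_scale c (sym3 a2 b2 c2 d2 e2 f2)"
  have sub: "mats.subspace W" using W(1) by (simp add: symmetric_plane_def)
  have "?F 0 b c \<in> W" by (subst fam) (auto simp only: family_def)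
  then have M: "sym3 (b * a1 + c * a2) (b * b1 + c * b2) (b * c1 + c * c2) 0 0 0 \<in> W"
    using 0 by simp
  have "b * b1 + c * b2 = 0" "b * c1 + c * c2 = 0"
    using O6_I[OF sub W(2) M] no by blast+
  then have "?F 0 b c = ?F (b * a1 + c * a2) 0 0" using 0 by simp
  moreover have "symmetric_plane (family ?F)" using W(1) fam by simp
  ultimately show "b = 0" "c = 0" using family_inj[of ?F 0 b c "b * a1 + c * a2" 0 0] by auto
qed

text \<open>
  Let \<open>Y'\<close> and \<open>Z'\<close> be elements with blocks \<open>(1, 0; 0, d\<^sub>0)\<close> and \<open>(0, 1; 1, 0)\<close>. The first row of an
  element is determined by its block up to \<open>E11\<close>, so it is a combination of the first rows of
  these two. Adding multiples of the first basis vector to the other two removes the first row of \<open>Z'\<close>.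
\<close>

lemma pencil_normal_form:
  fixes W :: "'a::{field,finite} mat3 set"
  assumes W: "symmetric_plane W" "sym3 1 0 0 0 0 0 \<in> W" and no: "\<not> has_line p O6 W"
    and diag: "\<And>M. M \<in> W \<Longrightarrow> \<exists>a b c d e. M = sym3 a b c d e (d0 * d)"
  obtains w where "congruent W (pencil_plane d0 w)"
proof -
  have sub: "mats.subspace W" using W(1) by (simp add: symmetric_plane_def)
  obtain Y Z where YZ: "Y \<in> W" "Z \<in> W"
    and fam: "W = family (\<lambda>a b c. mat_scale a (sym3 1 0 0 0 0 0) + mat_scale b Y + mat_scale c Z)"
    by (rule symmetric_plane_extend1[OF W]) (auto simp: zero_sym3)
  obtain a1 b1 c1 d1 e1 where Y: "Y = sym3 a1 b1 c1 d1 e1 (d0 * d1)" using diag[OF YZ(1)] by blast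
  obtain a2 b2 c2 d2 e2 where Z: "Z = sym3 a2 b2 c2 d2 e2 (d0 * d2)" using diag[OF YZ(2)] by blast
  note indep = blocks_independent[OF W no fam[unfolded Y Z]]
  \<comment> \<open>\<open>Y'\<close> and \<open>Z'\<close> are found by Cramer's rule\<close>
  define k where "k = inverse (d1 * e2 - d2 * e1)"
  have det: "d1 * e2 - d2 * e1 \<noteq> 0"
  proof
    assume "d1 * e2 - d2 * e1 = 0"
    then have e: "d1 * e2 = e1 * d2" by algebra
    moreover have "d1 * (d0 * d2) = d0 * d1 * d2" by algebra
    moreover have "e1 * (d0 * d2) = d0 * d1 * e2" using e by algebra
    ultimately obtain b c where "b \<noteq> 0 \<or> c \<noteq> 0" "b * d1 + c * d2 = 0" "b * e1 + c * e2 = 0"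
        "b * (d0 * d1) + c * (d0 * d2) = 0"
      by (rule dependent_if_minors_vanish) (rule that)
    with indep show False by blast
  qed
  then have k: "k * (d1 * e2 - d2 * e1) = 1" by (simp add: k_def)
  have "mat_scale 0 Y + mat_scale (k * e2) Y + mat_scale (- (k * e1)) Z \<in> W"
    by (rule subspace_combination[OF sub YZ(1,1,2)])
  moreover have "k * e2 * d1 - k * e1 * d2 = 1" using k by algebra
  moreover have "k * e2 * e1 - k * e1 * e2 = 0" by algebra
  moreover have "k * e2 * (d0 * d1) - k * e1 * (d0 * d2) = d0" using k by algebra
  ultimately obtain m1 x1 y1 where Y': "sym3 m1 x1 y1 1 0 d0 \<in> W" by (auto simp: Y Z)
  have "mat_scale 0 Y + mat_scale (- (k * d2)) Y + mat_scale (k * d1) Z \<in> W"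
    by (rule subspace_combination[OF sub YZ(1,1,2)])
  moreover have "k * d1 * d2 - k * d2 * d1 = 0" by algebra
  moreover have "k * d1 * e2 - k * d2 * e1 = 1" using k by algebra
  moreover have "k * d1 * (d0 * d2) - k * d2 * (d0 * d1) = 0" by algebra
  ultimately obtain m2 x2 y2 where Z': "sym3 m2 x2 y2 0 1 0 \<in> W" by (auto simp: Y Z)
  have "congruent W (pencil_plane d0 (y1 - d0 * x2, x1 - y2))"
  proof (rule congruent_familyI[OF W(1)])
    show "invertible (mat_rows [1, - y2, - x2] [0,1,0] [0,0,1])" by simp
    fix M assume "M \<in> W"
    then obtain a b c d e where M: "M = sym3 a b c d e (d0 * d)" using diag by blast
    have "mat_scale 1 M + mat_scale (- d) (sym3 m1 x1 y1 1 0 d0) + mat_scale (- e) (sym3 m2 x2 y2 0 1 0) \<in> W"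
      by (rule subspace_combination[OF sub \<open>M \<in> W\<close> Y' Z'])
    then have N: "sym3 (a - d * m1 - e * m2) (b - d * x1 - e * x2) (c - d * y1 - e * y2) 0 0 0 \<in> W"
      by (simp add: M)
    have "b - d * x1 - e * x2 = 0" "c - d * y1 - e * y2 = 0"
      using O6_I[OF sub W(2) N] no by blast+
    then have "b = d * x1 + e * x2" "c = d * y1 + e * y2" by algebra+
    then show "transform (mat_rows [1, - y2, - x2] [0,1,0] [0,0,1]) M \<in> pencil_plane d0 (y1 - d0 * x2, x1 - y2)"
      unfolding M transform_sym3 mem_pencil_plane by (simp add: algebra_simps)
  qed
  then show ?thesis by (rule that)
qed

text \<open>
  The blocks of \<open>W\<close> form a two-dimensional space. The vector product of two spanning blocks
  gives the functional that defines it.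
\<close>

lemma planes_without_O6:
  fixes W :: "'a::{field,finite} mat3 set"
  assumes two: "(2::'a) \<noteq> 0" and W: "symmetric_plane W" "sym3 1 0 0 0 0 0 \<in> W"
    and no: "\<not> has_line p O6 W"
  obtains d w where "congruent W (pencil_plane d w)"
proof -
  obtain Y Z where YZ: "Y \<in> W" "Z \<in> W"
    and fam: "W = family (\<lambda>a b c. mat_scale a (sym3 1 0 0 0 0 0) + mat_scale b Y + mat_scale c Z)"
    by (rule symmetric_plane_extend1[OF W]) (auto simp: zero_sym3)
  obtain a1 b1 c1 d1 e1 f1 where Y: "Y = sym3 a1 b1 c1 d1 e1 f1"
    by (rule symmetric_plane_sym3[OF W(1) YZ(1)])
  obtain a2 b2 c2 d2 e2 f2 where Z: "Z = sym3 a2 b2 c2 d2 e2 f2"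
    by (rule symmetric_plane_sym3[OF W(1) YZ(2)])
  define q1 q2 q3 where "q1 = e1 * f2 - f1 * e2" "q2 = f1 * d2 - d1 * f2" "q3 = d1 * e2 - e1 * d2"
  note q = this
  have "q1 \<noteq> 0 \<or> q2 \<noteq> 0 \<or> q3 \<noteq> 0"
  proof (rule ccontr)
    assume "\<not> ?thesis"
    then have "d1 * e2 = e1 * d2" "d1 * f2 = f1 * d2" "e1 * f2 = f1 * e2" by (auto simp: q)
    then obtain b c where "b \<noteq> 0 \<or> c \<noteq> 0" "b * d1 + c * d2 = 0" "b * e1 + c * e2 = 0" "b * f1 + c * f2 = 0"
      by (rule dependent_if_minors_vanish) (rule that)
    with blocks_independent[OF W no fam[unfolded Y Z]] show False by blast
  qed
  then obtain A d0 where A: "invertible A" "transform A (sym3 1 0 0 0 0 0) = sym3 1 0 0 0 0 0"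
    "\<And>a b c d e f. q1 * d + q2 * e + q3 * f = 0 \<Longrightarrow>
      \<exists>a' b' c' d' e'. transform A (sym3 a b c d e f) = sym3 a' b' c' d' e' (d0 * d')"
    by (rule pencil_diagonalise[OF two]) (rule that)
  let ?V = "transform A ` W"
  have WV: "congruent W ?V" using A(1) by (auto simp: congruent_def)
  have V: "symmetric_plane ?V" using symmetric_plane_congruent W(1) WV by blast
  have V1: "sym3 1 0 0 0 0 0 \<in> ?V" using W(2) A(2) by (metis imageI)
  have V2: "\<not> has_line p O6 ?V" using has_line_congruent[OF WV] no by blast
  have V3: "\<exists>a b c d e. M' = sym3 a b c d e (d0 * d)" if M': "M' \<in> ?V" for M'
  proof -
    obtain M where M: "M \<in> W" "M' = transform A M" using M' by blast
    then obtain a b c where abc: "M = mat_scale a (sym3 1 0 0 0 0 0) + mat_scale b Y + mat_scale c Z"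
      using fam by (auto simp only: family_def)
    have "q1 * (b * d1 + c * d2) + q2 * (b * e1 + c * e2) + q3 * (b * f1 + c * f2) = 0"
      unfolding q by algebra
    from A(3)[OF this] show ?thesis by (simp add: M(2) abc Y Z)
  qed
  obtain w where "congruent ?V (pencil_plane d0 w)"
    by (rule pencil_normal_form[OF V V1 V2 V3])
  then show ?thesis using congruent_trans[OF WV] that by blast
qed

section \<open>Lines and congruences of the pencil planes\<close>

text \<open>
  The block has determinant \<open>d y\<^sup>2 - z\<^sup>2\<close>.
\<close>

lemma pencil_plane_O9:
  assumes "symmetric_plane (pencil_plane d w)" and no: "\<not> has_line p O5 (pencil_plane d w)"
  shows "has_line p O9 (pencil_plane d w) \<longleftrightarrow> is_square d"
proof -
  let ?W = "pencil_plane d w"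
  have W: "mats.subspace ?W" "sym3 1 0 0 0 0 0 \<in> ?W"
    using assms by (auto simp: symmetric_plane_def family_def)
  show ?thesis
  proof
    assume l: "has_line p O9 ?W"
    obtain a b c y e f where M: "sym3 a b c y e f \<in> ?W" "y \<noteq> 0 \<or> f \<noteq> 0" "e * e = y * f"
      by (rule O9_D[OF W no l]) (rule that)
    then have "f = d * y" "y \<noteq> 0" by (auto simp: family_def)
    with M(3) have "d = (e / y) * (e / y)" by (simp add: field_simps)
    then show "is_square d" unfolding is_square_iff by blast
  next
    assume "is_square d"
    then obtain s where "d = s * s" by (auto simp: is_square_iff)
    then have "sym3 0 (snd w) (fst w) 1 s (s * s) \<in> ?W" by (auto simp: family_def)
    then show "has_line p O9 ?W" by (rule O9_I[OF W no]) auto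
  qed
qed

text \<open>
  For \<open>d = s\<^sup>2\<close> the discriminant of the block is \<open>(z - s y) (z + s y)\<close>, which attains \<open>eps p\<close> if \<open>s \<noteq> 0\<close>
  and only squares if \<open>s = 0\<close>.
\<close>

lemma pencil_plane_O8_2:
  fixes p :: "'a::field line_params"
  assumes "symmetric_plane (pencil_plane d w)" and no: "\<not> has_line p O5 (pencil_plane d w)"
    and two: "(2::'a) \<noteq> 0" and eps: "\<not> is_square (eps p)" and "is_square d"
  shows "has_line p O8_2 (pencil_plane d w) \<longleftrightarrow> d \<noteq> 0"
proof -
  let ?W = "pencil_plane d w"
  have W: "mats.subspace ?W" "sym3 1 0 0 0 0 0 \<in> ?W"
    using assms by (auto simp: symmetric_plane_def family_def)
  have eps': "eps p \<noteq> y * y" for y using eps by (auto simp: is_square_iff)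
  show ?thesis
  proof
    assume "has_line p O8_2 ?W"
    then obtain a b c y e f s where s: "sym3 a b c y e f \<in> ?W" "s \<noteq> 0" "e * e - y * f = eps p * (s * s)"
      by (rule O8_D[OF W no, of _ "eps p", rotated]) (rule that, assumption+, simp)
    show "d \<noteq> 0"
    proof
      assume "d = 0"
      then have "f = 0" using s(1) by (auto simp: family_def)
      then have "eps p = (e / s) * (e / s)" using s(2,3) by (simp add: field_simps)
      then show False using eps' by blast
    qed
  next
    assume "d \<noteq> 0"
    with assms(5) obtain s where s: "d = s * s" "s \<noteq> 0" by (auto simp: is_square_iff)
    define y z where "y = (eps p - 1) / (2 * s)" and "z = (eps p + 1) / 2"
    have y: "eps p - 1 = 2 * s * y" using s two by (simp add: y_def)
    have z: "eps p + 1 = 2 * z" using two by (simp add: z_def)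
    have "sym3 0 (snd w * y) (fst w * y) y z (d * y) \<in> ?W" by (auto simp: family_def)
    moreover have "y \<noteq> 0" using y eps'[of 1] by auto
    moreover have "z * z - y * (d * y) = eps p * (1 * 1)"
    proof -
      have "4 * (z * z - y * (d * y)) = 4 * eps p" using y z s(1) by algebra
      moreover have "(4::'a) \<noteq> 0" using two by (metis mult_eq_0_iff numeral_Bit0 mult_2 numeral_One one_add_one mult_numeral_1)
      ultimately have "z * z - y * (d * y) = eps p" by (metis mult_left_cancel)
      then show ?thesis by simp
    qed
    moreover have "eps p \<noteq> 0" using eps'[of 0] by simp
    ultimately show "has_line p O8_2 ?W"
      by (intro O8_I[OF W, of _ _ _ y z "d * y" "eps p" 1]) auto
  qed
qed

text \<open>
  If \<open>b = a s\<close> and \<open>d = s\<^sup>2\<close>, then the square of the vector \<open>(a, 1, s)\<close> is a second point of rank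
  one.
\<close>

lemma pencil_plane_norm:
  assumes "symmetric_plane (pencil_plane d w)" and no: "\<not> has_line p O5 (pencil_plane d w)"
    and "qnorm d w = 0"
  shows "w = (0, 0)" "\<not> is_square d"
proof -
  let ?W = "pencil_plane d w"
  have W: "mats.subspace ?W" "sym3 1 0 0 0 0 0 \<in> ?W"
    using assms by (auto simp: symmetric_plane_def family_def)
  obtain b a where w: "w = (b, a)" by (cases w)
  have n: "b * b = d * (a * a)" using assms(3) by (simp add: w qnorm_def power2_eq_square)
  have a: "a = 0"
  proof (rule ccontr)
    assume "a \<noteq> 0"
    then have "d = (b / a) * (b / a)" using n by (simp add: field_simps)
    then have "veronese a 1 (b / a) \<in> ?W"
      using \<open>a \<noteq> 0\<close> by (auto simp: family_def veronese_def w)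
    then show False using unique_rank_one_point(1)[OF W no] by fastforce
  qed
  with n show 0: "w = (0, 0)" by (simp add: w)
  show "\<not> is_square d"
  proof
    assume "is_square d"
    then obtain s where "d = s * s" by (auto simp: is_square_iff)
    then have "veronese 0 1 s \<in> ?W" by (auto simp: family_def veronese_def 0)
    then show False using unique_rank_one_point(1)[OF W no] by fastforce
  qed
qed

text \<open>
  With \<open>u = u10 p\<close> and \<open>v = v10 p\<close>, the representative of \<open>o\<^sub>1\<^sub>0\<close> is the pencil of binary forms that vanish under the functional
  \<open>X\<^sup>2/v + u X Y - Y\<^sup>2\<close>, and the condition on \<open>u\<close> and \<open>v\<close> says that this form has no zeros. So its
  discriminant is a non-square, like \<open>d\<close>, and completing the square carries one pencil to the other.
\<close>

lemma pencil_plane_O10: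
  fixes p :: "'a::{field,finite} line_params"
  assumes two: "(2::'a) \<noteq> 0" and star: "cond_star (u10 p) (v10 p)" and d: "\<not> is_square d"
  shows "has_line p O10 (pencil_plane d (0, 0))"
proof -
  define u v where "u = u10 p / 2" and "v = v10 p"
  have u: "u10 p = 2 * u" using two by (simp add: u_def)
  have v: "v \<noteq> 0" "\<And>z. v * z\<^sup>2 + u10 p * v * z - 1 \<noteq> 0"
    using star by (auto simp: cond_star_def v_def)
  define i where "i = inverse v"
  have i: "i * v = 1" using v by (simp add: i_def)
  have "\<not> is_square (u * u + i)"
  proof
    assume "is_square (u * u + i)"
    then obtain t where "u * u + i = t * t" by (auto simp: is_square_iff)
    \<comment> \<open>a square would give the root \<open>t - u\<close> of the polynomial in \<open>cond_star\<close>\<close>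
    then have "v * (t - u)\<^sup>2 + u10 p * v * (t - u) - 1 = 0" using i u by algebra
    then show False using v(2) by blast
  qed
  with d obtain s where s: "s \<noteq> 0" "u * u + i = d * s\<^sup>2" by (rule nonsquare_quotient)
  have eq: "v * a * u * u + (a + u10 p * b) - 2 * b * u = d * (v * a * s * s)" for a b
    using s(2) i u by algebra
  show ?thesis
  proof (rule has_lineI)
    show "invertible (mat_rows [0,0,1] [s,0,0] [-u,1,0])" using s(1) by simp
    show "transform (mat_rows [0,0,1] [s,0,0] [-u,1,0]) (line_point p O10 a b) \<in> pencil_plane d (0, 0)" for a b
      unfolding line_point_sym3 transform_sym3 mem_pencil_plane
      using eq[of a b] by (simp add: v_def algebra_simps)
  qed
qed

text \<open>
  In the plane, \<open>x = 0\<close> defines the line of the matrices \<open>y (2 e\<^sub>1 e\<^sub>3 + e\<^sub>2\<^sup>2 + d e\<^sub>3\<^sup>2) + 2 z e\<^sub>2 e\<^sub>3\<close>.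
  The substitution of \<open>e\<^sub>1 + (d/2) e\<^sub>3\<close> for \<open>e\<^sub>1\<close> absorbs the square of \<open>e\<^sub>3\<close>.
\<close>

lemma pencil_plane_O16:
  fixes d :: "'a::field"
  assumes two: "(2::'a) \<noteq> 0"
  shows "has_line p O16 (pencil_plane d (1, 0))"
  using two by (intro has_lineI[of "mat_rows [1,0,0] [0,1,0] [d/2,0,1]"]) (auto simp: family_def)

lemma pencil_plane_scale:
  fixes d :: "'a::{field,finite}"
  assumes "symmetric_plane (pencil_plane d w)" "k \<noteq> 0"
  shows "congruent (pencil_plane d w) (pencil_plane d (qscale k w))"
proof (rule congruent_familyI[OF assms(1)])
  show "invertible (mat_rows [k,0,0] [0,1,0] [0,0,1])" using assms(2) by simp
  show "transform (mat_rows [k,0,0] [0,1,0] [0,0,1]) M \<in> pencil_plane d (qscale k w)"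
    if "M \<in> pencil_plane d w" for M
    using that by (auto simp: family_def qscale_def)
qed

lemma pencil_plane_conj:
  fixes d :: "'a::{field,finite}"
  assumes "symmetric_plane (pencil_plane d w)"
  shows "congruent (pencil_plane d w) (pencil_plane d (qconj w))"
proof (rule congruent_familyI[OF assms(1)])
  show "invertible (mat_rows [1,0,0] [0,-1,0] [0,0,1::'a])" by simp
  show "transform (mat_rows [1,0,0] [0,-1,0] [0,0,1]) M \<in> pencil_plane d (qconj w)"
    if "M \<in> pencil_plane d w" for M
    using that by (auto simp: family_def qconj_def)
qed

lemma pencil_plane_rescale:
  fixes d :: "'a::{field,finite}"
  assumes "symmetric_plane (pencil_plane d (b, a))" "s \<noteq> 0"
  shows "congruent (pencil_plane d (b, a)) (pencil_plane (d * s\<^sup>2) (b * s, a))"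
proof (rule congruent_familyI[OF assms(1)])
  show "invertible (mat_rows [1,0,0] [0,1,0] [0,0,s])" using assms(2) by simp
  show "transform (mat_rows [1,0,0] [0,1,0] [0,0,s]) M \<in> pencil_plane (d * s\<^sup>2) (b * s, a)"
    if "M \<in> pencil_plane d (b, a)" for M
    using that by (auto simp: family_def power2_eq_square)
qed

text \<open>
  Multiplication by \<open>h\<close> on \<open>F[\<surd>d]\<close> preserves the pencil and multiplies its elements by \<open>h\<^sup>2\<close>. The vector in
  the first row is multiplied by \<open>h\<close>. To become a multiple of \<open>y\<close> again it has to be corrected by a shear
  with the parameters \<open>t\<^sub>1\<close>, \<open>t\<^sub>2\<close>, and solving for these gives the new value \<open>h w / h'\<^sup>2\<close>,
  where \<open>h'\<close> is the conjugate of \<open>h\<close>. This is \<open>h\<^sup>3 w\<close> divided by the square of the norm.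
\<close>

lemma pencil_plane_cube:
  fixes d :: "'a::{field,finite}"
  assumes W: "symmetric_plane (pencil_plane d w)" and h: "qnorm d h \<noteq> 0"
  shows "congruent (pencil_plane d w) (pencil_plane d (qscale (inverse ((qnorm d h)\<^sup>2)) (qmul d (qcube d h) w)))"
proof -
  obtain b a where w: "w = (b, a)" by (cases w)
  obtain u v where uv: "h = (u, v)" by (cases h)
  define n where "n = inverse (qnorm d h)"
  have n: "n * (u * u - d * v * v) = 1"
    using h by (simp add: n_def uv qnorm_def power2_eq_square mult.assoc)
  define b' a' where "b' = n * n * fst (qmul d (qcube d h) w)" and "a' = n * n * snd (qmul d (qcube d h) w)"
  have ba: "qscale (inverse ((qnorm d h)\<^sup>2)) (qmul d (qcube d h) w) = (b', a')"
    by (simp add: qscale_def a'_def b'_def n_def power2_eq_square)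
  \<comment> \<open>\<open>u u + d v v\<close> and \<open>2 u v\<close> are the components of \<open>h\<^sup>2\<close>\<close>
  have b'_eq: "b' = n * n * ((u * (u * u + d * v * v) + d * v * (2 * u * v)) * b +
      d * (u * (2 * u * v) + v * (u * u + d * v * v)) * a)"
    unfolding b'_def by (simp add: w uv q_defs) algebra
  have a'_eq: "a' = n * n * ((u * (u * u + d * v * v) + d * v * (2 * u * v)) * a +
      (u * (2 * u * v) + v * (u * u + d * v * v)) * b)"
    unfolding a'_def by (simp add: w uv q_defs) algebra
  define t1 t2 where "t1 = 2 * u * v * n * (u * b' - d * v * a')" and "t2 = 2 * u * v * n * (u * a' - v * b')"
  note t = this
  let ?A = "mat_rows [1,t1,t2] [0,u,v] [0, d * v, u]"
  show ?thesis
    unfolding ba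
  proof (rule congruent_familyI[OF W])
    show "invertible ?A" using n by (auto simp: algebra_simps)
    fix M assume "M \<in> pencil_plane d w"
    then obtain x y z where M: "M = sym3 x (a * y) (b * y) y z (d * y)"
      by (auto simp: family_def w)
    define y' where "y' = (u * u + d * v * v) * y + 2 * u * v * z"
    have *: "y * t1 * u + d * y * t2 * v + a * y * u + b * y * v + z * (t1 * v + u * t2) = a' * y'"
      unfolding y'_def t a'_eq b'_eq using n by algebra
    have **: "y * t1 * (d * v) + d * y * t2 * u + a * y * (d * v) + b * y * u + z * (t1 * u + d * v * t2) = b' * y'"
      unfolding y'_def t a'_eq b'_eq using n by algebra
    have "transform ?A M = sym3 (x + y * t1 * t1 + d * y * t2 * t2 + 2 * (a * y) * t1 + 2 * (b * y) * t2 + 2 * z * t1 * t2)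
      (a' * y') (b' * y') y' (2 * d * u * v * y + (u * u + d * v * v) * z) (d * y')"
      unfolding M transform_sym3 sym3_eq_iff
    proof (intro conjI, goal_cases)
      case 1 show ?case by algebra
      case 2 show ?case using * by simp
      case 3 show ?case using ** by simp
      case 4 show ?case unfolding y'_def by algebra
      case 5 show ?case by algebra
      case 6 show ?case unfolding y'_def by algebra
    qed
    then show "transform ?A M \<in> pencil_plane d (b', a')"
      by (auto simp: family_def)
  qed
qed

lemma pencil_plane_cube_class:
  fixes d :: "'a::{field,finite}"
  assumes W: "symmetric_plane (pencil_plane d w)" and c: "cube_class d w w'"
  shows "congruent (pencil_plane d w) (pencil_plane d w')"
proof -
  obtain k h where k: "k \<noteq> 0" "qnorm d h \<noteq> 0" "w' = qscale k (qmul d (qcube d h) w)"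
    using c by (auto simp: cube_class_def)
  define m where "m = k * (qnorm d h)\<^sup>2"
  let ?v = "qscale (inverse ((qnorm d h)\<^sup>2)) (qmul d (qcube d h) w)"
  have 1: "congruent (pencil_plane d w) (pencil_plane d ?v)"
    by (rule pencil_plane_cube[OF W k(2)])
  have "congruent (pencil_plane d ?v) (pencil_plane d (qscale m ?v))"
    using symmetric_plane_congruent[OF W 1] k by (intro pencil_plane_scale) (simp_all add: m_def)
  moreover have "qscale m ?v = w'"
    using k(2) by (simp add: qscale_scale m_def k(3) mult.assoc)
  ultimately show ?thesis using congruent_trans[OF 1] by simp
qed

section \<open>Planes spanned by a point and a line of type $o_{10}$ or $o_{16}$\<close>

text \<open>
  The span of the representative of \<open>o\<^sub>1\<^sub>0\<close> and \<open>e\<^sub>3\<^sup>2\<close>.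
\<close>

abbreviation exterior_plane :: "'a::field line_params \<Rightarrow> 'a mat3 set" where
  "exterior_plane p \<equiv> family (\<lambda>a b c. sym3 (v10 p * a) b 0 (a + u10 p * b) 0 c)"

text \<open>
  Like \<open>pull_back_line\<close>, keeping track of a point of rank one.
\<close>

lemma pull_back_line_and_point:
  assumes "symmetric_plane W" "veronese x y z \<in> W" "(x, y, z) \<noteq> (0, 0, 0)"
    and "invertible A" "\<And>a b. transform A (X a b) \<in> W"
  obtains W' x' y' z' where "congruent W W'" "symmetric_plane W'" "\<And>a b. X a b \<in> W'"
    "veronese x' y' z' \<in> W'" "(x', y', z') \<noteq> (0, 0, 0)"
proof -
  obtain B where B: "invertible B" "\<And>M. transform B (transform A M) = M" "\<And>M. transform A (transform B M) = M"
    using transform_inverse[OF assms(4)] by metis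
  obtain p1 q1 r1 p2 q2 r2 p3 q3 r3 where Bm: "B = mat_rows [p1,q1,r1] [p2,q2,r2] [p3,q3,r3]"
    by (rule mat3_cases)
  let ?x = "p1 * x + q1 * y + r1 * z" and ?y = "p2 * x + q2 * y + r2 * z" and ?z = "p3 * x + q3 * y + r3 * z"
  have v: "transform B (veronese x y z) = veronese ?x ?y ?z"
    unfolding Bm veronese_def transform_sym3 sym3_eq_iff by (intro conjI; algebra)
  show ?thesis
  proof (rule that[of "transform B ` W" ?x ?y ?z])
    show "congruent W (transform B ` W)" using B(1) by (auto simp: congruent_def)
    show "symmetric_plane (transform B ` W)" using symmetric_plane_transform assms(1) B(1) by blast
    show "X a b \<in> transform B ` W" for a b
      using assms(5)[of a b] B(2)[of "X a b"] by (metis imageI)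
    show "veronese ?x ?y ?z \<in> transform B ` W"
      using assms(2) v by (metis imageI)
    show "(?x, ?y, ?z) \<noteq> (0, 0, 0)"
    proof
      assume 0: "(?x, ?y, ?z) = (0, 0, 0)"
      have "transform B (veronese x y z) = 0" using 0 unfolding v by (simp add: veronese_def zero_sym3)
      then have "veronese x y z = transform A 0" using B(3) by metis
      also have "\<dots> = 0" by (simp add: transform_def)
      finally show False using assms(3) by (simp add: veronese_def zero_sym3)
    qed
  qed
qed

text \<open>
  The plane is spanned by the matrices \<open>a (2 e\<^sub>1 e\<^sub>3 + e\<^sub>2\<^sup>2) + 2 b e\<^sub>2 e\<^sub>3\<close> and the square of
  \<open>v = (x, y, z)\<close>. If \<open>x \<noteq> 0\<close>, take \<open>v\<close> as the first basis vector. If \<open>x = 0\<close>, there is a line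
  of type \<open>o\<^sub>6\<close> through \<open>e\<^sub>3\<^sup>2\<close> or \<open>e\<^sub>2\<^sup>2\<close>, or the square of \<open>(0, y, -z)\<close> is another point of rank one.
\<close>

lemma planes_with_O16:
  fixes W :: "'a::{field,finite} mat3 set"
  assumes W: "symmetric_plane W" "veronese x y z \<in> W" "(x, y, z) \<noteq> (0, 0, 0)"
    and O5: "\<not> has_line p O5 W" and O6: "\<not> has_line p O6 W" and O16: "has_line p O16 W"
    and two: "(2::'a) \<noteq> 0"
  obtains d where "congruent W (pencil_plane d (1, 0))"
proof -
  obtain A where "invertible A" "\<And>a b. transform A (sym3 0 0 a a b 0) \<in> W"
    using O16 by (auto simp: has_line_def)
  then obtain V x y z where V: "congruent W V" "symmetric_plane V" "\<And>a b. sym3 0 0 a a b 0 \<in> V"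
    "veronese x y z \<in> V" "(x, y, z) \<noteq> (0, 0, 0)"
    by (rule pull_back_line_and_point[OF W]) (rule that)
  have nO5: "\<not> has_line p O5 V" and nO6: "\<not> has_line p O6 V"
    using O5 O6 has_line_congruent[OF V(1)] by blast+
  have sub: "mats.subspace V" using V(2) by (simp add: symmetric_plane_def)
  have span: "sym3 (c * (x * x)) (c * (x * y)) (a + c * (x * z)) (a + c * (y * y)) (b + c * (y * z)) (c * (z * z)) \<in> V" for a b c
  proof -
    have "mat_scale 1 (sym3 0 0 a a b 0) + mat_scale c (veronese x y z) + mat_scale 0 (veronese x y z) \<in> V"
      by (rule subspace_combination[OF sub V(3) V(4) V(4)])
    then show ?thesis by (simp add: veronese_def)
  qed
  have x: "x \<noteq> 0"
  proof
    assume x: "x = 0"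
    show False
    proof (cases "y = 0 \<or> z = 0")
      case True
      have "has_line p O6 V"
      proof (cases "y = 0")
        case True
        then have "z \<noteq> 0" using x V(5) by simp
        show ?thesis
        proof (rule has_lineI)
          show "invertible (mat_rows [0,0,1] [0,1,0] [1,0,0::'a])" by simp
          show "transform (mat_rows [0,0,1] [0,1,0] [1,0,0]) (line_point p O6 a b) \<in> V" for a b
            using span[of "a / (z * z)" 0 b] x True \<open>z \<noteq> 0\<close> by simp
        qed
      next
        case False
        then have "z = 0" using True by simp
        show ?thesis
        proof (rule has_lineI)
          show "invertible (mat_rows [0,0,1] [1,0,0] [0,1,0::'a])" by simp
          show "transform (mat_rows [0,0,1] [1,0,0] [0,1,0]) (line_point p O6 a b) \<in> V" for a b
            using span[of "a / (y * y)" 0 b] x False \<open>z = 0\<close> by simp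
        qed
      qed
      with nO6 show False by blast
    next
      case False
      have "has_line p O5 V"
      proof (rule has_lineI)
        show "invertible (mat_rows [0,0,1] [y,y,0] [z,-z,0])" using False two by auto
        show "transform (mat_rows [0,0,1] [y,y,0] [z,-z,0]) (line_point p O5 a b) \<in> V" for a b
          using span[of "a + b" 0 "- 2 * b * y * z"] x by (simp add: algebra_simps)
      qed
      with nO5 show False by blast
    qed
  qed
  define s t where "s = y / x" and "t = z / x"
  have st: "y = x * s" "z = x * t" using x by (simp_all add: s_def t_def)
  have span': "sym3 c (c * s) (a + c * t) (a + c * s * s) (b + c * s * t) (c * t * t) \<in> V" for a b c
    using span[of "c / (x * x)" a b] x by (simp add: st mult.assoc)
  let ?F = "\<lambda>a b c. mat_scale a (sym3 0 0 1 1 0 0) + mat_scale b (sym3 0 0 0 0 1 0) +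
    mat_scale c (sym3 1 s t (s * s) (s * t) (t * t))"
  have fam: "V = family ?F"
  proof (rule symmetric_plane_eq_family[OF V(2)])
    show "sym3 0 0 1 1 0 0 \<in> V" "sym3 0 0 0 0 1 0 \<in> V" "sym3 1 s t (s * s) (s * t) (t * t) \<in> V"
      using span'[of 0 1 0] span'[of 0 0 1] span'[of 1 0 0] by simp_all
    show "a = 0 \<and> b = 0 \<and> c = 0" if "?F a b c = 0" for a b c
      using that by (auto simp: zero_sym3)
  qed
  have "congruent V (pencil_plane (- 2 * t) (1, 0))"
    unfolding fam
  proof (rule family_congruent)
    show "symmetric_plane (family ?F)" using V(2) fam by simp
    show "invertible (mat_rows [1,0,0] [s,1,0] [t,0,1])" by simp
    show "\<exists>a' b' c'. ?F a b c = transform (mat_rows [1,0,0] [s,1,0] [t,0,1])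
      (sym3 a' (snd (1, 0) * b') (fst (1, 0) * b') b' c' (- 2 * t * b'))" for a b c
      by (rule exI[of _ c], rule exI[of _ a], rule exI[of _ "b - a * s"]) (simp add: algebra_simps)
  qed
  then show ?thesis using congruent_trans[OF V(1)] that by blast
qed

text \<open>
  The line consists of binary forms in \<open>e\<^sub>1\<close>, \<open>e\<^sub>2\<close>. The point of rank one is \<open>v v\<^sup>T\<close> with \<open>v\<close> outside of the
  span of \<open>e\<^sub>1\<close> and \<open>e\<^sub>2\<close>, so \<open>v\<close> can be taken as the third basis vector; otherwise the plane would
  consist of all binary forms and contain \<open>e\<^sub>1\<^sup>2\<close> and \<open>e\<^sub>2\<^sup>2\<close>.
\<close>

lemma planes_with_O10:
  fixes W :: "'a::{field,finite} mat3 set"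
  assumes W: "symmetric_plane W" "veronese x y z \<in> W" "(x, y, z) \<noteq> (0, 0, 0)"
    and O5: "\<not> has_line p O5 W" and O10: "has_line p O10 W" and star: "cond_star (u10 p) (v10 p)"
  shows "congruent W (exterior_plane p)"
proof -
  define u v where "u = u10 p" and "v = v10 p"
  have v: "v \<noteq> 0" "\<And>z. v * z\<^sup>2 + u * v * z - 1 \<noteq> 0"
    using star by (auto simp: cond_star_def u_def v_def)
  obtain A where "invertible A" "\<And>a b. transform A (sym3 (v * a) b 0 (a + u * b) 0 0) \<in> W"
    using O10 by (auto simp: has_line_def u_def v_def)
  then obtain V x y z where V: "congruent W V" "symmetric_plane V" "\<And>a b. sym3 (v * a) b 0 (a + u * b) 0 0 \<in> V"
    "veronese x y z \<in> V" "(x, y, z) \<noteq> (0, 0, 0)"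
    by (rule pull_back_line_and_point[OF W]) (rule that)
  have nO5: "\<not> has_line p O5 V"
    using O5 has_line_congruent[OF V(1)] by blast
  have sub: "mats.subspace V" using V(2) by (simp add: symmetric_plane_def)
  have span: "sym3 (v * a + c * (x * x)) (b + c * (x * y)) (c * (x * z)) (a + u * b + c * (y * y)) (c * (y * z)) (c * (z * z)) \<in> V" for a b c
  proof -
    have "mat_scale 1 (sym3 (v * a) b 0 (a + u * b) 0 0) + mat_scale c (veronese x y z) + mat_scale 0 (veronese x y z) \<in> V"
      by (rule subspace_combination[OF sub V(3) V(4) V(4)])
    then show ?thesis by (simp add: veronese_def)
  qed
  have z: "z \<noteq> 0"
  proof
    assume z: "z = 0"
    \<comment> \<open>the determinant that decides whether \<open>v v\<^sup>T\<close> is independent of the line\<close>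
    define D where "D = x * x - v * (y * y) + u * v * x * y"
    have "D \<noteq> 0"
    proof (cases "x = 0")
      case True
      then show ?thesis using v(1) z V(5) by (simp add: D_def)
    next
      case False
      have "D = - (x * x) * (v * (- y / x)\<^sup>2 + u * v * (- y / x) - 1)"
        using False by (simp add: D_def power2_eq_square field_simps)
      with v(2)[of "- y / x"] False show ?thesis by simp
    qed
    define i where "i = inverse D"
    have i: "i * D = 1" using \<open>D \<noteq> 0\<close> by (simp add: i_def)
    define j where "j = inverse v"
    have j: "j * v = 1" using v by (simp add: j_def)
    have "has_line p O5 V"
    proof (rule has_lineI)
      show "invertible (mat_rows [1,0,0] [0,1,0] [0,0,1::'a])" by simp
      fix a b :: 'a
      define c where "c = i * (a - v * b)"
      define t where "t = - (c * (x * y))"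
      define s where "s = b - u * t - c * (y * y)"
      have "v * s + c * (x * x) = a"
        unfolding s_def t_def c_def using i D_def by algebra
      moreover have "t + c * (x * y) = 0" by (simp add: t_def)
      moreover have "s + u * t + c * (y * y) = b" by (simp add: s_def)
      ultimately have "sym3 a 0 0 b 0 0 \<in> V" using span[of s c t] z by simp
      then show "transform (mat_rows [1,0,0] [0,1,0] [0,0,1]) (line_point p O5 a b) \<in> V" by simp
    qed
    with nO5 show False by blast
  qed
  let ?F = "\<lambda>a b c. mat_scale a (sym3 v 0 0 1 0 0) + mat_scale b (sym3 0 1 0 u 0 0) + mat_scale c (veronese x y z)"
  have fam: "V = family ?F"
  proof (rule symmetric_plane_eq_family[OF V(2)])
    show "sym3 v 0 0 1 0 0 \<in> V" "sym3 0 1 0 u 0 0 \<in> V" "veronese x y z \<in> V"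
      using V(3)[of 1 0] V(3)[of 0 1] V(4) by simp_all
    show "a = 0 \<and> b = 0 \<and> c = 0" if "?F a b c = 0" for a b c
      using that z by (auto simp: zero_sym3 veronese_def)
  qed
  have "congruent V (exterior_plane p)"
    unfolding fam
  proof (rule family_congruent)
    show "symmetric_plane (family ?F)" using V(2) fam by simp
    show "invertible (mat_rows [1,0,x] [0,1,y] [0,0,z])" using z by simp
    show "\<exists>a' b' c'. ?F a b c = transform (mat_rows [1,0,x] [0,1,y] [0,0,z])
      (sym3 (v10 p * a') b' 0 (a' + u10 p * b') 0 c')" for a b c
      by (rule exI[of _ a], rule exI[of _ b], rule exI[of _ c])
        (simp add: veronese_def u_def v_def algebra_simps)
  qed
  then show ?thesis by (rule congruent_trans[OF V(1)])
qed

section \<open>The lines of a plane determine it\<close>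

text \<open>
  For \<open>d = 0\<close> scalars are the units \<open>b + 0\<surd>d\<close>.
\<close>

lemma cube_class_cusp:
  fixes a b :: "'a::field"
  assumes "b \<noteq> 0" "\<not> cube_class 0 (1, 0) (b, a)"
  shows "a \<noteq> 0"
proof
  assume "a = 0"
  then have "cube_class 0 (1, 0) (b, a)"
    unfolding cube_class_def using assms(1)
    by (intro exI[of _ b] exI[of _ "(1, 0)"]) (simp add: q_defs)
  with assms(2) show False by simp
qed

text \<open>
  For \<open>d = 0\<close>, diagonal congruences scale the two components of \<open>z\<close> independently, and both
  components are nonzero.
\<close>

lemma congruent_same_parameter:
  fixes d :: "'a::{field,finite}"
  assumes W: "symmetric_plane (pencil_plane d z)"
    and "qnorm d z \<noteq> 0" "qnorm d w \<noteq> 0" "\<not> cube_class d (1, 0) z" "\<not> cube_class d (1, 0) w"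
  shows "congruent (pencil_plane d z) (pencil_plane d w)"
proof (cases "d = 0")
  case False
  from cube_class_dichotomy[OF False assms(2-5)] show ?thesis
  proof
    assume "cube_class d z w"
    then show ?thesis by (rule pencil_plane_cube_class[OF W])
  next
    assume c: "cube_class d (qconj z) w"
    note conj = pencil_plane_conj[OF W]
    have "congruent (pencil_plane d (qconj z)) (pencil_plane d w)"
      using symmetric_plane_congruent[OF W conj] c by (rule pencil_plane_cube_class)
    with conj show ?thesis by (rule congruent_trans)
  qed
next
  case True
  obtain b a where z: "z = (b, a)" by (cases z)
  obtain b' a' where w: "w = (b', a')" by (cases w)
  have nz: "b \<noteq> 0" "b' \<noteq> 0" using assms(2,3) True by (auto simp: qnorm_def z w)
  then have na: "a \<noteq> 0" "a' \<noteq> 0" using cube_class_cusp assms(4,5) True by (auto simp: z w)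
  define k where "k = a' / a"
  have k: "k \<noteq> 0" using na by (simp add: k_def)
  have 1: "congruent (pencil_plane d z) (pencil_plane d (k * b, k * a))"
    using pencil_plane_scale[OF W k] by (simp add: qscale_def z)
  have "congruent (pencil_plane d (k * b, k * a)) (pencil_plane (d * (b' / (k * b))\<^sup>2) (k * b * (b' / (k * b)), k * a))"
    using symmetric_plane_congruent[OF W 1] k nz by (intro pencil_plane_rescale) simp_all
  moreover have "k * b * (b' / (k * b)) = b'" "k * a = a'" using k nz na by (simp_all add: k_def)
  ultimately have "congruent (pencil_plane d (k * b, k * a)) (pencil_plane d w)"
    by (simp add: True w)
  with 1 show ?thesis by (rule congruent_trans)
qed

text \<open>
  Type \<open>o\<^sub>9\<close> occurs iff \<open>d\<close> is a square, and then \<open>o\<^sub>8\<^sub>,\<^sub>2\<close> occurs iff \<open>d\<close> is not zero.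
\<close>

lemma pencil_parameter:
  fixes W1 W2 :: "'a::{field,finite} mat3 set"
  assumes two: "(2::'a) \<noteq> 0" and eps: "\<not> is_square (eps p)"
    and W: "symmetric_plane W1" "symmetric_plane W2"
    and O5: "\<not> has_line p O5 W1" "\<not> has_line p O5 W2"
    and same: "\<And>t. has_line p t W1 \<longleftrightarrow> has_line p t W2"
    and c: "congruent W1 (pencil_plane d z)" "congruent W2 (pencil_plane d' w)"
  obtains s where "s \<noteq> 0" "d' = d * s\<^sup>2"
proof -
  have V1: "symmetric_plane (pencil_plane d z)" "\<not> has_line p O5 (pencil_plane d z)"
    using symmetric_plane_congruent[OF W(1) c(1)] O5(1) has_line_congruent[OF c(1)] by blast+
  have V2: "symmetric_plane (pencil_plane d' w)" "\<not> has_line p O5 (pencil_plane d' w)"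
    using symmetric_plane_congruent[OF W(2) c(2)] O5(2) has_line_congruent[OF c(2)] by blast+
  have transfer: "has_line p t (pencil_plane d z) \<longleftrightarrow> has_line p t (pencil_plane d' w)" for t
    using same has_line_congruent[OF c(1)] has_line_congruent[OF c(2)] by blast
  have sq: "is_square d \<longleftrightarrow> is_square d'"
    using transfer[of O9] by (simp only: pencil_plane_O9[OF V1] pencil_plane_O9[OF V2])
  show ?thesis
  proof (cases "is_square d")
    case False
    moreover from False have "\<not> is_square d'" using sq by simp
    ultimately show ?thesis by (rule nonsquare_quotient) (rule that)
  next
    case True
    then obtain s t where st: "d = s * s" "d' = t * t" using sq by (auto simp: is_square_iff)
    have "is_square d'" using True sq by simp
    then have "d = 0 \<longleftrightarrow> d' = 0"
      using transfer[of O8_2] pencil_plane_O8_2[OF V1 two eps True] pencil_plane_O8_2[OF V2 two eps]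
      by blast
    then show ?thesis
    proof (cases "d = 0")
      case True
      with \<open>d = 0 \<longleftrightarrow> d' = 0\<close> show ?thesis by (intro that[of 1]) simp_all
    next
      case False
      with \<open>d = 0 \<longleftrightarrow> d' = 0\<close> st show ?thesis
        by (intro that[of "t / s"]) (auto simp: power2_eq_square)
    qed
  qed
qed

text \<open>
  Two planes of the form \<open>pencil_plane\<close> may be given the same parameter \<open>d\<close>. Without a line of
  type \<open>o\<^sub>1\<^sub>0\<close> the second parameter \<open>w\<close> is a unit, and it belongs to the class of \<open>1\<close> iff there is a
  line of type \<open>o\<^sub>1\<^sub>6\<close>.
\<close>

lemma congruent_if_no_O6:
  fixes W1 W2 :: "'a::{field,finite} mat3 set"
  assumes two: "(2::'a) \<noteq> 0" and eps: "\<not> is_square (eps p)" and star: "cond_star (u10 p) (v10 p)"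
    and W: "symmetric_plane W1" "symmetric_plane W2"
    and pt1: "veronese x y z \<in> W1" "(x, y, z) \<noteq> (0, 0, 0)"
    and pt2: "veronese x' y' z' \<in> W2" "(x', y', z') \<noteq> (0, 0, 0)"
    and O5: "\<not> has_line p O5 W1" "\<not> has_line p O5 W2"
    and O6: "\<not> has_line p O6 W1" "\<not> has_line p O6 W2"
    and same: "\<And>t. has_line p t W1 \<longleftrightarrow> has_line p t W2"
  shows "congruent W1 W2"
proof -
  have join: "congruent W1 W2" if "congruent W1 V" "congruent W2 V'" "congruent V V'" for V V'
    using that congruent_sym congruent_trans by blast
  note same_parameter = pencil_parameter[OF two eps W O5 same]
  consider "has_line p O10 W1" | "has_line p O16 W1" | "\<not> has_line p O10 W1" "\<not> has_line p O16 W1" by blast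
  then show ?thesis
  proof cases
    case 1
    then have "has_line p O10 W2" using same by simp
    then show ?thesis
      using planes_with_O10[OF W(1) pt1 O5(1) 1 star] planes_with_O10[OF W(2) pt2 O5(2) _ star]
        join congruent_refl by blast
  next
    case 2
    then have 2: "has_line p O16 W1" "has_line p O16 W2" using same by simp_all
    obtain d where d: "congruent W1 (pencil_plane d (1, 0))"
      by (rule planes_with_O16[OF W(1) pt1 O5(1) O6(1) 2(1) two])
    obtain d' where d': "congruent W2 (pencil_plane d' (1, 0))"
      by (rule planes_with_O16[OF W(2) pt2 O5(2) O6(2) 2(2) two])
    obtain s where s: "s \<noteq> 0" "d' = d * s\<^sup>2" by (rule same_parameter[OF d d'])
    have 1: "congruent (pencil_plane d (1, 0)) (pencil_plane d' (s, 0))"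
      using pencil_plane_rescale[OF symmetric_plane_congruent[OF W(1) d] s(1)] s(2) by simp
    have V: "symmetric_plane (pencil_plane d' (s, 0))"
      using symmetric_plane_congruent W(1) d 1 by blast
    have "congruent (pencil_plane d' (s, 0)) (pencil_plane d' (qscale (inverse s) (s, 0)))"
      by (rule pencil_plane_scale[OF V]) (use s in simp)
    then have "congruent (pencil_plane d' (s, 0)) (pencil_plane d' (1, 0))"
      using s(1) by (simp add: qscale_def)
    then show ?thesis using join[OF d d'] congruent_trans[OF 1] by blast
  next
    case 3
    have normal: "\<exists>d w. congruent V (pencil_plane d w)"
      if V: "symmetric_plane V" "veronese x y z \<in> V" "(x, y, z) \<noteq> (0, 0, 0)" "\<not> has_line p O6 V"
      for V :: "'a mat3 set" and x y z
    proof -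
      obtain V' where V': "congruent V V'" "symmetric_plane V'" "sym3 1 0 0 0 0 0 \<in> V'"
        by (rule congruent_plane_through_E11[OF V(1-3)])
      have "\<not> has_line p O6 V'" using V(4) has_line_congruent[OF V'(1)] by blast
      then obtain d w where "congruent V' (pencil_plane d w)"
        by (rule planes_without_O6[OF two V'(2,3)])
      then show ?thesis using congruent_trans[OF V'(1)] by blast
    qed
    have generic: "qnorm d w \<noteq> 0 \<and> \<not> cube_class d (1, 0) w"
      if V: "symmetric_plane (pencil_plane d w)" "\<not> has_line p O5 (pencil_plane d w)"
        "\<not> has_line p O10 (pencil_plane d w)" "\<not> has_line p O16 (pencil_plane d w)" for d w
    proof
      show "qnorm d w \<noteq> 0"
      proof
        assume "qnorm d w = 0"
        then have "w = (0, 0)" "\<not> is_square d" using pencil_plane_norm[OF V(1,2)] by blast+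
        then show False using pencil_plane_O10[OF two star] V(3) by blast
      qed
      show "\<not> cube_class d (1, 0) w"
      proof
        assume "cube_class d (1, 0) w"
        then have "cube_class d w (1, 0)" by (rule cube_class_sym)
        then have "congruent (pencil_plane d w) (pencil_plane d (1, 0))"
          by (rule pencil_plane_cube_class[OF V(1)])
        then show False using pencil_plane_O16[OF two] has_line_congruent V(4) by blast
      qed
    qed
    obtain d w where d: "congruent W1 (pencil_plane d w)" using normal[OF W(1) pt1 O6(1)] by blast
    obtain d' w' where d': "congruent W2 (pencil_plane d' w')" using normal[OF W(2) pt2 O6(2)] by blast
    obtain s where s: "s \<noteq> 0" "d' = d * s\<^sup>2" by (rule same_parameter[OF d d'])
    obtain b a where w: "w = (b, a)" by (cases w)
    have "congruent (pencil_plane d w) (pencil_plane d' (b * s, a))"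
      using pencil_plane_rescale[OF _ s(1)] symmetric_plane_congruent[OF W(1) d] s(2) by (simp add: w)
    then have c: "congruent W1 (pencil_plane d' (b * s, a))" using d congruent_trans by blast
    have g1: "qnorm d' (b * s, a) \<noteq> 0 \<and> \<not> cube_class d' (1, 0) (b * s, a)"
      using symmetric_plane_congruent[OF W(1) c] has_line_congruent[OF c] O5(1) 3 by (intro generic) blast+
    have g2: "qnorm d' w' \<noteq> 0 \<and> \<not> cube_class d' (1, 0) w'"
      using symmetric_plane_congruent[OF W(2) d'] has_line_congruent[OF d'] O5(2) 3 same by (intro generic) blast+
    have "congruent (pencil_plane d' (b * s, a)) (pencil_plane d' w')"
      using congruent_same_parameter[OF symmetric_plane_congruent[OF W(1) c]] g1 g2 by blast
    then show ?thesis by (rule join[OF c d'])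
  qed
qed

text \<open>
  Each of the five normal forms has its own pattern of occurrences of \<open>o\<^sub>1\<^sub>2\<close>, \<open>o\<^sub>9\<close> and \<open>o\<^sub>6\<close>.
\<close>

lemma congruent_if_O5:
  fixes W1 W2 :: "'a::{field,finite} mat3 set"
  assumes two: "(2::'a) \<noteq> 0" 
    and W: "symmetric_plane W1" "symmetric_plane W2"
    and O5: "has_line p O5 W1" "has_line p O5 W2"
    and same: "\<And>t. has_line p t W1 \<longleftrightarrow> has_line p t W2"
  shows "congruent W1 W2"
proof -
  have cases: "congruent V triangle_plane \<and> \<not> has_line p O12 V \<and> \<not> has_line p O9 V \<and> \<not> has_line p O6 V \<or>
    congruent V chord_plane \<and> \<not> has_line p O12 V \<and> has_line p O9 V \<and> \<not> has_line p O6 V \<or>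
    congruent V conic_plane \<and> \<not> has_line p O12 V \<and> \<not> has_line p O9 V \<and> has_line p O6 V \<or>
    congruent V point_tangent_plane \<and> \<not> has_line p O12 V \<and> has_line p O9 V \<and> has_line p O6 V \<or>
    congruent V bisecant_plane \<and> has_line p O12 V"
    if V: "symmetric_plane V" "has_line p O5 V" for V :: "'a mat3 set"
    using planes_with_O5[OF two V] has_line_congruent[of V _ p]
      O5_normal_forms_O12[OF two, of p] O5_normal_forms_O9[of p] O5_normal_forms_O6[OF two, of p]
    by (elim disjE) simp_all
  have join: "congruent W1 W2" if "congruent W1 V" "congruent W2 V" for V
    using that congruent_sym congruent_trans by blast
  note V1 = cases[OF W(1) O5(1)] and V2 = cases[OF W(2) O5(2), folded same]
  consider "has_line p O12 W1" | "\<not> has_line p O12 W1" "has_line p O9 W1" "has_line p O6 W1"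
    | "\<not> has_line p O12 W1" "has_line p O9 W1" "\<not> has_line p O6 W1"
    | "\<not> has_line p O12 W1" "\<not> has_line p O9 W1" "has_line p O6 W1"
    | "\<not> has_line p O12 W1" "\<not> has_line p O9 W1" "\<not> has_line p O6 W1"
    by blast
  then show ?thesis
  proof cases
    case 1
    with V1 V2 have "congruent W1 bisecant_plane" "congruent W2 bisecant_plane" by auto
    then show ?thesis by (rule join)
  next
    case 2
    with V1 V2 have "congruent W1 point_tangent_plane" "congruent W2 point_tangent_plane" by auto
    then show ?thesis by (rule join)
  next
    case 3
    with V1 V2 have "congruent W1 chord_plane" "congruent W2 chord_plane" by auto
    then show ?thesis by (rule join)
  next
    case 4
    with V1 V2 have "congruent W1 conic_plane" "congruent W2 conic_plane" by auto
    then show ?thesis by (rule join)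
  next
    case 5
    with V1 V2 have "congruent W1 triangle_plane" "congruent W2 triangle_plane" by auto
    then show ?thesis by (rule join)
  qed
qed

theorem corollary1p2:
  fixes N\<^sub>1 N\<^sub>2 :: "('a::{field,finite}^3 \<Rightarrow> 'a) set"
    and p :: "'a line_params"
  assumes "odd CARD('a)"
    and "admissible p"
    and "rank_one_net N\<^sub>1"
    and "rank_one_net N\<^sub>2"
    and "line_orbit_distribution p (plane_of_net N\<^sub>1) = line_orbit_distribution p (plane_of_net N\<^sub>2)"
  shows "PGL_orbit N\<^sub>1 = PGL_orbit N\<^sub>2"
proof -
  let ?W1 = "plane_of_net N\<^sub>1" and ?W2 = "plane_of_net N\<^sub>2"
  have two: "(2::'a) \<noteq> 0" using assms(1) by (rule two_neq_zero)
  have eps: "\<not> is_square (eps p)" and star: "cond_star (u10 p) (v10 p)"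
    using assms(2) by (auto simp: admissible_def)
  have W: "symmetric_plane ?W1" "symmetric_plane ?W2"
    using rank_one_net_plane(1)[OF two] assms(3,4) by blast+
  obtain x y z where pt1: "(x, y, z) \<noteq> (0, 0, 0)" "veronese x y z \<in> ?W1"
    using rank_one_net_plane(2)[OF two assms(3)] by blast
  obtain x' y' z' where pt2: "(x', y', z') \<noteq> (0, 0, 0)" "veronese x' y' z' \<in> ?W2"
    using rank_one_net_plane(2)[OF two assms(4)] by blast
  have same: "has_line p t ?W1 \<longleftrightarrow> has_line p t ?W2" for t
    using line_orbit_distribution_eq_0_iff[of p ?W1 t] line_orbit_distribution_eq_0_iff[of p ?W2 t] assms(5)
    by simp
  have "congruent ?W1 ?W2"
  proof (cases "has_line p O5 ?W1")
    case True
    then have "has_line p O5 ?W2" using same by blast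
    with True show ?thesis using same by (rule congruent_if_O5[OF two W])
  next
    case False
    note O5 = False
    then have O5': "\<not> has_line p O5 ?W2" using same by blast
    show ?thesis
    proof (cases "has_line p O6 ?W1")
      case True
      then have "has_line p O6 ?W2" using same by blast
      with True show ?thesis using same by (rule congruent_if_O6[OF two eps W O5 O5'])
    next
      case False
      then have "\<not> has_line p O6 ?W2" using same by blast
      with False show ?thesis
        using same by (rule congruent_if_no_O6[OF two eps star W pt1(2,1) pt2(2,1) O5 O5'])
    qed
  qed
  then show ?thesis
    using PGL_orbit_eqI[OF two] assms(3,4) by (auto simp: rank_one_net_def)
qed

end
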